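(* Let $\mathcal{P}=(P,d\mu,d\sigma)$ be an $n$-dimensional system with $n\ge2$. (1) For every $T>0$ there exists a unique $u^{\mathrm{can}}_T\in\mathcal{M}^1(P)$ minimizing $F_{\mathcal{P}}(T,\cdot)$ on $\mathcal{M}^1(P)$, and it lies in $\mathcal{M}^{\frac{n}{n-1}}(P)$. (2) For $T=0$ there exists a unique $u^{\mathrm{can}}_0\in\mathcal{M}^{1}(P)$ such that $u^{\mathrm{can}}_0$ minimizes $U_{\mathcal{P}}$ on $\mathcal{M}^1(P)$ and $S_{\mathcal{P}}(u^{\mathrm{can}}_0)=\max\{S_{\mathcal{P}}(u): u\in\mathcal{M}^1(P),\ U_{\mathcal{P}}(u)=\min U_{\mathcal{P}}\}$; moreover $u^{\mathrm{can}}_0\in\mathcal{M}^{\frac{n}{n-1}}(P)$.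
   Context: An $n$-dimensional system is a triple $\mathcal{P}=(P,d\mu,d\sigma)$ where $P$ is a simple polytope in an $n$-dimensional real affine space $V$ (a compact subset with non-empty interior that is a finite intersection of closed half spaces, such that every vertex is the intersection of exactly $n$ facets), $d\mu$ is the restriction to $P$ of a translation-invariant measure on $V$ that is positive and finite on bounded non-empty open sets (i.e. a positive multiple of Lebesgue measure), and $d\sigma$ is a measure on the boundary $\partial P$ whose restriction to each facet is a positive multiple of the Lebesgue measure of the affine hyperplane spanned by that facet. For $p\ge1$, $\mathcal{M}^p(P)$ is the set of lower semicontinuous functions $u:P\to(0,\infty]$ that are log-convex ($u((1-t)x+ty)\le u(x)^{1-t}u(y)^t$ for $x,y\in P$, $t\in[0,1]$) and satisfy $\int_P u\,d\mu=\int_P d\mu$ and $\int_P u^p\,d\mu<\infty$. For $u\in\mathcal{M}^1(P)$: entropy $S_{\mathcal{P}}(u):=-\frac{1}{\int_Pd\mu}\int_P u\log u\,d\mu\in[-\infty,0]$; internal $\mu$-energy $U_{\mathcal{P}}(u):=\frac{1}{\int_Pd\mu}\int_{\partial P}u\,d\sigma\in(0,\infty]$; and for $T\in\mathbb{R}$, free $\mu$-energy $F_{\mathcal{P}}(T,u):=U_{\mathcal{P}}(u)-TS_{\mathcal{P}}(u)$ if $S_{\mathcal{P}}(u)>-\infty$, and $F_{\mathcal{P}}(T,u):=+\infty$ if $S_{\mathcal{P}}(u)=-\infty$. *)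

theory Defs
  imports "HOL-Analysis.Analysis"
begin

definition simple_polytope :: "'a::euclidean_space set \<Rightarrow> bool" where
  "simple_polytope P \<longleftrightarrow> polytope P \<and> interior P \<noteq> {} \<and>
     (\<forall>v. v extreme_point_of P \<longrightarrow> card {F. F facet_of P \<and> v \<in> F} = DIM('a))"

text \<open>(n-1)-dimensional Lebesgue measure of a set A contained in an affine hyperplane H:
  the n-dimensional volume of the right prism of height 1 over A, built with a unit normal
  vector of H.\<close>

definition hyperplane_normal :: "'a::euclidean_space set \<Rightarrow> 'a" where
  "hyperplane_normal H = (SOME u. norm u = 1 \<and> (\<forall>y\<in>H. \<forall>z\<in>H. u \<bullet> (y - z) = 0))"

definition hyperplane_lebesgue :: "'a::euclidean_space set \<Rightarrow> 'a set \<Rightarrow> ennreal" where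
  "hyperplane_lebesgue H A =
     emeasure lborel {x + t *\<^sub>R hyperplane_normal H | x t. x \<in> A \<and> t \<in> {0..1::real}}"

text \<open>A system (P, d\<mu>, d\<sigma>): d\<mu> = c \<cdot> (Lebesgue measure restricted to P) with c > 0,
  and d\<sigma> a Borel measure concentrated on the boundary of P whose restriction to each facet
  F is a positive multiple of the Lebesgue measure of the hyperplane spanned by F.\<close>

definition n_system :: "'a::euclidean_space set \<Rightarrow> real \<Rightarrow> 'a measure \<Rightarrow> bool" where
  "n_system P c \<sigma> \<longleftrightarrow> simple_polytope P \<and> c > 0 \<and>
     sets \<sigma> = sets borel \<and> emeasure \<sigma> (UNIV - frontier P) = 0 \<and>
     (\<forall>F. F facet_of P \<longrightarrow> (\<exists>k::real. k > 0 \<and>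
        (\<forall>A \<in> sets borel. A \<subseteq> F \<longrightarrow>
           emeasure \<sigma> A = ennreal k * hyperplane_lebesgue (affine hull F) A)))"

definition mu_int :: "'a::euclidean_space set \<Rightarrow> real \<Rightarrow> ('a \<Rightarrow> ennreal) \<Rightarrow> ennreal" where
  "mu_int P c f = ennreal c * (\<integral>\<^sup>+ x. f x * indicator P x \<partial>lborel)"

definition epowr :: "ennreal \<Rightarrow> real \<Rightarrow> ennreal" where
  "epowr v p = (if v = \<infinity> then \<infinity> else ennreal (enn2real v powr p))"

definition lsc_on :: "'a::topological_space set \<Rightarrow> ('a \<Rightarrow> ennreal) \<Rightarrow> bool" where
  "lsc_on P u \<longleftrightarrow> (\<forall>x\<in>P. \<forall>a. a < u x \<longrightarrow> eventually (\<lambda>y. a < u y) (at x within P))"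

definition log_convex_on :: "'a::real_vector set \<Rightarrow> ('a \<Rightarrow> ennreal) \<Rightarrow> bool" where
  "log_convex_on P u \<longleftrightarrow> (\<forall>x\<in>P. \<forall>y\<in>P. \<forall>t\<in>{0..1::real}.
      u ((1 - t) *\<^sub>R x + t *\<^sub>R y) \<le> epowr (u x) (1 - t) * epowr (u y) t)"

definition Mp :: "real \<Rightarrow> 'a::euclidean_space set \<Rightarrow> real \<Rightarrow> ('a \<Rightarrow> ennreal) set" where
  "Mp p P c = {u. (\<forall>x. x \<notin> P \<longrightarrow> u x = 0) \<and> (\<forall>x\<in>P. u x > 0) \<and>
      lsc_on P u \<and> log_convex_on P u \<and>
      mu_int P c u = mu_int P c (\<lambda>_. 1) \<and>
      mu_int P c (\<lambda>x. epowr (u x) p) < \<infinity>}"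

definition xlogx :: "ennreal \<Rightarrow> ereal" where
  "xlogx v = (if v = \<infinity> then \<infinity> else ereal (enn2real v * ln (enn2real v)))"

text \<open>Integral of u log u d\<mu> over P (positive part minus negative part; the negative
  part is always finite).\<close>
definition ulogu_int :: "'a::euclidean_space set \<Rightarrow> real \<Rightarrow> ('a \<Rightarrow> ennreal) \<Rightarrow> ereal" where
  "ulogu_int P c u =
     enn2ereal (mu_int P c (\<lambda>x. e2ennreal (xlogx (u x))))
     - enn2ereal (mu_int P c (\<lambda>x. e2ennreal (- xlogx (u x))))"

definition entropy :: "'a::euclidean_space set \<Rightarrow> real \<Rightarrow> ('a \<Rightarrow> ennreal) \<Rightarrow> ereal" where
  "entropy P c u = - ulogu_int P c u / enn2ereal (mu_int P c (\<lambda>_. 1))"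

definition internal_energy ::
    "'a::euclidean_space set \<Rightarrow> real \<Rightarrow> 'a measure \<Rightarrow> ('a \<Rightarrow> ennreal) \<Rightarrow> ereal" where
  "internal_energy P c \<sigma> u = enn2ereal (\<integral>\<^sup>+ x. u x * indicator (frontier P) x \<partial>\<sigma>)
      / enn2ereal (mu_int P c (\<lambda>_. 1))"

definition free_energy ::
    "'a::euclidean_space set \<Rightarrow> real \<Rightarrow> 'a measure \<Rightarrow> real \<Rightarrow> ('a \<Rightarrow> ennreal) \<Rightarrow> ereal" where
  "free_energy P c \<sigma> T u =
     (if entropy P c u = - \<infinity> then \<infinity>
      else internal_energy P c \<sigma> u - ereal T * entropy P c u)"

end

theory Submission
  imports Defs
begin

text \<open>The functionals are convex under arithmetic means of log-convex functions, and the entropy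
  is convex with a quantitative gap: the defect at the midpoint of \<open>u\<close> and \<open>v\<close> dominates the squared
  Hellinger distance \<open>\<integral> (\<surd>u - \<surd>v)\<^sup>2 / 4\<close>. Hence minimising sequences (for \<open>T = 0\<close>,
  lexicographically minimising ones: energy first, entropy second) are Cauchy for this distance, so
  a fast subsequence converges almost everywhere without loss of mass. Functions in the class
  with prescribed integral are locally equi-Lipschitz in the interior, so convergence holds at
  every interior point; the limit is extended to the boundary along rays, and
  Fatou's lemma gives lower semicontinuity of both functionals. The gap also gives uniqueness.

  For the integrability exponent, let \<open>u > t\<close> at a point of relative depth \<open>d\<close>.
  Convexity forces \<open>u > t\<close> on half of a ball of radius comparable to \<open>d\<close>, and the radial projection
  to the boundary of this set has \<open>\<sigma>\<close>-measure at least a multiple of \<open>d\<^bsup>n-1\<^esup>\<close>; so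
  \<open>d \<le> C (U / t)\<^bsup>1/(n-1)\<^esup>\<close>. The set where \<open>u > t\<close> therefore lies in a thin cone shell over
  its trace on the boundary, and summing over dyadic \<open>t\<close> bounds the integral of \<open>u\<^bsup>n/(n-1)\<^esup>\<close> in terms of
  the energy. In particular the entropy is bounded on energy sublevels, which is what
  the case \<open>T = 0\<close> needs.\<close>

section \<open>Volume of cone shells over facets\<close>

text \<open>The energy is affine under arithmetic means and cannot separate two states, so every gap
  has to come from the entropy. For \<open>T = 0\<close> the set of energy minimisers is not known
  to be nonempty beforehand; the entropy term is therefore minimised in a relaxed sense, through the
  limit as e tends to 0 of its infima over states whose energy is within e of the infimum. Midpoints
  stay among these states.

  The measure \<open>\<sigma>\<close> lives on a null set of \<open>lborel\<close>, so convergence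
  almost everywhere by itself says nothing about the energy. Log-convexity and lower semicontinuity
  together determine boundary values by interior ones on a single ray, which is why convergence is
  needed at each interior point.

  The exponent comes from a cancellation. A superlevel set at level t has volume at most a multiple
  of t^(-1/(n-1)) times the \<open>\<sigma>\<close>-measure of its trace. Raising the power of u
  from 1 to n/(n-1) costs exactly t^(1/(n-1)), and what remains is the layer-cake sum of the
  boundary integral of u.\<close>

lemma nn_integral_lborel_affine:
  fixes f :: "'a::euclidean_space \<Rightarrow> ennreal"
  assumes [measurable]: "f \<in> borel_measurable borel" and c: "c \<noteq> 0"
  shows "(\<integral>\<^sup>+x. f x \<partial>lborel) = ennreal (\<bar>c\<bar> ^ DIM('a)) * (\<integral>\<^sup>+x. f (t + c *\<^sub>R x) \<partial>lborel)"
  by (subst lborel_affine[OF c, of t])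
     (simp add: nn_integral_density nn_integral_distr nn_integral_cmult)

lemma emeasure_lborel_affine:
  fixes A :: "'a::euclidean_space set"
  assumes [measurable]: "A \<in> sets borel" and c: "c \<noteq> 0"
  shows "emeasure lborel A = ennreal (\<bar>c\<bar> ^ DIM('a)) * emeasure lborel {x. t + c *\<^sub>R x \<in> A}"
proof -
  have "emeasure lborel A = (\<integral>\<^sup>+x. indicator A x \<partial>lborel)"
    by simp
  also have "\<dots> = ennreal (\<bar>c\<bar> ^ DIM('a)) * (\<integral>\<^sup>+x. indicator A (t + c *\<^sub>R x) \<partial>lborel)"
    by (rule nn_integral_lborel_affine[OF _ c]) simp
  also have "(\<lambda>x. indicator A (t + c *\<^sub>R x) :: ennreal) = indicator {x. t + c *\<^sub>R x \<in> A}"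
    by (auto simp: indicator_def)
  also have "(\<integral>\<^sup>+x. indicator {x. t + c *\<^sub>R x \<in> A} x \<partial>lborel) = emeasure lborel {x. t + c *\<^sub>R x \<in> A}"
    by (rule nn_integral_indicator) measurable
  finally show ?thesis .
qed

text \<open>Averaging over translates along \<open>w\<close> gives Fubini's theorem for the orthogonal
  splitting along \<open>w\<close>, with the slab standing in for Lebesgue measure on the hyperplane.\<close>

lemma nn_integral_slab:
  fixes f :: "'a::euclidean_space \<Rightarrow> ennreal"
  assumes [measurable]: "f \<in> borel_measurable borel" and w: "norm w = 1"
  shows "(\<integral>\<^sup>+x. f x \<partial>lborel) =
    (\<integral>\<^sup>+x. indicator {0..1} (w \<bullet> x) * (\<integral>\<^sup>+s. f (x - (w \<bullet> x) *\<^sub>R w + s *\<^sub>R w) \<partial>lborel) \<partial>lborel)"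
proof -
  have ww: "w \<bullet> w = 1" using w by (simp add: dot_square_norm)
  have one: "(\<integral>\<^sup>+s. indicator {0..1} (r - s) \<partial>(lborel::real measure)) = (1::ennreal)" for r :: real
  proof -
    have "(\<integral>\<^sup>+s. indicator {0..1} (r - s) \<partial>lborel) = (\<integral>\<^sup>+s. indicator {r-1..r} s \<partial>(lborel::real measure))"
      by (intro nn_integral_cong) (auto simp: indicator_def)
    also have "\<dots> = 1" by simp
    finally show ?thesis .
  qed
  have "(\<integral>\<^sup>+x. f x \<partial>lborel) = (\<integral>\<^sup>+x. (\<integral>\<^sup>+s. f x * indicator {0..1} (w \<bullet> x - s) \<partial>(lborel::real measure)) \<partial>lborel)"
    by (intro nn_integral_cong, subst nn_integral_cmult) (auto simp: one)
  also have "\<dots> = (\<integral>\<^sup>+s. (\<integral>\<^sup>+x. f x * indicator {0..1} (w \<bullet> x - s) \<partial>lborel) \<partial>(lborel::real measure))"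
    by (rule lborel_pair.Fubini'[symmetric]) simp
  also have "\<dots> = (\<integral>\<^sup>+s. (\<integral>\<^sup>+x. f (s *\<^sub>R w + x) * indicator {0..1} (w \<bullet> x) \<partial>lborel) \<partial>(lborel::real measure))"
  proof (rule nn_integral_cong)
    fix s :: real
    show "(\<integral>\<^sup>+x. f x * indicator {0..1} (w \<bullet> x - s) \<partial>lborel) = (\<integral>\<^sup>+x. f (s *\<^sub>R w + x) * indicator {0..1} (w \<bullet> x) \<partial>lborel)"
      using nn_integral_lborel_affine[of "\<lambda>x. f x * indicator {0..1} (w \<bullet> x - s)" 1 "s *\<^sub>R w"]
      by (simp add: inner_add_right ww)
  qed
  also have "\<dots> = (\<integral>\<^sup>+x. (\<integral>\<^sup>+s. f (s *\<^sub>R w + x) * indicator {0..1} (w \<bullet> x) \<partial>(lborel::real measure)) \<partial>lborel)"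
    by (rule lborel_pair.Fubini') simp
  also have "\<dots> = (\<integral>\<^sup>+x. indicator {0..1} (w \<bullet> x) * (\<integral>\<^sup>+s. f (x - (w \<bullet> x) *\<^sub>R w + s *\<^sub>R w) \<partial>lborel) \<partial>lborel)"
  proof (intro nn_integral_cong)
    fix x :: 'a
    have "(\<integral>\<^sup>+s. f (s *\<^sub>R w + x) * indicator {0..1} (w \<bullet> x) \<partial>(lborel::real measure)) =
       indicator {0..1} (w \<bullet> x) * (\<integral>\<^sup>+s. f (s *\<^sub>R w + x) \<partial>(lborel::real measure))"
      by (subst nn_integral_multc) (auto simp: mult.commute)
    also have "(\<integral>\<^sup>+s. f (s *\<^sub>R w + x) \<partial>(lborel::real measure)) = (\<integral>\<^sup>+s. f (x - (w \<bullet> x) *\<^sub>R w + s *\<^sub>R w) \<partial>lborel)"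
      by (subst nn_integral_real_affine[of _ 1 "- (w \<bullet> x)"]) (auto simp: algebra_simps)
    finally show "(\<integral>\<^sup>+s. f (s *\<^sub>R w + x) * indicator {0..1} (w \<bullet> x) \<partial>(lborel::real measure)) =
       indicator {0..1} (w \<bullet> x) * (\<integral>\<^sup>+s. f (x - (w \<bullet> x) *\<^sub>R w + s *\<^sub>R w) \<partial>lborel)" .
  qed
  finally show ?thesis .
qed

text \<open>For \<open>norm w = 1\<close> only the points of \<open>B\<close> orthogonal to
  \<open>w\<close> count, so \<open>emeasure lborel (prism w 1 B)\<close> is the (n-1)-dimensional
  Lebesgue measure of that part of \<open>B\<close>, expressed by the measure of the whole
  space.\<close>

definition prism :: "'a::euclidean_space \<Rightarrow> real \<Rightarrow> 'a set \<Rightarrow> 'a set" where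
  "prism w h B = {x. w \<bullet> x \<in> {0..h} \<and> x - (w \<bullet> x) *\<^sub>R w \<in> B}"

lemma sets_prism [measurable]:
  assumes [measurable]: "B \<in> sets borel"
  shows "prism w h B \<in> sets borel"
  unfolding prism_def by measurable

lemma emeasure_prism:
  assumes [measurable]: "B \<in> sets borel" and w: "norm w = 1" and h: "h \<ge> 0"
  shows "emeasure lborel (prism w h B) = ennreal h * emeasure lborel (prism w 1 B)"
proof -
  have ww: "w \<bullet> w = 1" using w by (simp add: dot_square_norm)
  have "emeasure lborel (prism w h B) = (\<integral>\<^sup>+x. indicator (prism w h B) x \<partial>lborel)"
    by simp
  also have "\<dots> = (\<integral>\<^sup>+x. indicator {0..1} (w \<bullet> x) *
      (\<integral>\<^sup>+s. indicator (prism w h B) (x - (w \<bullet> x) *\<^sub>R w + s *\<^sub>R w) \<partial>lborel) \<partial>lborel)"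
    by (rule nn_integral_slab[OF _ w]) simp
  also have "\<dots> = (\<integral>\<^sup>+x. ennreal h * indicator (prism w 1 B) x \<partial>lborel)"
  proof (intro nn_integral_cong)
    fix x :: 'a
    let ?p = "x - (w \<bullet> x) *\<^sub>R w"
    have "(\<integral>\<^sup>+s. indicator (prism w h B) (?p + s *\<^sub>R w) \<partial>lborel) = (\<integral>\<^sup>+s. indicator B ?p * indicator {0..h} s \<partial>(lborel::real measure))"
      by (intro nn_integral_cong) (auto simp: indicator_def prism_def algebra_simps ww)
    also have "\<dots> = ennreal h * indicator B ?p"
      using h by (subst nn_integral_cmult) (auto simp: mult.commute)
    finally show "indicator {0..1} (w \<bullet> x) * (\<integral>\<^sup>+s. indicator (prism w h B) (?p + s *\<^sub>R w) \<partial>lborel)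
        = ennreal h * indicator (prism w 1 B) x"
      by (auto simp: indicator_def prism_def)
  qed
  also have "\<dots> = ennreal h * emeasure lborel (prism w 1 B)"
    by (subst nn_integral_cmult) auto
  finally show ?thesis .
qed

text \<open>For \<open>B\<close> orthogonal to \<open>w\<close>, the set below is the part with radial parameter in \<open>[1 - e, 1]\<close>
  of the cone from the origin over \<open>B + \<beta> w\<close>.\<close>

lemma emeasure_cone_shell:
  fixes w :: "'a::euclidean_space"
  assumes [measurable]: "B \<in> sets borel" and w: "norm w = 1" and e: "0 \<le> e" and b: "\<beta> \<noteq> 0"
  shows "emeasure lborel {x. 1 - e \<le> (w \<bullet> x) / \<beta> \<and> 0 < (w \<bullet> x) / \<beta> \<and> (w \<bullet> x) / \<beta> \<le> 1 \<and>
            (1 / ((w \<bullet> x) / \<beta>)) *\<^sub>R (x - (w \<bullet> x) *\<^sub>R w) \<in> B}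
     \<le> ennreal (e * \<bar>\<beta>\<bar>) * emeasure lborel (prism w 1 B)" (is "emeasure lborel ?S \<le> _")
proof -
  have ww: "w \<bullet> w = 1" using w by (simp add: dot_square_norm)
  define J where "J = {s. 1 - e \<le> s / \<beta> \<and> 0 < s / \<beta> \<and> s / \<beta> \<le> 1}"
  have [measurable]: "J \<in> sets borel" unfolding J_def by measurable
  have S[measurable]: "?S \<in> sets borel" by measurable
  define Q where "Q s x \<longleftrightarrow> w \<bullet> x \<in> {0..1} \<and> (1 / (s / \<beta>)) *\<^sub>R (x - (w \<bullet> x) *\<^sub>R w) \<in> B" for s x
  have [measurable]: "Measurable.pred borel (\<lambda>x. Q s x)" for s unfolding Q_def by measurable
  have Q2[measurable]: "Measurable.pred (lborel \<Otimes>\<^sub>M lborel) (\<lambda>(x,s). Q s x)" unfolding Q_def by measurable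
  have Q2'[measurable]: "Measurable.pred (lborel \<Otimes>\<^sub>M lborel) (\<lambda>p. Q (snd p) (fst p))" unfolding Q_def by measurable
  have slice: "emeasure lborel {x. Q s x} \<le> emeasure lborel (prism w 1 B)" if "s \<in> J" for s
  proof -
    define r where "r = s / \<beta>"
    have r: "0 < r" "r \<le> 1" using that by (auto simp: J_def r_def)
    have [measurable]: "{x. Q s x} \<in> sets borel" by measurable
    \<comment> \<open>Rescaling by \<open>r\<close> restores the base \<open>B\<close> but stretches
      the unit height to \<open>1/r\<close>. The factor \<open>r^n\<close> times the height
      \<open>1/r\<close> leaves \<open>r^(n-1)\<close>, which is at most 1.\<close>
    have "emeasure lborel {x. Q s x} = ennreal (\<bar>r\<bar> ^ DIM('a)) * emeasure lborel {x. 0 + r *\<^sub>R x \<in> {x. Q s x}}"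
      by (rule emeasure_lborel_affine) (use r in auto)
    also have "{x. 0 + r *\<^sub>R x \<in> {x. Q s x}} = prism w (1/r) B"
    proof -
      have "(1/r) *\<^sub>R (r *\<^sub>R x - (w \<bullet> (r *\<^sub>R x)) *\<^sub>R w) = x - (w \<bullet> x) *\<^sub>R w" for x
        using r by (simp add: algebra_simps)
      then show ?thesis using r
        by (auto simp: prism_def Q_def r_def[symmetric] pos_le_divide_eq mult.commute zero_le_mult_iff)
    qed
    also have "emeasure lborel \<dots> = ennreal (1/r) * emeasure lborel (prism w 1 B)"
      by (rule emeasure_prism) (use w r in auto)
    also have "ennreal (\<bar>r\<bar> ^ DIM('a)) * (ennreal (1/r) * emeasure lborel (prism w 1 B))
        = ennreal (r ^ (DIM('a) - 1)) * emeasure lborel (prism w 1 B)"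
    proof -
      have "\<bar>r\<bar> ^ DIM('a) * (1/r) = r ^ (DIM('a) - 1)"
        using r by (simp add: power_eq_if)
      then show ?thesis using r by (simp add: ennreal_mult'[symmetric] mult.assoc[symmetric])
    qed
    also have "\<dots> \<le> ennreal 1 * emeasure lborel (prism w 1 B)"
      by (intro mult_right_mono ennreal_leI power_le_one) (use r in auto)
    finally show ?thesis by simp
  qed
  have "emeasure lborel ?S = (\<integral>\<^sup>+x. indicator ?S x \<partial>lborel)"
    by (rule nn_integral_indicator[symmetric]) (simp add: S)
  also have "\<dots> = (\<integral>\<^sup>+x. indicator {0..1} (w \<bullet> x) *
      (\<integral>\<^sup>+s. indicator ?S (x - (w \<bullet> x) *\<^sub>R w + s *\<^sub>R w) \<partial>lborel) \<partial>lborel)"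
    by (rule nn_integral_slab[OF _ w]) (rule borel_measurable_indicator[OF S])
  also have "\<dots> = (\<integral>\<^sup>+x. (\<integral>\<^sup>+s. indicator J s * indicator {x. Q s x} x \<partial>lborel) \<partial>lborel)"
  proof (intro nn_integral_cong)
    fix x :: 'a
    have "indicator {0..1} (w \<bullet> x) * (\<integral>\<^sup>+s. indicator ?S (x - (w \<bullet> x) *\<^sub>R w + s *\<^sub>R w) \<partial>lborel)
       = (\<integral>\<^sup>+s. indicator {0..1} (w \<bullet> x) * indicator ?S (x - (w \<bullet> x) *\<^sub>R w + s *\<^sub>R w) \<partial>lborel)"
      by (rule nn_integral_cmult[symmetric]) (use S in measurable)
    also have "\<dots> = (\<integral>\<^sup>+s. indicator J s * indicator {x. Q s x} x \<partial>lborel)"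
      by (intro nn_integral_cong) (auto simp: indicator_def Q_def J_def algebra_simps ww)
    finally show "indicator {0..1} (w \<bullet> x) * (\<integral>\<^sup>+s. indicator ?S (x - (w \<bullet> x) *\<^sub>R w + s *\<^sub>R w) \<partial>lborel)
       = (\<integral>\<^sup>+s. indicator J s * indicator {x. Q s x} x \<partial>lborel)" .
  qed
  also have "\<dots> = (\<integral>\<^sup>+s. (\<integral>\<^sup>+x. indicator J s * indicator {x. Q s x} x \<partial>lborel) \<partial>lborel)"
  proof (rule lborel_pair.Fubini'[symmetric])
    have "(\<lambda>p. indicator J (snd p) * indicator {p. Q (snd p) (fst p)} p :: ennreal)
        \<in> borel_measurable (lborel \<Otimes>\<^sub>M lborel)" by measurable
    then show "(\<lambda>(x,s). indicator J s * indicator {x. Q s x} x :: ennreal)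
        \<in> borel_measurable (lborel \<Otimes>\<^sub>M lborel)"
      by (simp add: case_prod_beta' indicator_def)
  qed
  also have "\<dots> = (\<integral>\<^sup>+s. indicator J s * emeasure lborel {x. Q s x} \<partial>lborel)"
    by (intro nn_integral_cong, subst nn_integral_cmult) auto
  also have "\<dots> \<le> (\<integral>\<^sup>+s. emeasure lborel (prism w 1 B) * indicator J s \<partial>lborel)"
    by (intro nn_integral_mono) (auto simp: indicator_def slice)
  also have "\<dots> = emeasure lborel (prism w 1 B) * emeasure lborel J"
    by (subst nn_integral_cmult) auto
  finally have le: "emeasure lborel ?S \<le> emeasure lborel (prism w 1 B) * emeasure lborel J" .
  \<comment> \<open>The admissible heights \<open>s\<close> lie in an interval of length
    \<open>e * \<bar>\<beta>\<bar>\<close>, whose end points swap when \<open>\<beta>\<close> is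
    negative.\<close>
  have J_le: "emeasure lborel J \<le> ennreal (e * \<bar>\<beta>\<bar>)"
  proof (cases "\<beta> > 0")
    case True
    then have "J \<subseteq> {(1-e)*\<beta>..\<beta>}" by (auto simp: J_def field_simps)
    then have "emeasure lborel J \<le> emeasure lborel {(1-e)*\<beta>..\<beta>}" by (intro emeasure_mono) auto
    then show ?thesis using True e by (simp add: algebra_simps split: if_splits)
  next
    case False
    then have "\<beta> < 0" using b by simp
    then have "J \<subseteq> {\<beta>..(1-e)*\<beta>}" by (auto simp: J_def field_simps)
    then have "emeasure lborel J \<le> emeasure lborel {\<beta>..(1-e)*\<beta>}" by (intro emeasure_mono) auto
    moreover have "\<beta> \<le> (1-e)*\<beta>" using \<open>\<beta> < 0\<close> e by (simp add: algebra_simps mult_nonpos_nonneg)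
    ultimately show ?thesis using \<open>\<beta> < 0\<close> by (simp add: algebra_simps split: if_splits)
  qed
  show ?thesis using order_trans[OF le mult_left_mono[OF J_le]] by (simp add: mult.commute)
qed


section \<open>Facets and the boundary measure\<close>

lemma facet_normal:
  fixes P :: "'a::euclidean_space set"
  assumes P: "polytope P" and z: "z \<in> interior P" and F: "F facet_of P"
  obtains \<beta> where "\<beta> \<noteq> 0" "norm (hyperplane_normal (affine hull F)) = 1"
    "\<And>x. x \<in> F \<Longrightarrow> hyperplane_normal (affine hull F) \<bullet> (x - z) / \<beta> = 1"
    "\<And>x. x \<in> P \<Longrightarrow> hyperplane_normal (affine hull F) \<bullet> (x - z) / \<beta> \<le> 1"
proof -
  define w where "w = hyperplane_normal (affine hull F)"
  obtain a b where a: "a \<noteq> 0" and Pab: "P \<subseteq> {x. a \<bullet> x \<le> b}" and Fab: "F = P \<inter> {x. a \<bullet> x = b}"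
    using facet_of_polyhedron[OF polytope_imp_polyhedron[OF P] F] by blast
  have zb: "a \<bullet> z < b"
  proof -
    have "z \<in> interior {x. a \<bullet> x \<le> b}" using z Pab interior_mono by blast
    then show ?thesis using a by (simp add: interior_halfspace_le)
  qed
  have dimP: "aff_dim P = int (DIM('a))" using z affine_hull_nonempty_interior aff_dim_eq_full by blast
  have hull: "affine hull F = {x. a \<bullet> x = b}"
  proof -
    have "aff_dim F = aff_dim {x. a \<bullet> x = b}"
      using F dimP a by (simp add: facet_of_def)
    then have "affine hull F = affine hull {x. a \<bullet> x = b}"
      using aff_dim_eq_full_gen[of F "{x. a \<bullet> x = b}"] Fab by auto
    then show ?thesis by (metis affine_hyperplane affine_hull_eq)
  qed
  have ex: "\<exists>u. norm u = 1 \<and> (\<forall>y\<in>affine hull F. \<forall>z\<in>affine hull F. u \<bullet> (y - z) = 0)"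
    unfolding hull using a by (intro exI[of _ "a /\<^sub>R norm a"]) (auto simp: inner_diff_right)
  have w: "norm w = 1" "\<And>y y'. a \<bullet> y = b \<Longrightarrow> a \<bullet> y' = b \<Longrightarrow> w \<bullet> (y - y') = 0"
    using someI_ex[OF ex] unfolding w_def hyperplane_normal_def hull by auto
  obtain y0 where y0: "y0 \<in> F" using F by (auto simp: facet_of_def)
  have ay0: "a \<bullet> y0 = b" using y0 Fab by auto
  define k where "k = (w \<bullet> a) / (a \<bullet> a)"
  have aa: "a \<bullet> a \<noteq> 0" using a by simp
  have wk: "w = k *\<^sub>R a"
  proof -
    have "w \<bullet> x = k * (a \<bullet> x)" for x
    proof -
      \<comment> \<open>Removing from \<open>x\<close> its component along \<open>a\<close> keeps
        the sum with \<open>y0\<close> in the hyperplane. Hence \<open>w\<close> vanishes on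
        everything orthogonal to \<open>a\<close>.\<close>
      have "w \<bullet> ((y0 + x - ((a \<bullet> x) / (a \<bullet> a)) *\<^sub>R a) - y0) = 0"
        by (rule w(2)) (use aa ay0 in \<open>auto simp: inner_diff_right inner_add_right\<close>)
      then show ?thesis by (simp add: k_def inner_diff_right mult.commute)
    qed
    then show ?thesis by (metis inner_scaleR_left vector_eq_rdot)
  qed
  have k: "k \<noteq> 0" using w(1) wk by auto
  show ?thesis
  proof (rule that)
    \<comment> \<open>This \<open>\<beta>\<close> is the signed distance from \<open>z\<close> to
      the hyperplane. The orientation of \<open>hyperplane_normal\<close> is an arbitrary choice,
      and dividing by \<open>\<beta>\<close> makes the functional equal to 1 on the facet either
      way.\<close>
    show "k * (b - a \<bullet> z) \<noteq> 0" using k zb by auto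
    show "norm (hyperplane_normal (affine hull F)) = 1" using w(1) by (simp add: w_def)
    show "hyperplane_normal (affine hull F) \<bullet> (x - z) / (k * (b - a \<bullet> z)) = 1" if "x \<in> F" for x
      using that Fab k zb unfolding w_def[symmetric] wk by (auto simp: inner_diff_right right_diff_distrib)
    show "hyperplane_normal (affine hull F) \<bullet> (x - z) / (k * (b - a \<bullet> z)) \<le> 1" if "x \<in> P" for x
    proof -
      have "a \<bullet> x \<le> b" using that Pab by auto
      moreover have "k *\<^sub>R a \<bullet> (x - z) / (k * (b - a \<bullet> z)) = (a \<bullet> x - a \<bullet> z) / (b - a \<bullet> z)"
        using k by (simp add: inner_diff_right flip: right_diff_distrib)
      ultimately show ?thesis
        using zb unfolding w_def[symmetric] wk by simp
    qed
  qed
qed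

text \<open>Translation by \<open>\<beta> *\<^sub>R w + z\<close> carries the hyperplane through 0
  orthogonal to \<open>w\<close> onto the one that contains \<open>F\<close>, so the slab over
  \<open>A\<close> can be measured at the origin, where \<open>emeasure_cone_shell\<close> is
  stated.\<close>

lemma facet_prism:
  fixes P :: "'a::euclidean_space set"
  assumes w: "w = hyperplane_normal (affine hull F)" "norm w = 1"
    and b: "\<beta> \<noteq> 0" and F: "\<And>x. x \<in> F \<Longrightarrow> w \<bullet> (x - z) / \<beta> = 1"
    and A[measurable]: "A \<in> sets borel" "A \<subseteq> F"
  shows "hyperplane_lebesgue (affine hull F) A = emeasure lborel (prism w 1 {p. p + \<beta> *\<^sub>R w + z \<in> A})"
proof -
  have ww: "w \<bullet> w = 1" using w(2) by (simp add: dot_square_norm)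
  have FA: "w \<bullet> (x - z) = \<beta>" if "x \<in> A" for x using F[of x] that A(2) b by auto
  define X where "X = {x. w \<bullet> (x - z) - \<beta> \<in> {0..1} \<and> x - (w \<bullet> (x - z) - \<beta>) *\<^sub>R w \<in> A}"
  have [measurable]: "X \<in> sets borel" unfolding X_def by measurable
  have "{x + t *\<^sub>R w | x t. x \<in> A \<and> t \<in> {0..1::real}} = X"
  proof (intro set_eqI iffI)
    fix v assume "v \<in> {x + t *\<^sub>R w | x t. x \<in> A \<and> t \<in> {0..1::real}}"
    then obtain x t where v: "v = x + t *\<^sub>R w" "x \<in> A" "t \<in> {0..1}" by auto
    have "w \<bullet> (v - z) = \<beta> + t" using FA[OF v(2)] v(1) ww by (simp add: algebra_simps inner_diff_right)
    then show "v \<in> X" using v by (simp add: X_def)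
  next
    fix v assume "v \<in> X"
    then show "v \<in> {x + t *\<^sub>R w | x t. x \<in> A \<and> t \<in> {0..1::real}}"
      unfolding X_def by (intro CollectI exI[of _ "v - (w \<bullet> (v - z) - \<beta>) *\<^sub>R w"] exI[of _ "w \<bullet> (v - z) - \<beta>"]) auto
  qed
  then have "hyperplane_lebesgue (affine hull F) A = emeasure lborel X"
    by (simp add: hyperplane_lebesgue_def w(1))
  also have "\<dots> = emeasure lborel {x. (\<beta> *\<^sub>R w + z) + 1 *\<^sub>R x \<in> X}"
    by (subst emeasure_lborel_affine[of X 1 "\<beta> *\<^sub>R w + z"]) auto
  also have "{x. (\<beta> *\<^sub>R w + z) + 1 *\<^sub>R x \<in> X} = prism w 1 {p. p + \<beta> *\<^sub>R w + z \<in> A}"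
    by (auto simp: X_def prism_def algebra_simps inner_diff_right ww)
  finally show ?thesis .
qed

text \<open>The shell over \<open>A\<close> is an image set, whose measurability is not evident; a
  Borel superset described by preimages takes its place. The constant is the distance of
  \<open>z\<close> from the hyperplane of \<open>F\<close>, the height of the cone.\<close>

lemma facet_shell:
  fixes P :: "'a::euclidean_space set"
  assumes P: "polytope P" and z: "z \<in> interior P" and F: "F facet_of P"
  shows "\<exists>C\<ge>0. \<forall>A\<in>sets borel. \<forall>e\<ge>0. A \<subseteq> F \<longrightarrow> (\<exists>S\<in>sets borel.
    {z + r *\<^sub>R (y - z) | y r. y \<in> A \<and> 1 - e \<le> r \<and> 0 < r \<and> r \<le> 1} \<subseteq> S \<and>
    emeasure lborel S \<le> ennreal (C * e) * hyperplane_lebesgue (affine hull F) A)"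
proof -
  define w where "w = hyperplane_normal (affine hull F)"
  obtain \<beta> where \<beta>: "\<beta> \<noteq> 0" "norm w = 1" "\<And>x. x \<in> F \<Longrightarrow> w \<bullet> (x - z) / \<beta> = 1"
    using facet_normal[OF P z F] unfolding w_def by metis
  have *: "\<exists>S\<in>sets borel.
    {z + r *\<^sub>R (y - z) | y r. y \<in> A \<and> 1 - e \<le> r \<and> 0 < r \<and> r \<le> 1} \<subseteq> S \<and>
    emeasure lborel S \<le> ennreal (\<bar>\<beta>\<bar> * e) * hyperplane_lebesgue (affine hull F) A"
    if A[measurable]: "A \<in> sets borel" and e: "e \<ge> 0" and AF: "A \<subseteq> F" for A and e :: real
  proof -
    define B where "B = {p. p + \<beta> *\<^sub>R w + z \<in> A}"
    have [measurable]: "B \<in> sets borel" unfolding B_def by measurable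
    define T where "T = {x. 1 - e \<le> (w \<bullet> x) / \<beta> \<and> 0 < (w \<bullet> x) / \<beta> \<and> (w \<bullet> x) / \<beta> \<le> 1 \<and>
            (1 / ((w \<bullet> x) / \<beta>)) *\<^sub>R (x - (w \<bullet> x) *\<^sub>R w) \<in> B}"
    have [measurable]: "T \<in> sets borel" unfolding T_def by measurable
    define S where "S = {x. x - z \<in> T}"
    have [measurable]: "S \<in> sets borel" unfolding S_def by measurable
    have "{z + r *\<^sub>R (y - z) | y r. y \<in> A \<and> 1 - e \<le> r \<and> 0 < r \<and> r \<le> 1} \<subseteq> S"
    proof clarify
      fix y r assume y: "y \<in> A" and r: "1 - e \<le> r" "0 < r" "r \<le> 1"
      have wy: "w \<bullet> (y - z) = \<beta>" using \<beta>(3)[of y] y AF \<beta>(1) by auto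
      have wr: "w \<bullet> (r *\<^sub>R (y - z)) / \<beta> = r" using \<beta>(1) by (simp add: wy)
      have wr': "w \<bullet> (r *\<^sub>R (y - z)) = r * \<beta>" by (simp add: wy)
      have "(1 / r) *\<^sub>R (r *\<^sub>R (y - z) - (w \<bullet> (r *\<^sub>R (y - z))) *\<^sub>R w) = (y - z) - \<beta> *\<^sub>R w"
        unfolding wr' using r by (simp add: scaleR_diff_right)
      then have "r *\<^sub>R (y - z) \<in> T"
        unfolding T_def mem_Collect_eq wr using r y by (simp add: B_def)
      then show "z + r *\<^sub>R (y - z) \<in> S" by (simp add: S_def)
    qed
    moreover have "emeasure lborel S \<le> ennreal (\<bar>\<beta>\<bar> * e) * hyperplane_lebesgue (affine hull F) A"
    proof -
      have "emeasure lborel S = emeasure lborel {x. z + 1 *\<^sub>R x \<in> S}"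
        by (subst emeasure_lborel_affine[of S 1 z]) auto
      also have "{x. z + 1 *\<^sub>R x \<in> S} = T" by (simp add: S_def)
      also have "emeasure lborel T \<le> ennreal (e * \<bar>\<beta>\<bar>) * emeasure lborel (prism w 1 B)"
        unfolding T_def by (rule emeasure_cone_shell) (use \<beta> e in auto)
      also have "emeasure lborel (prism w 1 B) = hyperplane_lebesgue (affine hull F) A"
        unfolding B_def using facet_prism[OF w_def \<beta>(2) \<beta>(1) \<beta>(3) A AF] by simp
      finally show ?thesis by (simp add: mult.commute)
    qed
    ultimately show ?thesis using \<open>S \<in> sets borel\<close> by blast
  qed
  then show ?thesis by (intro exI[of _ "\<bar>\<beta>\<bar>"] conjI ballI allI impI) simp_all
qed

lemma hyperplane_lebesgue_bounded:
  fixes P :: "'a::euclidean_space set"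
  assumes P: "polytope P" and F: "F facet_of P"
  shows "hyperplane_lebesgue (affine hull F) F < \<infinity>"
proof -
  have "bounded P" using P polytope_imp_bounded by blast
  then have "bounded F" using F facet_of_imp_subset bounded_subset by blast
  then obtain M where M: "\<And>x. x \<in> F \<Longrightarrow> norm x \<le> M" unfolding bounded_iff by blast
  let ?w = "hyperplane_normal (affine hull F)"
  have "{x + t *\<^sub>R ?w | x t. x \<in> F \<and> t \<in> {0..1::real}} \<subseteq> cball 0 (M + norm ?w)"
  proof clarify
    fix x and t :: real assume x: "x \<in> F" and t: "t \<in> {0..1}"
    have "norm (x + t *\<^sub>R ?w) \<le> norm x + \<bar>t\<bar> * norm ?w" by (metis norm_triangle_ineq norm_scaleR)
    also have "\<dots> \<le> M + 1 * norm ?w" by (intro add_mono mult_right_mono M x) (use t in auto)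
    finally show "x + t *\<^sub>R ?w \<in> cball 0 (M + norm ?w)" by simp
  qed
  then have "emeasure lborel {x + t *\<^sub>R ?w | x t. x \<in> F \<and> t \<in> {0..1::real}} \<le> emeasure lborel (cball (0::'a) (M + norm ?w))"
    by (intro emeasure_mono) auto
  also have "\<dots> < \<infinity>" by (rule emeasure_lborel_cball_finite)
  finally show ?thesis by (simp add: hyperplane_lebesgue_def)
qed

lemma n_system_frontier:
  fixes P :: "'a::euclidean_space set"
  assumes "n_system P c \<sigma>"
  shows "frontier P = \<Union>{F. F facet_of P}" "finite {F. F facet_of P}"
proof -
  have P: "polytope P" "interior P \<noteq> {}" using assms by (auto simp: n_system_def simple_polytope_def)
  show "frontier P = \<Union>{F. F facet_of P}"
    using rel_frontier_of_polyhedron[OF polytope_imp_polyhedron[OF P(1)]] P(2)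
    by (simp add: rel_frontier_nonempty_interior)
  show "finite {F. F facet_of P}" using finite_polytope_facets[OF P(1)] .
qed

lemma facet_sets_borel:
  assumes "polytope P" "F facet_of P"
  shows "F \<in> sets borel"
proof -
  have "polytope F" using assms face_of_polytope_polytope facet_of_imp_face_of by blast
  then show ?thesis by (intro borel_closed polytope_imp_closed)
qed

lemma emeasure_frontier_finite:
  fixes P :: "'a::euclidean_space set"
  assumes sys: "n_system P c \<sigma>"
  shows "emeasure \<sigma> (frontier P) < \<infinity>"
proof -
  have P: "polytope P" and sets: "sets \<sigma> = sets borel"
    using sys by (auto simp: n_system_def simple_polytope_def)
  have "emeasure \<sigma> (\<Union>F\<in>{F. F facet_of P}. F) \<le> (\<Sum>F\<in>{F. F facet_of P}. emeasure \<sigma> F)"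
    by (rule emeasure_subadditive_finite) (use n_system_frontier[OF sys] facet_sets_borel[OF P] sets in auto)
  also have "\<dots> < \<infinity>"
  proof -
    have "emeasure \<sigma> F < \<infinity>" if F: "F facet_of P" for F
    proof -
      obtain k where "k > 0" "\<forall>A \<in> sets borel. A \<subseteq> F \<longrightarrow>
           emeasure \<sigma> A = ennreal k * hyperplane_lebesgue (affine hull F) A"
        using sys F unfolding n_system_def by blast
      then have "emeasure \<sigma> F = ennreal k * hyperplane_lebesgue (affine hull F) F"
        using facet_sets_borel[OF P F] by auto
      then show ?thesis using hyperplane_lebesgue_bounded[OF P F]
        by (simp add: ennreal_mult_less_top)
    qed
    then show ?thesis using n_system_frontier(2)[OF sys] by (simp add: less_top)
  qed
  finally show ?thesis using n_system_frontier(1)[OF sys] by simp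
qed

text \<open>Facets overlap in their common faces, so no additivity over facets is claimed: each
  piece is bounded by the full \<open>emeasure \<sigma> A\<close> and the constants are added. The
  density of \<open>\<sigma>\<close> on each facet is divided out of the constant.\<close>

lemma n_system_shell:
  fixes P :: "'a::euclidean_space set"
  assumes sys: "n_system P c \<sigma>" and z: "z \<in> interior P"
  shows "\<exists>C\<ge>0. \<forall>A\<in>sets borel. \<forall>e\<ge>0. A \<subseteq> frontier P \<longrightarrow> (\<exists>S\<in>sets borel.
    {z + r *\<^sub>R (y - z) | y r. y \<in> A \<and> 1 - e \<le> r \<and> 0 < r \<and> r \<le> 1} \<subseteq> S \<and>
    emeasure lborel S \<le> ennreal (C * e) * emeasure \<sigma> A)"
proof -
  have P: "polytope P" and sets: "sets \<sigma> = sets borel"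
    using sys by (auto simp: n_system_def simple_polytope_def)
  let ?FF = "{F. F facet_of P}"
  have fin: "finite ?FF" by (rule n_system_frontier(2)[OF sys])
  define G where "G F C \<longleftrightarrow> C \<ge> 0 \<and> (\<forall>A\<in>sets borel. \<forall>e\<ge>0. A \<subseteq> F \<longrightarrow> (\<exists>S\<in>sets borel.
    {z + r *\<^sub>R (y - z) | y r. y \<in> A \<and> 1 - e \<le> r \<and> 0 < r \<and> r \<le> 1} \<subseteq> S \<and>
    emeasure lborel S \<le> ennreal (C * e) * emeasure \<sigma> A))" for F :: "'a set" and C :: real
  have ex: "\<exists>C. G F C" if F: "F facet_of P" for F
  proof -
    obtain k where k: "k > 0" "\<forall>A \<in> sets borel. A \<subseteq> F \<longrightarrow>
           emeasure \<sigma> A = ennreal k * hyperplane_lebesgue (affine hull F) A"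
      using sys F unfolding n_system_def by blast
    obtain C where C: "C \<ge> 0" "\<forall>A\<in>sets borel. \<forall>e\<ge>0. A \<subseteq> F \<longrightarrow> (\<exists>S\<in>sets borel.
      {z + r *\<^sub>R (y - z) | y r. y \<in> A \<and> 1 - e \<le> r \<and> 0 < r \<and> r \<le> 1} \<subseteq> S \<and>
      emeasure lborel S \<le> ennreal (C * e) * hyperplane_lebesgue (affine hull F) A)"
      using facet_shell[OF P z F] by blast
    have eq: "ennreal (C * e) * hyperplane_lebesgue (affine hull F) A = ennreal (C / k * e) * emeasure \<sigma> A"
      if "A \<in> sets borel" "A \<subseteq> F" "e \<ge> 0" for A e
    proof -
      have "ennreal (C / k * e) * emeasure \<sigma> A = ennreal (C / k * e) * ennreal k * hyperplane_lebesgue (affine hull F) A"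
        using k that by (simp add: mult.assoc)
      also have "ennreal (C / k * e) * ennreal k = ennreal (C * e)"
        using C(1) k(1) that(3) by (subst ennreal_mult'[symmetric]) auto
      finally show ?thesis by simp
    qed
    show ?thesis unfolding G_def
    proof (intro exI[of _ "C / k"] conjI ballI allI impI)
      show "0 \<le> C / k" using C(1) k(1) by simp
      fix A and e :: real assume A: "A \<in> sets borel" "0 \<le> e" "A \<subseteq> F"
      show "\<exists>S\<in>sets borel. {z + r *\<^sub>R (y - z) | y r. y \<in> A \<and> 1 - e \<le> r \<and> 0 < r \<and> r \<le> 1} \<subseteq> S \<and>
          emeasure lborel S \<le> ennreal (C / k * e) * emeasure \<sigma> A"
        using C(2) A unfolding eq[OF A(1) A(3) A(2), symmetric] by blast
    qed
  qed
  define C where "C F = (SOME k. G F k)" for F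
  have GC: "G F (C F)" if "F facet_of P" for F
    unfolding C_def by (rule someI_ex[OF ex[OF that]])
  have C0: "C F \<ge> 0" if "F facet_of P" for F
    using GC[OF that] unfolding G_def by blast
  have C: "\<exists>S\<in>sets borel.
    {z + r *\<^sub>R (y - z) | y r. y \<in> A \<and> 1 - e \<le> r \<and> 0 < r \<and> r \<le> 1} \<subseteq> S \<and>
    emeasure lborel S \<le> ennreal (C F * e) * emeasure \<sigma> A"
    if "F facet_of P" "A \<in> sets borel" "e \<ge> 0" "A \<subseteq> F" for F A e
    using GC[OF that(1)] that(2-4) unfolding G_def by blast
  have "\<exists>S\<in>sets borel.
    {z + r *\<^sub>R (y - z) | y r. y \<in> A \<and> 1 - e \<le> r \<and> 0 < r \<and> r \<le> 1} \<subseteq> S \<and>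
    emeasure lborel S \<le> ennreal ((\<Sum>F\<in>?FF. C F) * e) * emeasure \<sigma> A"
    if A: "A \<in> sets borel" and e: "e \<ge> 0" and AP: "A \<subseteq> frontier P" for A and e :: real
  proof -
    define H where "H F S \<longleftrightarrow> S \<in> sets borel \<and>
      {z + r *\<^sub>R (y - z) | y r. y \<in> A \<inter> F \<and> 1 - e \<le> r \<and> 0 < r \<and> r \<le> 1} \<subseteq> S \<and>
      emeasure lborel S \<le> ennreal (C F * e) * emeasure \<sigma> (A \<inter> F)" for F S
    define S where "S F = (SOME S. H F S)" for F
    have HS: "H F (S F)" if "F facet_of P" for F
    proof -
      have "\<exists>S. H F S"
        using C[OF that, of "A \<inter> F" e] A e facet_sets_borel[OF P that] unfolding H_def by blast
      then show ?thesis unfolding S_def by (rule someI_ex)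
    qed
    have S: "S F \<in> sets borel"
      "{z + r *\<^sub>R (y - z) | y r. y \<in> A \<inter> F \<and> 1 - e \<le> r \<and> 0 < r \<and> r \<le> 1} \<subseteq> S F"
      "emeasure lborel (S F) \<le> ennreal (C F * e) * emeasure \<sigma> (A \<inter> F)" if "F facet_of P" for F
      using HS[OF that] unfolding H_def by blast+
    have "{z + r *\<^sub>R (y - z) | y r. y \<in> A \<and> 1 - e \<le> r \<and> 0 < r \<and> r \<le> 1} \<subseteq> (\<Union>F\<in>?FF. S F)"
    proof clarify
      fix y r assume y: "y \<in> A" and r: "1 - e \<le> r" "0 < r" "r \<le> 1"
      obtain F where F: "F facet_of P" "y \<in> F" using y AP n_system_frontier(1)[OF sys] by blast
      have "z + r *\<^sub>R (y - z) \<in> S F" by (rule subsetD[OF S(2)[OF F(1)]]) (use F y r in blast)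
      then show "z + r *\<^sub>R (y - z) \<in> (\<Union>F\<in>?FF. S F)" using F(1) by blast
    qed
    moreover have "(\<Union>F\<in>?FF. S F) \<in> sets borel" using fin S(1) by auto
    moreover have "emeasure lborel (\<Union>F\<in>?FF. S F) \<le> ennreal ((\<Sum>F\<in>?FF. C F) * e) * emeasure \<sigma> A"
    proof -
      have "emeasure lborel (\<Union>F\<in>?FF. S F) \<le> (\<Sum>F\<in>?FF. emeasure lborel (S F))"
        by (rule emeasure_subadditive_finite) (use fin S in auto)
      also have "\<dots> \<le> (\<Sum>F\<in>?FF. ennreal (C F * e) * emeasure \<sigma> A)"
      proof (rule sum_mono)
        fix F assume F: "F \<in> ?FF"
        have "emeasure \<sigma> (A \<inter> F) \<le> emeasure \<sigma> A" by (rule emeasure_mono) (use A sets in auto)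
        then show "emeasure lborel (S F) \<le> ennreal (C F * e) * emeasure \<sigma> A"
          using F by (intro order_trans[OF S(3)] mult_left_mono) auto
      qed
      also have "\<dots> = (\<Sum>F\<in>?FF. ennreal (C F * e)) * emeasure \<sigma> A" by (simp add: sum_distrib_right)
      also have "(\<Sum>F\<in>?FF. ennreal (C F * e)) = ennreal ((\<Sum>F\<in>?FF. C F) * e)"
        by (subst sum_ennreal) (use C0 e in \<open>auto simp: sum_distrib_right\<close>)
      finally show ?thesis .
    qed
    ultimately show ?thesis by blast
  qed
  then show ?thesis by (intro exI[of _ "\<Sum>F\<in>?FF. C F"] conjI ballI allI impI sum_nonneg) (simp_all add: C0)
qed

section \<open>Radial coordinates about an interior point\<close>

lemma radial_decomposition:
  fixes P :: "'a::euclidean_space set"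
  assumes P: "polytope P" and z: "z \<in> interior P" and x: "x \<in> P" "x \<noteq> z"
  obtains y r where "y \<in> frontier P" "0 < r" "r \<le> 1" "x = z + r *\<^sub>R (y - z)"
proof -
  have "convex P" "bounded P" using P polytope_imp_convex polytope_imp_bounded by auto
  obtain d where d: "0 < d" "z + d *\<^sub>R (x - z) \<in> frontier P"
    using ray_to_frontier[OF \<open>bounded P\<close> z, of "x - z"] x by auto
  have "d \<ge> 1"
  proof (rule ccontr)
    assume "\<not> 1 \<le> d"
    then have "x - (1 - d) *\<^sub>R (x - z) \<in> interior P"
      using mem_interior_convex_shrink[OF \<open>convex P\<close> z x(1), of "1 - d"] d by auto
    moreover have "x - (1 - d) *\<^sub>R (x - z) = z + d *\<^sub>R (x - z)" by (simp add: algebra_simps)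
    ultimately show False using d by (simp add: frontier_def)
  qed
  then show ?thesis
    by (intro that[of "z + d *\<^sub>R (x - z)" "1/d"]) (use d in auto)
qed

text \<open>The linear functional \<open>l\<close> of the facet through \<open>y\<close> equals
  \<open>r\<close> at the centre of the ball and is at most \<open>s\<close> at the other point,
  both seen from \<open>z\<close>. As \<open>l\<close> is at most 1 on \<open>ball 0 \<rho>\<close>,
  it drops by at most \<open>d\<close> under a displacement shorter than
  \<open>d * \<rho>\<close>.\<close>

lemma radial_parameter_near:
  fixes P :: "'a::euclidean_space set"
  assumes P: "polytope P" and F: "F facet_of P" "y \<in> F" and rho: "\<rho> > 0" "ball z \<rho> \<subseteq> P"
    and y': "y' \<in> P" and s: "0 \<le> s" and d: "d > 0"
    and near: "z + s *\<^sub>R (y' - z) \<in> ball (z + r *\<^sub>R (y - z)) (d * \<rho>)"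
  shows "r - d \<le> s"
proof -
  have z: "z \<in> interior P" using rho by (meson centre_in_ball interior_maximal open_ball subsetD)
  obtain \<beta> where \<beta>: "\<beta> \<noteq> 0"
    "\<And>x. x \<in> F \<Longrightarrow> hyperplane_normal (affine hull F) \<bullet> (x - z) / \<beta> = 1"
    "\<And>x. x \<in> P \<Longrightarrow> hyperplane_normal (affine hull F) \<bullet> (x - z) / \<beta> \<le> 1"
    using facet_normal[OF P z F(1)] by metis
  define l where "l x = hyperplane_normal (affine hull F) \<bullet> x / \<beta>" for x
  have lin: "l (a *\<^sub>R x) = a * l x" "l (x - x') = l x - l x'" for a x x'
    by (simp_all add: l_def inner_diff_right diff_divide_distrib)
  define q where "q = (1/d) *\<^sub>R (r *\<^sub>R (y - z) - s *\<^sub>R (y' - z))"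
  have "norm (r *\<^sub>R (y - z) - s *\<^sub>R (y' - z)) < d * \<rho>"
    using near by (simp add: dist_norm)
  then have "norm q < \<rho>" using d by (simp add: q_def pos_divide_less_eq mult.commute)
  then have "z + q \<in> P" using rho(2) by (auto simp: dist_norm)
  then have "l q \<le> 1" using \<beta>(3)[of "z + q"] by (simp add: l_def)
  moreover have "l q = (1/d) * (r * l (y - z) - s * l (y' - z))" by (simp only: q_def lin)
  moreover have "l (y - z) = 1" unfolding l_def by (rule \<beta>(2)[OF F(2)])
  moreover have "s * l (y' - z) \<le> s" using \<beta>(3)[OF y'] mult_left_mono[of "l (y' - z)" 1 s] s by (simp add: l_def)
  ultimately show ?thesis using d by (simp add: field_simps)
qed

section \<open>Log-convex functions on a convex body\<close>

lemma epowr_1 [simp]: "epowr v 1 = v"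
  by (cases v) (auto simp: epowr_def)

lemma epowr_ennreal: "0 \<le> a \<Longrightarrow> epowr (ennreal a) p = ennreal (a powr p)"
  by (simp add: epowr_def)

lemma epowr_mono:
  assumes "a \<le> b" "0 \<le> p"
  shows "epowr a p \<le> epowr b p"
  using assms by (auto simp: epowr_def less_top intro!: ennreal_leI powr_mono2 enn2real_mono)
lemma epowr_pos: "0 < a \<Longrightarrow> 0 < epowr a p"
  by (cases a) (auto simp: epowr_def)

text \<open>Hoelder's inequality for two terms, by Young's inequality after normalising with the
  sums. It is the reason why sums of log-convex functions are log-convex.\<close>

lemma powr_Holder_2:
  fixes a1 a2 b1 b2 :: real
  assumes "a1 > 0" "a2 > 0" "b1 > 0" "b2 > 0" and t: "0 \<le> t" "t \<le> 1"
  shows "a1 powr (1 - t) * b1 powr t + a2 powr (1 - t) * b2 powr t \<le> (a1 + a2) powr (1 - t) * (b1 + b2) powr t"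
proof -
  define A B where "A = a1 + a2" and "B = b1 + b2"
  have AB: "A > 0" "B > 0" using assms by (auto simp: A_def B_def)
  have "a powr (1 - t) * b powr t \<le> (A powr (1 - t) * B powr t) * ((1 - t) * (a / A) + t * (b / B))"
    if "a > 0" "b > 0" for a b :: real
  proof -
    have "(a / A) powr (1 - t) * (b / B) powr t \<le> (1 - t) * (a / A) + t * (b / B)"
      by (rule Youngs_inequality_0) (use that AB t in auto)
    then have "(A powr (1 - t) * B powr t) * ((a / A) powr (1 - t) * (b / B) powr t) \<le>
      (A powr (1 - t) * B powr t) * ((1 - t) * (a / A) + t * (b / B))"
      by (intro mult_left_mono) auto
    moreover have "(A powr (1 - t) * B powr t) * ((a / A) powr (1 - t) * (b / B) powr t) = a powr (1 - t) * b powr t"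
      using that AB by (simp add: powr_divide)
    ultimately show ?thesis by simp
  qed
  from add_mono[OF this[of a1 b1] this[of a2 b2]] assms
  have "a1 powr (1 - t) * b1 powr t + a2 powr (1 - t) * b2 powr t \<le>
    (A powr (1 - t) * B powr t) * (((1 - t) * (a1 / A) + t * (b1 / B)) + ((1 - t) * (a2 / A) + t * (b2 / B)))"
    by (simp add: distrib_left)
  also have "((1 - t) * (a1 / A) + t * (b1 / B)) + ((1 - t) * (a2 / A) + t * (b2 / B)) = (1 - t) * ((a1 + a2) / A) + t * ((b1 + b2) / B)"
    by (simp add: add_divide_distrib algebra_simps)
  also have "\<dots> = 1" using AB by (simp add: A_def B_def)
  finally show ?thesis by (simp add: A_def B_def)
qed

lemma epowr_Holder_2:
  assumes pos: "a1 > 0" "a2 > 0" "b1 > 0" "b2 > 0" and t: "0 \<le> t" "t \<le> 1"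
  shows "epowr a1 (1 - t) * epowr b1 t + epowr a2 (1 - t) * epowr b2 t \<le> epowr (a1 + a2) (1 - t) * epowr (b1 + b2) t"
proof (cases "a1 + a2 = \<infinity> \<or> b1 + b2 = \<infinity>")
  case True
  \<comment> \<open>\<open>epowr \<infinity> 0\<close> is \<open>\<infinity>\<close>, so an infinite
    sum times a positive factor makes the right side infinite even at \<open>t = 0\<close> and
    \<open>t = 1\<close>.\<close>
  have "epowr (a1 + a2) (1 - t) > 0" "epowr (b1 + b2) t > 0" using pos by (auto intro!: epowr_pos add_pos_pos)
  then have "epowr (a1 + a2) (1 - t) * epowr (b1 + b2) t = \<infinity>" using True
    by (auto simp: epowr_def ennreal_mult_eq_top_iff)
  then show ?thesis by simp
next
  case False
  then obtain x1 x2 y1 y2 where "a1 = ennreal x1" "a2 = ennreal x2" "b1 = ennreal y1" "b2 = ennreal y2"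
      "x1 \<ge> 0" "x2 \<ge> 0" "y1 \<ge> 0" "y2 \<ge> 0"
    by (cases a1; cases a2; cases b1; cases b2) (auto)
  moreover have "x1 > 0" "x2 > 0" "y1 > 0" "y2 > 0" using pos calculation by auto
  ultimately show ?thesis
    using powr_Holder_2[of x1 x2 y1 y2 t] t
    by (simp add: epowr_ennreal ennreal_plus[symmetric] ennreal_mult''[symmetric] del: ennreal_plus)
qed

text \<open>The end points are excluded because there \<open>0 * \<infinity> = 0\<close> on the
  right meets \<open>epowr \<infinity> 0 = \<infinity>\<close> on the left.\<close>

lemma epowr_Young_2:
  assumes t: "0 < t" "t < 1" and pos: "a > 0" "b > 0"
  shows "epowr a (1 - t) * epowr b t \<le> ennreal (1 - t) * a + ennreal t * b"
proof (cases "a = \<infinity> \<or> b = \<infinity>")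
  case True
  moreover have "ennreal (1 - t) \<noteq> 0" "ennreal t \<noteq> 0" using t by auto
  ultimately have top: "ennreal (1 - t) * a + ennreal t * b = top"
    by (auto simp: ennreal_mult_eq_top_iff)
  show ?thesis unfolding top by (rule top_greatest)
next
  case False
  then obtain x y where "a = ennreal x" "b = ennreal y" "x \<ge> 0" "y \<ge> 0"
    by (cases a; cases b) auto
  then show ?thesis
    using Youngs_inequality_0[of "1 - t" t x y] t pos
    by (simp add: epowr_ennreal ennreal_plus[symmetric] ennreal_mult''[symmetric] del: ennreal_plus)
qed

lemma lsc_on_iff_openin:
  "lsc_on P u \<longleftrightarrow> (\<forall>a. openin (top_of_set P) {x\<in>P. a < u x})"
proof
  assume L: "lsc_on P u"
  show "\<forall>a. openin (top_of_set P) {x\<in>P. a < u x}"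
  proof
    fix a
    show "openin (top_of_set P) {x\<in>P. a < u x}"
    proof (subst openin_subopen, safe)
      fix x assume x: "x \<in> P" "a < u x"
      then have "eventually (\<lambda>y. a < u y) (at x within P)" using L by (auto simp: lsc_on_def)
      then obtain S where S: "open S" "x \<in> S" "\<And>y. y \<in> S \<Longrightarrow> y \<noteq> x \<Longrightarrow> y \<in> P \<Longrightarrow> a < u y"
        unfolding eventually_at_topological by blast
      show "\<exists>T. openin (top_of_set P) T \<and> x \<in> T \<and> T \<subseteq> {x \<in> P. a < u x}"
        by (rule exI[of _ "P \<inter> S"]) (use S x in auto)
    qed
  qed
next
  assume O: "\<forall>a. openin (top_of_set P) {x\<in>P. a < u x}"
  show "lsc_on P u"
    unfolding lsc_on_def
  proof safe
    fix x a assume x: "x \<in> P" "a < u x"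
    obtain S where S: "open S" "{x\<in>P. a < u x} = P \<inter> S" using O unfolding openin_open by blast
    have "x \<in> S" using S x by auto
    then show "eventually (\<lambda>y. a < u y) (at x within P)"
      unfolding eventually_at_topological using S by blast
  qed
qed

lemma lsc_on_borel_measurable:
  fixes P :: "'a::topological_space set"
  assumes P: "P \<in> sets borel" and L: "lsc_on P u" and 0: "\<And>x. x \<notin> P \<Longrightarrow> u x = 0"
  shows "u \<in> borel_measurable borel"
proof (rule borel_measurableI_greater)
  fix a
  obtain S where S: "open S" "{x\<in>P. a < u x} = P \<inter> S" using L unfolding lsc_on_iff_openin openin_open by blast
  have "{x \<in> space borel. a < u x} = {x\<in>P. a < u x}" using 0 by force
  also have "\<dots> \<in> sets borel" unfolding S(2) using P S(1) by auto
  finally show "{x \<in> space borel. a < u x} \<in> sets borel" .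
qed

text \<open>This is how lower semicontinuity passes to sums: a level below the sum is reached by
  levels below the summands. Positivity leaves room below each summand.\<close>

lemma ennreal_less_add_split:
  fixes a x y :: ennreal
  assumes "a < x + y" "0 < x" "0 < y"
  obtains b c where "b < x" "c < y" "a < b + c"
proof (cases "x = \<infinity> \<or> y = \<infinity>")
  case True
  then have "a < \<infinity>" using assms by auto
  then obtain b where "a < b" "b < \<infinity>" using dense by blast
  then show ?thesis using that[of b 0] that[of 0 b] True assms by auto
next
  case False
  then obtain p q r where r: "x = ennreal p" "y = ennreal q" "a = ennreal r" "p \<ge> 0" "q \<ge> 0" "r \<ge> 0"
    using assms by (cases x; cases y; cases a) auto
  have pq: "p > 0" "q > 0" "r < p + q"
    using assms r by (auto simp: ennreal_plus[symmetric] ennreal_less_iff simp del: ennreal_plus)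
  \<comment> \<open>Lowering both summands by a quarter of the gap costs half of it; the cap by
    \<open>p\<close> and \<open>q\<close> keeps the levels nonnegative.\<close>
  define e where "e = min (min p q) ((p + q - r) / 4)"
  have e: "e > 0" "e \<le> p" "e \<le> q" using pq by (auto simp: e_def)
  have "e \<le> (p + q - r) / 4" unfolding e_def by (rule min.cobounded2)
  then have "r < (p - e) + (q - e)" using pq(3) by (simp add: field_simps)
  show ?thesis
    by (rule that[of "ennreal (p - e)" "ennreal (q - e)"])
       (use e r \<open>r < (p - e) + (q - e)\<close> in \<open>auto simp: ennreal_plus[symmetric] ennreal_less_iff simp del: ennreal_plus\<close>)
qed

section \<open>Normalised log-convex functions and their pointwise bounds\<close>

locale convex_body =
  fixes P :: "'a::euclidean_space set" and z :: 'a and \<rho> :: real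
  assumes convexP: "convex P" and compactP: "compact P" and rho: "\<rho> > 0" and ballP: "ball z \<rho> \<subseteq> P"
begin

lemma z_interior: "z \<in> interior P"
  using rho ballP by (meson centre_in_ball interior_maximal open_ball subsetD)

lemma z_in: "z \<in> P" using z_interior interior_subset by blast

lemma P_borel [measurable]: "P \<in> sets borel"
  using compactP compact_imp_closed by (intro borel_closed)

lemma emeasure_P_finite: "emeasure lborel P < \<infinity>"
  using compactP emeasure_bounded_finite[OF compact_imp_bounded] by auto

lemma emeasure_ball_pos: "0 < e \<Longrightarrow> 0 < emeasure lborel (ball (x::'a) e)"
proof -
  assume "0 < e"
  have "emeasure lborel (ball x e) \<noteq> 0"
  proof
    assume "emeasure lborel (ball x e) = 0"
    then have "negligible (ball x e)"
      by (simp add: negligible_iff_null_sets null_setsI null_sets_completionI)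
    then show False using open_not_negligible[OF open_ball, of x e] \<open>0 < e\<close> by auto
  qed
  then show ?thesis by (simp add: zero_less_iff_neq_zero)
qed

lemma emeasure_P_pos: "0 < emeasure lborel P"
proof -
  have "0 < emeasure lborel (ball z \<rho>)" using emeasure_ball_pos rho by blast
  also have "\<dots> \<le> emeasure lborel P" by (intro emeasure_mono ballP) auto
  finally show ?thesis .
qed

text \<open>This is \<open>Mp 1 P c\<close> with the constant \<open>c\<close> cancelled from the
  normalisation; integrability for exponent 1 is then automatic, and vanishing off \<open>P\<close>
  lets the integral run over the whole space.\<close>

definition M :: "('a \<Rightarrow> ennreal) set" where
  "M = {u. (\<forall>x. x \<notin> P \<longrightarrow> u x = 0) \<and> (\<forall>x\<in>P. u x > 0) \<and> lsc_on P u \<and> log_convex_on P u \<and>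
       (\<integral>\<^sup>+x. u x \<partial>lborel) = emeasure lborel P}"

lemma Mp_1_eq: "c > 0 \<Longrightarrow> Mp 1 P c = M"
proof -
  assume c: "c > 0"
  have eq: "u x * indicator P x = u x" if "\<forall>x. x \<notin> P \<longrightarrow> u x = 0" for u :: "'a \<Rightarrow> ennreal" and x
    using that by (auto simp: indicator_def)
  have "ennreal c * a = ennreal c * b \<longleftrightarrow> a = b" for a b
    using c by (simp add: ennreal_mult_cancel_left)
  then show ?thesis
    unfolding Mp_def M_def mu_int_def using emeasure_P_finite
    by (auto simp: eq ennreal_mult_less_top cong: nn_integral_cong)
qed

lemma M_zero: "u \<in> M \<Longrightarrow> x \<notin> P \<Longrightarrow> u x = 0" by (auto simp: M_def)
lemma M_pos: "u \<in> M \<Longrightarrow> x \<in> P \<Longrightarrow> u x > 0" by (auto simp: M_def)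
lemma M_lsc: "u \<in> M \<Longrightarrow> lsc_on P u" by (auto simp: M_def)
lemma M_integral: "u \<in> M \<Longrightarrow> (\<integral>\<^sup>+x. u x \<partial>lborel) = emeasure lborel P" by (auto simp: M_def)
lemma M_log_convex:
  "u \<in> M \<Longrightarrow> x \<in> P \<Longrightarrow> y \<in> P \<Longrightarrow> 0 \<le> t \<Longrightarrow> t \<le> 1 \<Longrightarrow>
    u ((1 - t) *\<^sub>R x + t *\<^sub>R y) \<le> epowr (u x) (1 - t) * epowr (u y) t"
  by (auto simp: M_def log_convex_on_def)

lemma M_measurable [measurable_dest]: "u \<in> M \<Longrightarrow> u \<in> borel_measurable borel"
  by (rule lsc_on_borel_measurable[OF P_borel M_lsc]) (auto simp: M_zero)

lemma M_convex:
  assumes u: "u \<in> M" "x \<in> P" "y \<in> P" and t: "0 < t" "t < 1"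
  shows "u ((1 - t) *\<^sub>R x + t *\<^sub>R y) \<le> ennreal (1 - t) * u x + ennreal t * u y"
  using order_trans[OF M_log_convex epowr_Young_2] u t M_pos by fastforce

lemma M_midpoint:
  assumes u: "u \<in> M" "x + w \<in> P" "x - w \<in> P"
  shows "2 * u x \<le> u (x + w) + u (x - w)"
proof -
  have "u ((1 - 1/2) *\<^sub>R (x + w) + (1/2) *\<^sub>R (x - w)) \<le> ennreal (1 - 1/2) * u (x + w) + ennreal (1/2) * u (x - w)"
    by (rule M_convex) (use u in auto)
  also have "(1 - 1/2) *\<^sub>R (x + w) + (1/2) *\<^sub>R (x - w) = x"
    by (simp add: algebra_simps flip: scaleR_add_left)
  finally have "2 * u x \<le> 2 * (ennreal (1 - 1/2) * u (x + w) + ennreal (1/2) * u (x - w))"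
    by (rule mult_left_mono) simp
  also have "\<dots> = (2 * ennreal (1/2)) * (u (x + w) + u (x - w))" by (simp add: algebra_simps)
  also have "2 * ennreal (1/2) = 1" 
    by (metis ennreal_1 ennreal_mult'' ennreal_numeral mult.commute nonzero_eq_divide_eq zero_le_divide_1_iff zero_le_numeral zero_neq_numeral)
  finally show ?thesis by simp
qed

text \<open>Midpoint convexity averaged over the displacements \<open>w\<close> and
  \<open>-w\<close>. Combined with the fixed total mass it bounds all members of \<open>M\<close> at
  a point by its distance to the complement of \<open>P\<close> alone.\<close>

lemma M_mean_value:
  assumes u: "u \<in> M" and B: "ball x e \<subseteq> P"
  shows "u x * emeasure lborel (ball x e) \<le> (\<integral>\<^sup>+y. u y * indicator (ball x e) y \<partial>lborel)"
proof -
  have [measurable]: "u \<in> borel_measurable borel" using u by measurable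
  have [measurable]: "ball (0::'a) e \<in> sets borel" by (intro borel_open open_ball)
  let ?I = "\<integral>\<^sup>+y. u y * indicator (ball x e) y \<partial>lborel"
  have r1: "?I = (\<integral>\<^sup>+w. u (x + w) * indicator (ball 0 e) w \<partial>lborel)"
    using nn_integral_lborel_affine[of "\<lambda>y. u y * indicator (ball x e) y" 1 x]
    by (simp add: indicator_def dist_norm)
  have r2: "?I = (\<integral>\<^sup>+w. u (x - w) * indicator (ball 0 e) w \<partial>lborel)"
    using nn_integral_lborel_affine[of "\<lambda>y. u y * indicator (ball x e) y" "-1" x]
    by (simp add: indicator_def dist_norm)
  have b: "emeasure lborel (ball x e) = (\<integral>\<^sup>+w. indicator (ball (0::'a) e) w \<partial>lborel)"
    using emeasure_lborel_affine[of "ball x e" 1 x] by (simp add: dist_norm ball_def)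
  have "2 * (u x * emeasure lborel (ball x e)) = (\<integral>\<^sup>+w. 2 * u x * indicator (ball (0::'a) e) w \<partial>lborel)"
    unfolding b by (subst nn_integral_cmult) (auto simp: mult.assoc intro!: borel_measurable_indicator)
  also have "\<dots> \<le> (\<integral>\<^sup>+w. (u (x + w) + u (x - w)) * indicator (ball 0 e) w \<partial>lborel)"
  proof (intro nn_integral_mono)
    fix w :: 'a
    show "2 * u x * indicator (ball 0 e) w \<le> (u (x + w) + u (x - w)) * indicator (ball 0 e) w"
    proof (cases "w \<in> ball 0 e")
      case True
      then have "x + w \<in> P" "x - w \<in> P" using B by (auto simp: dist_norm subset_eq)
      then show ?thesis using M_midpoint[OF u] True by simp
    qed simp
  qed
  also have "\<dots> = ?I + ?I"
    by (subst r1, subst r2, subst nn_integral_add[symmetric]) (measurable, simp add: distrib_right)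
  also have "\<dots> = 2 * ?I" by (simp add: mult_2)
  finally show ?thesis
    by (simp add: ennreal_mult_cancel_left ennreal_mult_le_mult_iff)
qed

lemma M_ball_integral_le:
  assumes u: "u \<in> M"
  shows "(\<integral>\<^sup>+y. u y * indicator B y \<partial>lborel) \<le> emeasure lborel P"
proof -
  have "(\<integral>\<^sup>+y. u y * indicator B y \<partial>lborel) \<le> (\<integral>\<^sup>+y. u y \<partial>lborel)"
    by (intro nn_integral_mono) (auto simp: indicator_def)
  then show ?thesis using M_integral[OF u] by simp
qed

lemma M_finite_interior:
  assumes u: "u \<in> M" and x: "x \<in> interior P"
  shows "u x < \<infinity>"
proof -
  obtain e where e: "e > 0" "ball x e \<subseteq> P" using x mem_interior by blast
  have "u x * emeasure lborel (ball x e) \<le> emeasure lborel P"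
    using order_trans[OF M_mean_value[OF u e(2)] M_ball_integral_le[OF u]] .
  also have "\<dots> < \<infinity>" by (rule emeasure_P_finite)
  finally show ?thesis using emeasure_ball_pos[OF e(1), of x]
    by (auto simp: ennreal_mult_less_top)
qed

text \<open>The mean value inequality on \<open>ball z \<rho>\<close> bounds every member of
  \<open>M\<close> at \<open>z\<close> by this number. Superlevel sets at levels from
  \<open>K\<close> upwards therefore avoid the centre.\<close>

definition K :: real where "K = measure lborel P / measure lborel (ball z \<rho>)"

lemma measure_P_pos: "measure lborel P > 0"
  using emeasure_P_pos emeasure_P_finite by (simp add: measure_def enn2real_positive_iff)

lemma emeasure_P_eq: "emeasure lborel P = ennreal (measure lborel P)"
  using emeasure_P_finite by (intro emeasure_eq_ennreal_measure) auto

lemma measure_ball_pos: "0 < e \<Longrightarrow> measure lborel (ball (x::'a) e) > 0"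
  using emeasure_ball_pos[of e x] emeasure_lborel_ball_finite[of x e]
  by (simp add: measure_def enn2real_positive_iff)

lemma K_pos: "K > 0"
  unfolding K_def using measure_P_pos measure_ball_pos[OF rho] by auto

lemma M_center_le:
  assumes u: "u \<in> M"
  shows "u z \<le> ennreal K"
proof -
  let ?b = "measure lborel (ball z \<rho>)"
  have b: "?b > 0" by (rule measure_ball_pos[OF rho])
  have eb: "emeasure lborel (ball z \<rho>) = ennreal ?b"
    using emeasure_lborel_ball_finite[of z \<rho>] by (intro emeasure_eq_ennreal_measure) auto
  obtain a where a: "u z = ennreal a" "a \<ge> 0"
    using M_finite_interior[OF u z_interior] by (cases "u z") auto
  have "u z * emeasure lborel (ball z \<rho>) \<le> emeasure lborel P"
    using order_trans[OF M_mean_value[OF u ballP] M_ball_integral_le[OF u]] .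
  then have "a * ?b \<le> measure lborel P"
    using a b unfolding eb emeasure_P_eq by (simp add: ennreal_mult''[symmetric])
  then show ?thesis using a b by (auto simp: K_def pos_le_divide_eq intro!: ennreal_leI)
qed

section \<open>Interior values and their radial extension\<close>

definition rf :: "('a \<Rightarrow> ennreal) \<Rightarrow> 'a \<Rightarrow> real" where "rf u x = enn2real (u x)"

lemma M_rf:
  assumes "u \<in> M" "x \<in> interior P"
  shows "u x = ennreal (rf u x)" "rf u x > 0"
proof -
  have "u x > 0" "u x < \<infinity>" using assms M_pos M_finite_interior interior_subset by blast+
  then show "u x = ennreal (rf u x)" "rf u x > 0" by (auto simp: rf_def less_top enn2real_positive_iff)
qed

definition log_cvx :: "('a \<Rightarrow> real) \<Rightarrow> bool" where
  "log_cvx g \<longleftrightarrow> (\<forall>x\<in>interior P. g x > 0) \<and> (\<forall>x\<in>interior P. \<forall>y\<in>interior P. \<forall>t\<in>{0..1}.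
     g ((1 - t) *\<^sub>R x + t *\<^sub>R y) \<le> g x powr (1 - t) * g y powr t)"

lemma M_log_cvx:
  assumes u: "u \<in> M"
  shows "log_cvx (rf u)"
  unfolding log_cvx_def
proof (intro conjI ballI)
  show "0 < rf u x" if "x \<in> interior P" for x using M_rf[OF u that] by simp
  fix x y t assume x: "x \<in> interior P" and y: "y \<in> interior P" and t: "t \<in> {0..1::real}"
  let ?m = "(1 - t) *\<^sub>R x + t *\<^sub>R y"
  have m: "?m \<in> interior P" using convexD[OF convex_interior[OF convexP] x y, of "1 - t" t] t by simp
  have "u ?m \<le> epowr (u x) (1 - t) * epowr (u y) t"
    by (rule M_log_convex) (use x y t u interior_subset in auto)
  then have "ennreal (rf u ?m) \<le> ennreal (rf u x powr (1 - t) * rf u y powr t)"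
    using M_rf[OF u x] M_rf[OF u y] M_rf[OF u m] by (simp add: epowr_ennreal ennreal_mult'')
  then show "rf u ?m \<le> rf u x powr (1 - t) * rf u y powr t"
    by (subst (asm) ennreal_le_iff) auto
qed

lemma log_cvx_convex: "log_cvx g \<Longrightarrow> convex_on (interior P) g"
proof (rule convex_onI)
  fix t :: real and x y assume g: "log_cvx g" and t: "0 < t" "t < 1" and x: "x \<in> interior P" and y: "y \<in> interior P"
  have "g ((1 - t) *\<^sub>R x + t *\<^sub>R y) \<le> g x powr (1 - t) * g y powr t" using g x y t by (auto simp: log_cvx_def)
  also have "\<dots> \<le> (1 - t) * g x + t * g y"
    by (rule Youngs_inequality_0) (use g x y t in \<open>auto simp: log_cvx_def\<close>)
  finally show "g ((1 - t) *\<^sub>R x + t *\<^sub>R y) \<le> (1 - t) * g x + t * g y" .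
qed (simp add: convex_interior[OF convexP])

lemma log_cvx_continuous: "log_cvx g \<Longrightarrow> continuous_on (interior P) g"
  by (intro convex_on_continuous log_cvx_convex) auto

text \<open>Log-convexity on the segment from \<open>z\<close> to \<open>x\<close> bounds the value
  at \<open>z + r *\<^sub>R (x - z)\<close> by a product of powers of the values at \<open>z\<close>
  and \<open>x\<close>. Solved for the value at \<open>x\<close>, it says that this value is at
  least \<open>radial g r x\<close>.\<close>

definition radial :: "('a \<Rightarrow> real) \<Rightarrow> real \<Rightarrow> 'a \<Rightarrow> real" where
  "radial g r x = (g (z + r *\<^sub>R (x - z)) / g z powr (1 - r)) powr (1 / r)"

lemma radial_point:
  assumes "x \<in> P" "0 \<le> r" "r < 1"
  shows "z + r *\<^sub>R (x - z) \<in> interior P"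
proof -
  have "x - (1 - r) *\<^sub>R (x - z) \<in> interior P"
    using mem_interior_convex_shrink[OF convexP z_interior assms(1), of "1 - r"] assms by auto
  moreover have "x - (1 - r) *\<^sub>R (x - z) = z + r *\<^sub>R (x - z)" by (simp add: algebra_simps)
  ultimately show ?thesis by simp
qed

text \<open>Log-convexity along rays makes the supremum below a limit as \<open>r \<rightarrow> 1\<close>; being a
  supremum of continuous log-convex functions it is lower semicontinuous and log-convex.\<close>

definition ext :: "('a \<Rightarrow> real) \<Rightarrow> 'a \<Rightarrow> ennreal" where
  "ext g x = (if x \<in> P then (SUP r\<in>{0<..<1}. ennreal (radial g r x)) else 0)"

lemma M_radial_le:
  assumes u: "u \<in> M" and x: "x \<in> P" and r: "0 < r" "r < 1"
  shows "ennreal (radial (rf u) r x) \<le> u x"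
proof (cases "u x = \<infinity>")
  case False
  then obtain a where a: "u x = ennreal a" "a > 0" using M_pos[OF u x] by (cases "u x") auto
  let ?y = "z + r *\<^sub>R (x - z)"
  have y: "?y \<in> interior P" by (rule radial_point) (use x r in auto)
  note fy = M_rf[OF u y] and fz = M_rf[OF u z_interior]
  have "u ((1 - r) *\<^sub>R z + r *\<^sub>R x) \<le> epowr (u z) (1 - r) * epowr (u x) r"
    by (rule M_log_convex) (use u x r z_in in auto)
  also have "(1 - r) *\<^sub>R z + r *\<^sub>R x = ?y" by (simp add: algebra_simps)
  finally have "ennreal (rf u ?y) \<le> ennreal (rf u z powr (1 - r) * a powr r)"
    using fy fz a by (simp add: epowr_ennreal ennreal_mult'')
  then have "rf u ?y \<le> rf u z powr (1 - r) * a powr r" by (subst (asm) ennreal_le_iff) auto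
  then have "rf u ?y / rf u z powr (1 - r) \<le> a powr r" using fz by (simp add: pos_divide_le_eq mult.commute)
  then have "radial (rf u) r x \<le> (a powr r) powr (1 / r)"
    unfolding radial_def by (intro powr_mono2) (use fy fz r in auto)
  also have "\<dots> = a" using a r by (simp add: powr_powr)
  finally show ?thesis using a by (simp add: ennreal_leI)
qed simp

lemma tendsto_radial_point: "((\<lambda>r. z + r *\<^sub>R (x - z)) \<longlongrightarrow> x) (at_left 1)"
proof -
  have "((\<lambda>r. z + r *\<^sub>R (x - z)) \<longlongrightarrow> z + 1 *\<^sub>R (x - z)) (at_left 1)" by (intro tendsto_intros)
  then show ?thesis by simp
qed

lemma eventually_at_left_1: "eventually (\<lambda>r. r \<in> {0<..<1::real}) (at_left 1)"
  by (rule eventually_at_left_real) simp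

text \<open>Lower semicontinuity bounds \<open>u x\<close> by values on the ray towards
  \<open>x\<close>, and log-convexity gives the opposite bound. So the boundary values, possibly
  infinite, are determined by the interior ones.\<close>

lemma ext_rf:
  assumes u: "u \<in> M"
  shows "ext (rf u) = u"
proof
  fix x
  show "ext (rf u) x = u x"
  proof (cases "x \<in> P")
    case False then show ?thesis using M_zero[OF u] by (simp add: ext_def)
  next
    case x: True
    have "u x \<le> ext (rf u) x"
    proof (rule dense_le)
      fix a assume a: "a < u x"
      then obtain a' where a': "a = ennreal a'" "a' \<ge> 0" by (cases a) auto
      show "a \<le> ext (rf u) x"
      proof (cases "a' = 0")
        case False
        then have a'pos: "a' > 0" using a' by simp
        obtain S where S: "open S" "{x\<in>P. a < u x} = P \<inter> S"
          using M_lsc[OF u] unfolding lsc_on_iff_openin openin_open by blast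
        have "eventually (\<lambda>r. z + r *\<^sub>R (x - z) \<in> S) (at_left 1)"
          using tendsto_radial_point[of x] S x a by (intro topological_tendstoD) auto
        \<comment> \<open>Close to the end of the ray \<open>u\<close> exceeds \<open>a'\<close>,
          which bounds \<open>radial\<close> from below by an expression tending to
          \<open>a'\<close>, as both exponents \<open>1 - r\<close> and \<open>1 / r\<close> tend to
          those of \<open>r = 1\<close>.\<close>
        then have ev: "eventually (\<lambda>r. ennreal ((a' / rf u z powr (1 - r)) powr (1 / r)) \<le> ext (rf u) x) (at_left 1)"
          using eventually_at_left_1
        proof eventually_elim
          case (elim r)
          let ?y = "z + r *\<^sub>R (x - z)"
          have y: "?y \<in> interior P" by (rule radial_point) (use x elim in auto)
          then have "a < u ?y" using S elim interior_subset by blast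
          then have "a' \<le> rf u ?y" using M_rf[OF u y] a' by (simp add: ennreal_less_iff)
          then have "(a' / rf u z powr (1 - r)) powr (1 / r) \<le> radial (rf u) r x"
            unfolding radial_def using a' elim by (intro powr_mono2 divide_right_mono) auto
          then have "ennreal ((a' / rf u z powr (1 - r)) powr (1 / r)) \<le> ennreal (radial (rf u) r x)" by (rule ennreal_leI)
          also have "\<dots> \<le> ext (rf u) x" unfolding ext_def using x elim by (auto intro!: SUP_upper)
          finally show ?case .
        qed
        have fz: "rf u z \<noteq> 0" using M_rf[OF u z_interior] by simp
        have "((\<lambda>r. (a' / rf u z powr (1 - r)) powr (1 / r)) \<longlongrightarrow> (a' / rf u z powr (1 - 1)) powr (1 / 1)) (at_left 1)"
          by (intro tendsto_intros) (use fz a'pos in auto)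
        then have "((\<lambda>r. ennreal ((a' / rf u z powr (1 - r)) powr (1 / r))) \<longlongrightarrow> ennreal a') (at_left 1)"
          using fz a'pos by (intro tendsto_ennrealI) simp
        from tendsto_upperbound[OF this ev] show ?thesis using a' by simp
      qed (use a' in simp)
    qed
    moreover have "ext (rf u) x \<le> u x"
      using M_radial_le[OF u x] x by (auto simp: ext_def intro!: SUP_least)
    ultimately show ?thesis by simp
  qed
qed

lemma log_cvx_ext_interior:
  assumes g: "log_cvx g" and x: "x \<in> interior P"
  shows "ext g x = ennreal (g x)"
proof (rule antisym)
  have xP: "x \<in> P" using x interior_subset by blast
  have gx: "g x > 0" "g z > 0" using g x z_interior by (auto simp: log_cvx_def)
  show "ext g x \<le> ennreal (g x)"
    unfolding ext_def using xP
  proof (simp, intro SUP_least ennreal_leI)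
    fix r assume r: "r \<in> {0<..<1::real}"
    let ?y = "z + r *\<^sub>R (x - z)"
    have "g ((1 - r) *\<^sub>R z + r *\<^sub>R x) \<le> g z powr (1 - r) * g x powr r"
      using g x z_interior r by (auto simp: log_cvx_def)
    also have "(1 - r) *\<^sub>R z + r *\<^sub>R x = ?y" by (simp add: algebra_simps)
    finally have "g ?y / g z powr (1 - r) \<le> g x powr r" using gx by (simp add: pos_divide_le_eq mult.commute)
    moreover have "g ?y > 0" using g radial_point[OF xP, of r] r by (auto simp: log_cvx_def)
    ultimately have "radial g r x \<le> (g x powr r) powr (1 / r)"
      unfolding radial_def using r by (intro powr_mono2) auto
    also have "\<dots> = g x" using gx r by (simp add: powr_powr)
    finally show "radial g r x \<le> g x" .
  qed
  have "isCont g x"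
    using log_cvx_continuous[OF g] x by (simp add: continuous_on_interior continuous_on_eq_continuous_at)
  then have "((\<lambda>r. g (z + r *\<^sub>R (x - z))) \<longlongrightarrow> g x) (at_left 1)"
    using tendsto_radial_point[of x] by (rule isCont_tendsto_compose)
  then have "((\<lambda>r. radial g r x) \<longlongrightarrow> (g x / g z powr (1 - 1)) powr (1 / 1)) (at_left 1)"
    unfolding radial_def by (intro tendsto_intros) (use gx in auto)
  then have lim: "((\<lambda>r. ennreal (radial g r x)) \<longlongrightarrow> ennreal (g x)) (at_left 1)"
    using gx by (intro tendsto_ennrealI) simp
  have "eventually (\<lambda>r. ennreal (radial g r x) \<le> ext g x) (at_left 1)"
    using eventually_at_left_1 by eventually_elim (use xP in \<open>auto simp: ext_def intro!: SUP_upper\<close>)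
  from tendsto_upperbound[OF lim this] show "ennreal (g x) \<le> ext g x" by simp
qed

lemma ext_pos:
  assumes g: "log_cvx g" and x: "x \<in> P"
  shows "ext g x > 0"
proof -
  have "g (z + (1/2) *\<^sub>R (x - z)) > 0" "g z > 0"
    using g radial_point[OF x, of "1/2"] z_interior by (auto simp: log_cvx_def)
  then have "0 < ennreal (radial g (1/2) x)" by (simp add: radial_def)
  also have "\<dots> \<le> ext g x" unfolding ext_def using x by (auto intro!: SUP_upper)
  finally show ?thesis .
qed

lemma continuous_on_radial:
  assumes g: "log_cvx g" and r: "0 < r" "r < 1"
  shows "continuous_on P (radial g r)"
proof -
  have "continuous_on ((\<lambda>x. z + r *\<^sub>R (x - z)) ` P) g"
    by (rule continuous_on_subset[OF log_cvx_continuous[OF g]]) (use radial_point r in auto)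
  then have c: "continuous_on P (\<lambda>x. g (z + r *\<^sub>R (x - z)))"
    by (rule continuous_on_compose2) (auto intro!: continuous_intros)
  have "g (z + r *\<^sub>R (x - z)) \<noteq> 0" if "x \<in> P" for x
    using g radial_point[OF that, of r] r by (force simp: log_cvx_def)
  moreover have "g z \<noteq> 0" using g z_interior by (force simp: log_cvx_def)
  ultimately show ?thesis unfolding radial_def by (intro continuous_intros c) auto
qed

lemma ext_lsc:
  assumes g: "log_cvx g"
  shows "lsc_on P (ext g)"
  unfolding lsc_on_iff_openin
proof
  fix a
  have "{x\<in>P. a < ext g x} = (\<Union>r\<in>{0<..<1}. {x\<in>P. a < ennreal (radial g r x)})"
    by (auto simp: ext_def less_SUP_iff)
  moreover have "openin (top_of_set P) {x\<in>P. a < ennreal (radial g r x)}" if "r \<in> {0<..<1}" for r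
  proof -
    have "continuous_on P (\<lambda>x. ennreal (radial g r x))"
      using continuous_on_radial[OF g] that by (intro continuous_on_ennreal) auto
    then have "openin (top_of_set P) (P \<inter> (\<lambda>x. ennreal (radial g r x)) -` {a<..})"
      by (rule continuous_openin_preimage_gen) simp
    moreover have "P \<inter> (\<lambda>x. ennreal (radial g r x)) -` {a<..} = {x\<in>P. a < ennreal (radial g r x)}" by auto
    ultimately show ?thesis by simp
  qed
  ultimately show "openin (top_of_set P) {x\<in>P. a < ext g x}" by auto
qed

lemma ext_log_convex:
  assumes g: "log_cvx g"
  shows "log_convex_on P (ext g)"
  unfolding log_convex_on_def
proof (intro ballI)
  fix x y t assume x: "x \<in> P" and y: "y \<in> P" and t: "t \<in> {0..1::real}"
  let ?m = "(1 - t) *\<^sub>R x + t *\<^sub>R y"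
  have m: "?m \<in> P" using convexD[OF convexP x y, of "1 - t" t] t by simp
  have "ennreal (radial g r ?m) \<le> epowr (ext g x) (1 - t) * epowr (ext g y) t" if r: "r \<in> {0<..<1}" for r
  proof -
    let ?p = "\<lambda>x. z + r *\<^sub>R (x - z)"
    have px: "?p x \<in> interior P" "?p y \<in> interior P" by (rule radial_point; use x y r in auto)+
    have gp: "g (?p x) > 0" "g (?p y) > 0" "g z > 0" "g (?p ?m) > 0"
      using g px z_interior radial_point[OF m, of r] r by (auto simp: log_cvx_def)
    have "?p ?m = (1 - t) *\<^sub>R ?p x + t *\<^sub>R ?p y" by (simp add: algebra_simps)
    then have "g (?p ?m) \<le> g (?p x) powr (1 - t) * g (?p y) powr t" using g px t by (auto simp: log_cvx_def)
    then have "g (?p ?m) / g z powr (1 - r) \<le> g (?p x) powr (1 - t) * g (?p y) powr t / g z powr (1 - r)"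
      by (rule divide_right_mono) simp
    also have "\<dots> = (g (?p x) / g z powr (1 - r)) powr (1 - t) * (g (?p y) / g z powr (1 - r)) powr t"
    proof -
      \<comment> \<open>The normalising factor at \<open>z\<close> is shared between the two points
        with weights \<open>1 - t\<close> and \<open>t\<close>.\<close>
      have "(g z powr (1 - r)) powr (1 - t) * (g z powr (1 - r)) powr t = g z powr (1 - r)"
        using gp by (simp flip: powr_add)
      then show ?thesis using gp by (simp add: powr_divide)
    qed
    finally have "radial g r ?m \<le> ((g (?p x) / g z powr (1 - r)) powr (1 - t) * (g (?p y) / g z powr (1 - r)) powr t) powr (1 / r)"
      unfolding radial_def using r gp by (intro powr_mono2) (auto simp: algebra_simps)
    also have "\<dots> = radial g r x powr (1 - t) * radial g r y powr t"
      using gp by (simp add: radial_def powr_mult powr_powr mult.commute)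
    finally have "ennreal (radial g r ?m) \<le> epowr (ennreal (radial g r x)) (1 - t) * epowr (ennreal (radial g r y)) t"
      by (simp add: epowr_ennreal radial_def ennreal_leI flip: ennreal_mult'')
    also have "\<dots> \<le> epowr (ext g x) (1 - t) * epowr (ext g y) t"
      by (intro mult_mono epowr_mono) (use x y r t in \<open>auto simp: ext_def intro!: SUP_upper\<close>)
    finally show ?thesis .
  qed
  then show "ext g ?m \<le> epowr (ext g x) (1 - t) * epowr (ext g y) t"
    using m by (auto simp: ext_def[of g ?m] intro!: SUP_least)
qed

lemma AE_interior: "AE x in lborel. x \<in> P \<longrightarrow> x \<in> interior P"
proof -
  have "negligible (frontier P)" by (rule negligible_convex_frontier[OF convexP])
  then have "frontier P \<in> null_sets lborel" by (simp add: negligible_iff_null_sets null_sets_completion_iff)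
  moreover have "{x. \<not> (x \<in> P \<longrightarrow> x \<in> interior P)} \<subseteq> frontier P"
    using closure_subset by (auto simp: frontier_def)
  ultimately show ?thesis by (intro AE_I'[of "frontier P"]) auto
qed

lemma ext_in_M:
  assumes g: "log_cvx g" and int: "(\<integral>\<^sup>+x. ennreal (g x) * indicator (interior P) x \<partial>lborel) = emeasure lborel P"
  shows "ext g \<in> M"
proof -
  have "(\<integral>\<^sup>+x. ext g x \<partial>lborel) = (\<integral>\<^sup>+x. ennreal (g x) * indicator (interior P) x \<partial>lborel)"
  proof (rule nn_integral_cong_AE, rule AE_mp[OF AE_interior], rule AE_I2, rule impI)
    fix x assume x: "x \<in> P \<longrightarrow> x \<in> interior P"
    show "ext g x = ennreal (g x) * indicator (interior P) x"
    proof (cases "x \<in> interior P")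
      case True then show ?thesis by (simp add: log_cvx_ext_interior[OF g])
    next
      case False
      then have "x \<notin> P" using x by blast
      then show ?thesis using False by (simp add: ext_def)
    qed
  qed
  moreover have "ext g x = 0" if "x \<notin> P" for x using that by (simp add: ext_def)
  ultimately show ?thesis using int ext_lsc[OF g] ext_log_convex[OF g] ext_pos[OF g]
    by (simp add: M_def)
qed

lemma M_eq_interiorI:
  assumes "u \<in> M" "v \<in> M" "\<And>x. x \<in> interior P \<Longrightarrow> rf u x = rf v x"
  shows "u = v"
proof -
  have "ext (rf u) x = ext (rf v) x" for x
    using assms(3) radial_point[of x] z_interior by (auto simp: ext_def radial_def intro!: SUP_cong)
  then show ?thesis using ext_rf assms(1,2) by (metis ext)
qed

text \<open>Convex functions are continuous in the interior, so a single disagreement spreads to a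
  ball of positive volume; the boundary then follows the interior.\<close>

lemma M_eq_AE:
  assumes u: "u \<in> M" and v: "v \<in> M" and ae: "AE x in lborel. x \<in> interior P \<longrightarrow> rf u x = rf v x"
  shows "u = v"
proof (rule M_eq_interiorI[OF u v], rule ccontr)
  fix x assume x: "x \<in> interior P" and ne: "rf u x \<noteq> rf v x"
  have c: "continuous_on (interior P) (\<lambda>x. rf u x - rf v x)"
    using u v by (intro continuous_intros log_cvx_continuous M_log_cvx)
  then have "open (interior P \<inter> (\<lambda>x. rf u x - rf v x) -` (- {0}))"
    by (intro continuous_open_preimage) auto
  moreover have "x \<in> interior P \<inter> (\<lambda>x. rf u x - rf v x) -` (- {0})" using x ne by auto
  ultimately obtain e where e: "e > 0" "ball x e \<subseteq> interior P \<inter> (\<lambda>x. rf u x - rf v x) -` (- {0})"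
    using open_contains_ball by blast
  have "AE y in lborel. y \<notin> ball x e" using ae by eventually_elim (use e in auto)
  then have "emeasure lborel (ball x e) = 0" by (subst (asm) AE_iff_measurable[of "ball x e"]) auto
  then show False using emeasure_ball_pos[OF e(1), of x] by simp
qed

section \<open>Closure under arithmetic means\<close>

definition mid :: "('a \<Rightarrow> ennreal) \<Rightarrow> ('a \<Rightarrow> ennreal) \<Rightarrow> 'a \<Rightarrow> ennreal" where
  "mid u v x = ennreal (1/2) * u x + ennreal (1/2) * v x"

lemma half_half: "ennreal (1/2) * a + ennreal (1/2) * a = a"
proof -
  have "ennreal (1/2) * a + ennreal (1/2) * a = (ennreal (1/2) + ennreal (1/2)) * a" by (simp only: distrib_right)
  also have "ennreal (1/2) + ennreal (1/2) = 1" by (subst ennreal_plus[symmetric]) auto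
  finally show ?thesis by simp
qed

lemma epowr_scale:
  assumes k: "k > 0"
  shows "epowr (ennreal k * a) (1 - t) * epowr (ennreal k * b) t = ennreal k * (epowr a (1 - t) * epowr b t)"
proof -
  have scale: "epowr (ennreal k * a) s = ennreal (k powr s) * epowr a s" for a s
  proof (cases "a = \<infinity>")
    case True then show ?thesis using k by (simp add: epowr_def ennreal_mult_top)
  next
    case False
    then obtain r where "a = ennreal r" "r \<ge> 0" by (cases a) auto
    then show ?thesis using k by (simp add: epowr_ennreal powr_mult flip: ennreal_mult'')
  qed
  have "ennreal (k powr (1 - t)) * ennreal (k powr t) = ennreal k"
    using k by (simp flip: ennreal_mult'' powr_add)
  then show ?thesis unfolding scale by (metis mult.assoc mult.left_commute)
qed

text \<open>The normalisation is linear, which is why the arithmetic mean is used although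
  log-convexity is naturally compatible with the geometric one. Hoelder's inequality supplies
  log-convexity.\<close>

lemma mid_in_M:
  assumes u: "u \<in> M" and v: "v \<in> M"
  shows "mid u v \<in> M"
proof -
  have [measurable]: "u \<in> borel_measurable borel" "v \<in> borel_measurable borel" using u v by measurable
  have pos: "ennreal (1/2) * u x > 0" "ennreal (1/2) * v x > 0" if "x \<in> P" for x
    using M_pos[OF u that] M_pos[OF v that]
    by (simp_all only: ennreal_zero_less_mult_iff ennreal_less_zero_iff) simp_all
  have lsc_half: "lsc_on P (\<lambda>x. ennreal (1/2) * u x)" if u: "u \<in> M" for u
    unfolding lsc_on_def
  proof safe
    fix x a assume x: "x \<in> P" "a < ennreal (1/2) * u x"
    have two: "2 * (ennreal (1/2) * b) = b" for b using half_half[of b] by (simp only: mult_2)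
    then have two': "ennreal (1/2) * (2 * b) = b" for b by (simp only: mult.left_commute)
    have "ennreal (1/2) * b \<le> a \<longleftrightarrow> b \<le> 2 * a" for b
    proof
      assume "ennreal (1/2) * b \<le> a"
      from mult_left_mono[OF this, of 2] show "b \<le> 2 * a" unfolding two by simp
    next
      assume "b \<le> 2 * a"
      from mult_left_mono[OF this, of "ennreal (1/2)"] show "ennreal (1/2) * b \<le> a" unfolding two' by simp
    qed
    then have d: "a < ennreal (1/2) * b \<longleftrightarrow> 2 * a < b" for b by (simp only: not_le[symmetric])
    show "eventually (\<lambda>y. a < ennreal (1/2) * u y) (at x within P)"
      using M_lsc[OF u] x unfolding lsc_on_def d by blast
  qed
  have "lsc_on P (mid u v)"
    unfolding lsc_on_def
  proof safe
    fix x a assume x: "x \<in> P" "a < mid u v x"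
    obtain b c where bc: "b < ennreal (1/2) * u x" "c < ennreal (1/2) * v x" "a < b + c"
      using ennreal_less_add_split[OF x(2)[unfolded mid_def] pos[OF x(1)]] by blast
    have "eventually (\<lambda>y. b < ennreal (1/2) * u y) (at x within P)" "eventually (\<lambda>y. c < ennreal (1/2) * v y) (at x within P)"
      using lsc_half[OF u] lsc_half[OF v] x bc unfolding lsc_on_def by blast+
    then show "eventually (\<lambda>y. a < mid u v y) (at x within P)"
      by eventually_elim (use bc in \<open>auto simp: mid_def intro: less_le_trans[OF _ add_mono]\<close>)
  qed
  moreover have "log_convex_on P (mid u v)"
    unfolding log_convex_on_def
  proof (intro ballI)
    fix x y t assume x: "x \<in> P" and y: "y \<in> P" and t: "t \<in> {0..1::real}"
    let ?m = "(1 - t) *\<^sub>R x + t *\<^sub>R y"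
    have "mid u v ?m \<le> ennreal (1/2) * (epowr (u x) (1 - t) * epowr (u y) t) + ennreal (1/2) * (epowr (v x) (1 - t) * epowr (v y) t)"
      unfolding mid_def using t by (intro add_mono mult_left_mono M_log_convex u v x y) auto
    also have "\<dots> \<le> epowr (mid u v x) (1 - t) * epowr (mid u v y) t"
      unfolding mid_def using t pos[OF x] pos[OF y]
      by (subst (1 2) epowr_scale[symmetric]) (auto intro!: epowr_Holder_2)
    finally show "mid u v ?m \<le> epowr (mid u v x) (1 - t) * epowr (mid u v y) t" .
  qed
  moreover have "(\<integral>\<^sup>+x. mid u v x \<partial>lborel) = emeasure lborel P"
    unfolding mid_def
    by (subst nn_integral_add, simp, simp, subst (1 2) nn_integral_cmult)
       (simp_all only: M_integral[OF u] M_integral[OF v] half_half measurable_lborel1, simp_all)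
  moreover have "mid u v x = 0" if "x \<notin> P" for x
    unfolding mid_def M_zero[OF u that] M_zero[OF v that] by simp
  moreover have "mid u v x > 0" if "x \<in> P" for x
    unfolding mid_def using pos[OF that] by (intro add_pos_pos)
  ultimately show ?thesis by (simp add: M_def)
qed

lemma indicator_in_M: "indicator P \<in> M"
proof -
  have "lsc_on P (indicator P)"
    unfolding lsc_on_def
  proof safe
    fix x a assume "x \<in> P" "a < (indicator P x :: ennreal)"
    then have "a < indicator P y" if "y \<in> P" for y using that by simp
    then show "eventually (\<lambda>y. a < indicator P y) (at x within P)"
      by (simp add: eventually_at_filter)
  qed
  moreover have "epowr 1 s = 1" for s
    using epowr_ennreal[of 1 s] by simp
  ultimately show ?thesis
    by (auto simp: M_def log_convex_on_def indicator_def)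
qed

lemma rf_mid:
  assumes "u \<in> M" "v \<in> M" "x \<in> interior P"
  shows "rf (mid u v) x = (rf u x + rf v x) / 2"
proof -
  have k: "ennreal k * ennreal a + ennreal k * ennreal b = ennreal (k * a + k * b)" if "k > 0" "a > 0" "b > 0" for k a b
    using that by (simp add: ennreal_mult'' ennreal_plus)
  have "mid u v x = ennreal (1/2) * ennreal (rf u x) + ennreal (1/2) * ennreal (rf v x)"
    unfolding mid_def using M_rf(1)[OF assms(1,3)] M_rf(1)[OF assms(2,3)] by metis
  also have "\<dots> = ennreal ((1/2) * rf u x + (1/2) * rf v x)"
    using M_rf(2)[OF assms(1,3)] M_rf(2)[OF assms(2,3)] by (intro k) auto
  finally have "rf (mid u v) x = (1/2) * rf u x + (1/2) * rf v x"
    using M_rf(2)[OF assms(1,3)] M_rf(2)[OF assms(2,3)] by (simp only: rf_def[of "mid u v"]) simp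
  then show ?thesis by simp
qed

lemma rf_measurable [measurable_dest]: "u \<in> M \<Longrightarrow> rf u \<in> borel_measurable borel"
proof -
  assume "u \<in> M"
  then have [measurable]: "u \<in> borel_measurable borel" by measurable
  show ?thesis unfolding rf_def[abs_def] by measurable
qed

end

section \<open>Entropy and limits of Hellinger-Cauchy sequences\<close>

definition phi :: "real \<Rightarrow> real" where "phi a = a * ln a"

lemma phi_ge: "a > 0 \<Longrightarrow> a - 1 \<le> phi a"
proof -
  assume a: "a > 0"
  have "ln (1 / a) \<le> 1 / a - 1" by (rule ln_le_minus_one) (use a in simp)
  then have "a * (- ln a) \<le> a * (1 / a - 1)" using a by (intro mult_left_mono) (auto simp: ln_div)
  then show ?thesis using a by (simp add: phi_def right_diff_distrib)
qed

text \<open>With \<open>m\<close> the mean, the defect is \<open>a ln (a/m) + b ln (b/m)\<close>.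
  The bound \<open>ln y \<le> y - 1\<close> at \<open>y = sqrt m / sqrt x\<close> gives
  \<open>x ln (x/m) \<ge> 2 x - 2 sqrt (x m)\<close>, and \<open>2 m = a + b\<close> completes the
  two squares around \<open>sqrt m\<close>.\<close>

lemma phi_midpoint_gap:
  assumes a: "a > 0" and b: "b > 0"
  shows "2 * phi ((a + b) / 2) + (sqrt a - sqrt b)\<^sup>2 / 2 \<le> phi a + phi b"
proof -
  define m where "m = (a + b) / 2"
  have m: "m > 0" using a b by (simp add: m_def)
  have *: "x * ln x - x * ln m \<ge> 2 * x - 2 * (sqrt x * sqrt m)" if x: "x > 0" for x
  proof -
    have "ln (sqrt m / sqrt x) \<le> sqrt m / sqrt x - 1" by (rule ln_le_minus_one) (use x m in simp)
    moreover have "ln (sqrt m / sqrt x) = ln m / 2 - ln x / 2" using x m by (simp add: ln_div ln_sqrt)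
    ultimately have "2 * x * (ln m / 2 - ln x / 2) \<le> 2 * x * (sqrt m / sqrt x - 1)"
      using x by (intro mult_left_mono) auto
    moreover have "2 * x * (ln m / 2 - ln x / 2) = x * ln m - x * ln x"
      "2 * x * (sqrt m / sqrt x - 1) = 2 * (x * (sqrt m / sqrt x)) - 2 * x"
      by (simp_all add: algebra_simps)
    moreover have "x * (sqrt m / sqrt x) = (x / sqrt x) * sqrt m" by simp
    then have "x * (sqrt m / sqrt x) = sqrt x * sqrt m" using x by (simp only: real_div_sqrt[OF less_imp_le])
    ultimately show ?thesis by linarith
  qed
  have "2 * phi m = a * ln m + b * ln m" by (simp add: phi_def m_def algebra_simps)
  moreover have "phi a + phi b - (a * ln m + b * ln m) \<ge> (2 * a - 2 * (sqrt a * sqrt m)) + (2 * b - 2 * (sqrt b * sqrt m))"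
    using *[OF a] *[OF b] by (simp add: phi_def)
  moreover have "(2 * a - 2 * (sqrt a * sqrt m)) + (2 * b - 2 * (sqrt b * sqrt m)) = (sqrt a - sqrt m)\<^sup>2 + (sqrt b - sqrt m)\<^sup>2"
    using a b m by (simp add: power2_diff) (simp add: m_def)
  moreover have "(sqrt a - sqrt b)\<^sup>2 / 2 \<le> (sqrt a - sqrt m)\<^sup>2 + (sqrt b - sqrt m)\<^sup>2"
  proof -
    have "(p - q)\<^sup>2 \<le> 2 * ((p - r)\<^sup>2 + (q - r)\<^sup>2)" for p q r :: real
      using zero_le_power2[of "p + q - 2 * r"] by (simp add: power2_eq_square algebra_simps)
    then have "(p - q)\<^sup>2 / 2 \<le> (p - r)\<^sup>2 + (q - r)\<^sup>2" for p q r :: real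
      by (simp add: pos_divide_le_eq mult.commute)
    then show ?thesis .
  qed
  ultimately show ?thesis by (simp add: m_def)
qed

text \<open>Factor \<open>a - b\<close> as a difference of squares of roots and apply the weighted
  inequality between arithmetic and geometric mean. The weight \<open>e\<close> trades total mass
  against Hellinger distance, which turns Hellinger bounds into bounds in the mean.\<close>

lemma abs_diff_le_sqrt_diff:
  assumes a: "a \<ge> 0" and b: "b \<ge> 0" and e: "e > 0"
  shows "\<bar>a - b\<bar> \<le> e * (a + b) + (2 / e) * ((sqrt a - sqrt b)\<^sup>2 / 4)"
proof -
  define p q where "p = \<bar>sqrt a - sqrt b\<bar>" and "q = sqrt a + sqrt b"
  have "\<bar>a - b\<bar> = p * q"
  proof -
    have "a - b = (sqrt a - sqrt b) * (sqrt a + sqrt b)" using a b by (simp add: algebra_simps)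
    then show ?thesis using a b by (simp add: p_def q_def abs_mult)
  qed
  also have "p * q \<le> p\<^sup>2 / (2 * e) + e * q\<^sup>2 / 2"
  proof -
    have "0 \<le> (p - e * q)\<^sup>2 / (2 * e)" using e by simp
    also have "\<dots> = p\<^sup>2 / (2 * e) + e * q\<^sup>2 / 2 - p * q" using e by (simp add: power2_eq_square field_simps)
    finally show ?thesis by simp
  qed
  also have "e * q\<^sup>2 / 2 \<le> e * (a + b)"
  proof -
    have "q\<^sup>2 \<le> 2 * (a + b)"
      using zero_le_power2[of "sqrt a - sqrt b"] a b by (simp add: q_def power2_sum power2_diff)
    then have "e * q\<^sup>2 \<le> e * (2 * (a + b))" using e by (intro mult_left_mono) auto
    then show ?thesis by (simp add: algebra_simps)
  qed
  finally show ?thesis by (simp add: p_def)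
qed

context convex_body
begin

text \<open>The shift by \<open>1\<close> makes the integrand nonnegative (\<open>phi a \<ge> a - 1\<close>), so \<open>En\<close> is the negative of the
  unnormalised entropy plus the volume of \<open>P\<close>.\<close>

definition En :: "('a \<Rightarrow> ennreal) \<Rightarrow> ennreal" where
  "En u = (\<integral>\<^sup>+x. ennreal (phi (rf u x) + 1) * indicator (interior P) x \<partial>lborel)"

definition Hd :: "('a \<Rightarrow> ennreal) \<Rightarrow> ('a \<Rightarrow> ennreal) \<Rightarrow> ennreal" where
  "Hd u v = (\<integral>\<^sup>+x. ennreal ((sqrt (rf u x) - sqrt (rf v x))\<^sup>2 / 4) * indicator (interior P) x \<partial>lborel)"

lemma phi_measurable [measurable]: "phi \<in> borel_measurable borel"
  unfolding phi_def[abs_def] by measurable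

lemma En_mid:
  assumes u: "u \<in> M" and v: "v \<in> M"
  shows "2 * (En (mid u v) + Hd u v) \<le> En u + En v"
proof -
  have [measurable]: "rf u \<in> borel_measurable borel" "rf v \<in> borel_measurable borel"
    "rf (mid u v) \<in> borel_measurable borel"
    using u v mid_in_M[OF u v] by measurable
  let ?A = "\<lambda>x. ennreal (phi (rf (mid u v) x) + 1) * indicator (interior P) x"
  let ?D = "\<lambda>x. ennreal ((sqrt (rf u x) - sqrt (rf v x))\<^sup>2 / 4) * indicator (interior P) x"
  have "2 * (En (mid u v) + Hd u v) = (\<integral>\<^sup>+x. 2 * (?A x + ?D x) \<partial>lborel)"
    unfolding En_def Hd_def by (subst nn_integral_cmult, measurable, subst nn_integral_add) measurable
  also have "\<dots> \<le> (\<integral>\<^sup>+x. ennreal (phi (rf u x) + 1) * indicator (interior P) x + ennreal (phi (rf v x) + 1) * indicator (interior P) x \<partial>lborel)"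
  proof (rule nn_integral_mono)
    fix x
    show "2 * (?A x + ?D x) \<le> ennreal (phi (rf u x) + 1) * indicator (interior P) x + ennreal (phi (rf v x) + 1) * indicator (interior P) x"
    proof (cases "x \<in> interior P")
      case x: True
      note p = M_rf(2)[OF u x] M_rf(2)[OF v x]
      let ?m = "(rf u x + rf v x) / 2"
      have "?m > 0" using p by simp
      \<comment> \<open>Without these signs \<open>ennreal\<close> would cut off the summands and
        the real inequality would not transfer.\<close>
      then have ge: "0 \<le> phi (rf u x) + 1" "0 \<le> phi (rf v x) + 1" "0 \<le> phi ?m + 1"
        using phi_ge[OF p(1)] phi_ge[OF p(2)] phi_ge[OF \<open>?m > 0\<close>] p by linarith+
      have two: "2 * (ennreal a + ennreal b) = ennreal (2 * (a + b))" if "a \<ge> 0" "b \<ge> 0" for a b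
        using that by (subst ennreal_mult') (auto simp: ennreal_plus)
      have "2 * (ennreal (phi ?m + 1) + ennreal ((sqrt (rf u x) - sqrt (rf v x))\<^sup>2 / 4))
          = ennreal (2 * ((phi ?m + 1) + (sqrt (rf u x) - sqrt (rf v x))\<^sup>2 / 4))"
        by (rule two) (use ge in auto)
      also have "\<dots> \<le> ennreal ((phi (rf u x) + 1) + (phi (rf v x) + 1))"
        using phi_midpoint_gap[OF p] by (intro ennreal_leI) (simp add: algebra_simps)
      also have "\<dots> = ennreal (phi (rf u x) + 1) + ennreal (phi (rf v x) + 1)" using ge(1,2) by (rule ennreal_plus)
      finally show ?thesis using x by (simp add: rf_mid[OF u v x])
    qed simp
  qed
  also have "\<dots> = En u + En v"
    unfolding En_def by (subst nn_integral_add) measurable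
  finally show ?thesis .
qed

lemma Hd_eq_0:
  assumes u: "u \<in> M" and v: "v \<in> M" and D: "Hd u v = 0"
  shows "u = v"
proof (rule M_eq_AE[OF u v])
  have [measurable]: "rf u \<in> borel_measurable borel" "rf v \<in> borel_measurable borel" using u v by measurable
  have "AE x in lborel. ennreal ((sqrt (rf u x) - sqrt (rf v x))\<^sup>2 / 4) * indicator (interior P) x = 0"
    using D unfolding Hd_def by (subst (asm) nn_integral_0_iff_AE) measurable
  then show "AE x in lborel. x \<in> interior P \<longrightarrow> rf u x = rf v x"
  proof (rule AE_mp, intro AE_I2 impI)
    fix x assume "ennreal ((sqrt (rf u x) - sqrt (rf v x))\<^sup>2 / 4) * indicator (interior P) x = 0" "x \<in> interior P"
    then have "(sqrt (rf u x) - sqrt (rf v x))\<^sup>2 / 4 \<le> 0" by (simp add: ennreal_eq_0_iff)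
    then have "(sqrt (rf u x) - sqrt (rf v x))\<^sup>2 = 0" using zero_le_power2[of "sqrt (rf u x) - sqrt (rf v x)"] by linarith
    then show "rf u x = rf v x" by simp
  qed
qed

lemma rf_nonneg: "rf u x \<ge> 0" by (simp add: rf_def)

lemma M_rf_integral:
  assumes u: "u \<in> M"
  shows "(\<integral>\<^sup>+x. ennreal (rf u x) * indicator (interior P) x \<partial>lborel) = emeasure lborel P"
  unfolding M_integral[OF u, symmetric]
proof (rule nn_integral_cong_AE, rule AE_mp[OF AE_interior], rule AE_I2, rule impI)
  fix x assume x: "x \<in> P \<longrightarrow> x \<in> interior P"
  show "ennreal (rf u x) * indicator (interior P) x = u x"
    using M_rf(1)[OF u, of x] M_zero[OF u, of x] x by (cases "x \<in> interior P") auto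
qed

section \<open>Uniform interior regularity and passage to the limit\<close>

lemma M_rf_bound:
  assumes u: "u \<in> M" and e: "e > 0" and B: "ball x e \<subseteq> P"
  shows "rf u x \<le> measure lborel P / measure lborel (ball (0::'a) e)"
proof -
  let ?b = "measure lborel (ball x e)"
  have "emeasure lborel (ball x e) = emeasure lborel (ball (0::'a) e)"
    using emeasure_lborel_affine[of "ball x e" 1 x] by (simp add: dist_norm ball_def)
  then have bb: "?b = measure lborel (ball (0::'a) e)" by (simp add: measure_def)
  have b: "?b > 0" by (rule measure_ball_pos[OF e])
  have eb: "emeasure lborel (ball x e) = ennreal ?b"
    using emeasure_lborel_ball_finite[of x e] by (intro emeasure_eq_ennreal_measure) auto
  have "x \<in> interior P" using e B by (meson centre_in_ball interior_maximal open_ball subsetD)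
  then have a: "u x = ennreal (rf u x)" "rf u x \<ge> 0" using M_rf[OF u] by (auto simp: less_imp_le)
  have "u x * emeasure lborel (ball x e) \<le> emeasure lborel P"
    using order_trans[OF M_mean_value[OF u B] M_ball_integral_le[OF u]] .
  then have "rf u x * ?b \<le> measure lborel P"
    using a b unfolding eb emeasure_P_eq by (simp add: ennreal_mult''[symmetric])
  then show ?thesis using b by (simp add: pos_le_divide_eq flip: bb)
qed

text \<open>A convex function between 0 and \<open>b\<close> on a ball is Lipschitz near the centre
  with a constant that depends on \<open>b\<close> and the radius only, and
  \<open>M_rf_bound\<close> provides one \<open>b\<close> for the whole class.\<close>

lemma M_equi_Lipschitz:
  assumes e: "e > 0" and B: "ball x (2 * e) \<subseteq> P"
  shows "\<exists>L. \<forall>u\<in>M. \<forall>w. norm w < e / 2 \<longrightarrow> \<bar>rf u (x + w) - rf u x\<bar> \<le> L * norm w"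
proof (intro exI ballI allI impI)
  define b where "b = measure lborel P / measure lborel (ball (0::'a) e)"
  fix u and w :: 'a assume u: "u \<in> M" and w: "norm w < e / 2"
  have bound: "rf u y \<le> b" if "y \<in> ball x e" for y
  proof -
    have "ball y e \<subseteq> ball x (2 * e)" using that 
    proof (intro subsetI)
      fix v assume "v \<in> ball y e"
      then show "v \<in> ball x (2 * e)" using dist_triangle[of x v y] that by simp
    qed
    then show ?thesis unfolding b_def using M_rf_bound[OF u e] B by blast
  qed
  have I: "y \<in> interior P" if "y \<in> ball x e" for y
  proof -
    have "ball x e \<subseteq> P" using B e by (meson ball_subset_ball_iff order_trans subset_ball less_imp_le mult_le_cancel_right1 one_le_numeral)
    then show ?thesis using that by (meson interior_maximal open_ball subsetD)
  qed
  show "\<bar>rf u (x + w) - rf u x\<bar> \<le> (2 * b / e) * norm w"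
  proof (cases "w = 0")
    case False
    \<comment> \<open>Chosen so that \<open>x + (1/t) *\<^sub>R w\<close> has distance
      \<open>e / 2\<close> from \<open>x\<close>; then \<open>x + w\<close> is a convex combination
      of this point and \<open>x\<close>.\<close>
    define t where "t = 2 * norm w / e"
    have t: "0 < t" "t < 1" using w e False by (auto simp: t_def field_simps)
    have tw: "norm ((1/t) *\<^sub>R w) = e / 2" using False e by (simp add: t_def)
    have cv: "convex_on (interior P) (rf u)" by (rule log_cvx_convex[OF M_log_cvx[OF u]])
    have pts: "x \<in> ball x e" "x + w \<in> ball x e" "x + (1/t) *\<^sub>R w \<in> ball x e" "x - (1/t) *\<^sub>R w \<in> ball x e"
      using e w tw by (auto simp: dist_norm)
    have "rf u ((1 - t) *\<^sub>R x + t *\<^sub>R (x + (1/t) *\<^sub>R w)) \<le> (1 - t) * rf u x + t * rf u (x + (1/t) *\<^sub>R w)"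
      by (rule convex_onD[OF cv]) (use t I pts in auto)
    also have "(1 - t) *\<^sub>R x + t *\<^sub>R (x + (1/t) *\<^sub>R w) = x + w" using t by (simp add: algebra_simps)
    also have "(1 - t) * rf u x + t * rf u (x + (1/t) *\<^sub>R w) \<le> rf u x + t * b"
      using bound[OF pts(3)] rf_nonneg[of u x] t by (intro add_mono mult_left_mono) (auto simp: mult_left_le_one_le)
    finally have 1: "rf u (x + w) - rf u x \<le> t * b" by simp
    \<comment> \<open>With this weight \<open>1 - s = s / t\<close>, so \<open>x\<close> itself is
      the convex combination of \<open>x + w\<close> and the opposite point
      \<open>x - (1/t) *\<^sub>R w\<close>.\<close>
    define s where "s = t / (1 + t)"
    have s: "0 < s" "s < 1" "s \<le> t" using t by (auto simp: s_def field_simps)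
    have "rf u ((1 - s) *\<^sub>R (x + w) + s *\<^sub>R (x - (1/t) *\<^sub>R w)) \<le> (1 - s) * rf u (x + w) + s * rf u (x - (1/t) *\<^sub>R w)"
      by (rule convex_onD[OF cv]) (use s I pts in auto)
    also have "(1 - s) *\<^sub>R (x + w) + s *\<^sub>R (x - (1/t) *\<^sub>R w) = x + ((1 - s) - s / t) *\<^sub>R w" by (simp add: algebra_simps)
    also have "(1 - s) - s / t = 0"
    proof -
      have "1 - s = 1 / (1 + t)" using t by (simp add: s_def field_simps)
      moreover have "s / t = 1 / (1 + t)" using t by (simp add: s_def)
      ultimately show ?thesis by simp
    qed
    also have "(1 - s) * rf u (x + w) + s * rf u (x - (1/t) *\<^sub>R w) \<le> rf u (x + w) + s * b"
      using bound[OF pts(4)] rf_nonneg[of u "x + w"] s by (intro add_mono mult_left_mono) (auto simp: mult_left_le_one_le)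
    finally have "rf u x \<le> rf u (x + w) + s * b" by simp
    moreover have "b \<ge> 0" using order_trans[OF rf_nonneg bound[OF pts(1)]] .
    ultimately have "rf u x - rf u (x + w) \<le> t * b" using mult_right_mono[OF s(3), of b] by linarith
    with 1 show ?thesis by (simp add: t_def abs_le_iff mult.commute mult.left_commute)
  qed simp
qed

text \<open>Points of convergence are dense, and equi-Lipschitz bounds carry the Cauchy property
  from them to \<open>x\<close>. Rays are null sets, so the radial extension of a limit could not be
  controlled by convergence almost everywhere.\<close>

lemma M_convergent_everywhere:
  assumes s: "\<And>j. s j \<in> M" and ae: "AE x in lborel. x \<in> interior P \<longrightarrow> convergent (\<lambda>j. rf (s j) x)"
    and x: "x \<in> interior P"
  shows "convergent (\<lambda>j. rf (s j) x)"
proof -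
  obtain e0 where e0: "e0 > 0" "ball x e0 \<subseteq> interior P" using x open_contains_ball[of "interior P"] by auto
  define e where "e = e0 / 2"
  have e: "e > 0" "ball x (2 * e) \<subseteq> P" "ball x (2 * e) \<subseteq> interior P" using e0 interior_subset by (auto simp: e_def)
  obtain L where L: "\<And>u w. u \<in> M \<Longrightarrow> norm w < e / 2 \<Longrightarrow> \<bar>rf u (x + w) - rf u x\<bar> \<le> L * norm w"
    using M_equi_Lipschitz[OF e(1,2)] by blast
  have "Cauchy (\<lambda>j. rf (s j) x)"
  proof (rule metric_CauchyI)
    fix \<epsilon> :: real assume \<epsilon>: "\<epsilon> > 0"
    define d where "d = min (e / 2) (\<epsilon> / (4 * (\<bar>L\<bar> + 1)))"
    have d: "d > 0" using e \<epsilon> by (auto simp: d_def)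
    have "\<exists>y\<in>ball x d. convergent (\<lambda>j. rf (s j) y)"
    proof (rule ccontr)
      assume no: "\<not> ?thesis"
      have sub: "ball x d \<subseteq> interior P" using e(1,3) by (auto simp: d_def subset_eq)
      have "AE y in lborel. y \<notin> ball x d" using ae by eventually_elim (use no sub in blast)
      then have "emeasure lborel (ball x d) = 0" by (subst (asm) AE_iff_measurable[of "ball x d"]) auto
      then show False using emeasure_ball_pos[OF d, of x] by simp
    qed
    then obtain y where y: "y \<in> ball x d" "convergent (\<lambda>j. rf (s j) y)" by blast
    define w where "w = y - x"
    have w: "norm w < d" "y = x + w" using y by (auto simp: w_def dist_norm norm_minus_commute)
    have close: "\<bar>rf (s j) y - rf (s j) x\<bar> \<le> \<epsilon> / 4" for j
    proof -
      have "\<bar>rf (s j) y - rf (s j) x\<bar> \<le> L * norm w" unfolding w(2) by (rule L[OF s]) (use w in \<open>auto simp: d_def\<close>)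
      also have "\<dots> \<le> (\<bar>L\<bar> + 1) * (\<epsilon> / (4 * (\<bar>L\<bar> + 1)))" by (intro mult_mono) (use w \<epsilon> in \<open>auto simp: d_def\<close>)
      also have "\<dots> = \<epsilon> / 4" by (simp add: field_simps)
      finally show ?thesis .
    qed
    obtain N where N: "\<And>i j. i \<ge> N \<Longrightarrow> j \<ge> N \<Longrightarrow> dist (rf (s i) y) (rf (s j) y) < \<epsilon> / 4"
      using convergent_Cauchy[OF y(2)] \<epsilon> unfolding Cauchy_def by (meson divide_pos_pos zero_less_numeral)
    show "\<exists>N. \<forall>i\<ge>N. \<forall>j\<ge>N. dist (rf (s i) x) (rf (s j) x) < \<epsilon>"
    proof (intro exI allI impI)
      fix i j assume "i \<ge> N" "j \<ge> N"
      from N[OF this] close[of i] close[of j] \<epsilon> show "dist (rf (s i) x) (rf (s j) x) < \<epsilon>"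
        unfolding dist_real_def by linarith
    qed
  qed
  then show ?thesis by (rule Cauchy_convergent)
qed

lemma M_limit:
  assumes s: "\<And>j. s j \<in> M" and D: "\<And>j. Hd (s j) (s (Suc j)) \<le> ennreal ((1/4) ^ j)"
  obtains u where "u \<in> M" "\<And>x. x \<in> P \<Longrightarrow> u x \<le> liminf (\<lambda>j. s j x)" "En u \<le> liminf (\<lambda>j. En (s j))"
proof -
  define f where "f j = rf (s j)" for j
  have [measurable]: "f j \<in> borel_measurable borel" for j unfolding f_def using s[of j] by measurable
  have f0: "f j x \<ge> 0" for j x by (simp add: f_def rf_nonneg)
  let ?I = "interior P"
  let ?V = "measure lborel P"
  have fint: "(\<integral>\<^sup>+x. ennreal (f j x) * indicator ?I x \<partial>lborel) = ennreal ?V" for j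
    using M_rf_integral[OF s[of j]] by (simp add: f_def emeasure_P_eq)
  have expand: "ennreal (d * (a + b) + k * c) = ennreal d * ennreal a + ennreal d * ennreal b + ennreal k * ennreal c"
    if "a \<ge> 0" "b \<ge> 0" "c \<ge> 0" "d \<ge> 0" "k \<ge> 0" for a b c d k
    using that by (simp add: distrib_left ennreal_mult')
  have step: "(\<integral>\<^sup>+x. ennreal \<bar>f j x - f (Suc j) x\<bar> * indicator ?I x \<partial>lborel) \<le> ennreal ((2 * ?V + 2) * (1/2) ^ j)" for j
  proof -
    define h where "h x = (sqrt (f j x) - sqrt (f (Suc j) x))\<^sup>2 / 4" for x
    have [measurable]: "h \<in> borel_measurable borel" unfolding h_def[abs_def] by measurable
    have h0: "h x \<ge> 0" for x by (simp add: h_def)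
    \<comment> \<open>This weight balances the two terms: the mass enters with \<open>d\<close> and
      the Hellinger distance with \<open>(2 / d) * (1/4) ^ j\<close>, both of order
      \<open>(1/2) ^ j\<close> and hence summable.\<close>
    define d :: real where "d = (1/2) ^ j"
    have d: "d > 0" by (simp add: d_def)
    have "(\<integral>\<^sup>+x. ennreal \<bar>f j x - f (Suc j) x\<bar> * indicator ?I x \<partial>lborel) \<le>
      (\<integral>\<^sup>+x. ennreal d * (ennreal (f j x) * indicator ?I x) + ennreal d * (ennreal (f (Suc j) x) * indicator ?I x) + ennreal (2 / d) * (ennreal (h x) * indicator ?I x) \<partial>lborel)"
    proof (rule nn_integral_mono)
      fix x
      have "ennreal \<bar>f j x - f (Suc j) x\<bar> \<le> ennreal (d * (f j x + f (Suc j) x) + (2 / d) * h x)"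
        unfolding h_def by (intro ennreal_leI abs_diff_le_sqrt_diff f0 d)
      also have "\<dots> = ennreal d * ennreal (f j x) + ennreal d * ennreal (f (Suc j) x) + ennreal (2 / d) * ennreal (h x)"
        by (rule expand) (use d f0[of j x] f0[of "Suc j" x] h0[of x] in auto)
      finally show "ennreal \<bar>f j x - f (Suc j) x\<bar> * indicator ?I x \<le> ennreal d * (ennreal (f j x) * indicator ?I x) + ennreal d * (ennreal (f (Suc j) x) * indicator ?I x) + ennreal (2 / d) * (ennreal (h x) * indicator ?I x)"
        by (cases "x \<in> ?I") auto
    qed
    also have "\<dots> = ennreal d * ennreal ?V + ennreal d * ennreal ?V + ennreal (2 / d) * (\<integral>\<^sup>+x. ennreal (h x) * indicator ?I x \<partial>lborel)"
      by (subst nn_integral_add, measurable, subst nn_integral_add, measurable, (subst nn_integral_cmult, measurable)+) (simp add: fint)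
    also have "\<dots> \<le> ennreal d * ennreal ?V + ennreal d * ennreal ?V + ennreal (2 / d) * ennreal ((1/4) ^ j)"
      using D[of j] unfolding Hd_def h_def f_def by (intro add_mono mult_left_mono) auto
    also have "\<dots> = ennreal (d * (?V + ?V) + (2 / d) * (1/4) ^ j)"
      by (rule expand[symmetric]) (use d measure_P_pos in auto)
    also have "d * (?V + ?V) + (2 / d) * (1/4) ^ j = (2 * ?V + 2) * (1/2) ^ j"
    proof -
      have "(1/4) ^ j = d * d" unfolding d_def by (simp flip: power_mult_distrib)
      then show ?thesis using d by (simp add: algebra_simps flip: d_def)
    qed
    finally show ?thesis .
  qed
  \<comment> \<open>The total variation of the sequence at \<open>x\<close>. Its finite integral
    gives convergence almost everywhere, and \<open>f 0 + W\<close> dominates every member, so no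
    mass is lost in the limit.\<close>
  define W where "W x = (\<Sum>j. ennreal \<bar>f j x - f (Suc j) x\<bar> * indicator ?I x)" for x
  have [measurable]: "W \<in> borel_measurable borel" unfolding W_def[abs_def] by measurable
  have Wint: "(\<integral>\<^sup>+x. W x \<partial>lborel) < \<infinity>"
  proof -
    have "(\<integral>\<^sup>+x. W x \<partial>lborel) = (\<Sum>j. \<integral>\<^sup>+x. ennreal \<bar>f j x - f (Suc j) x\<bar> * indicator ?I x \<partial>lborel)"
      unfolding W_def by (rule nn_integral_suminf) measurable
    also have "\<dots> \<le> (\<Sum>j. ennreal ((2 * ?V + 2) * (1/2) ^ j))"
      by (intro suminf_le step) auto
    also have "\<dots> = ennreal (\<Sum>j. (2 * ?V + 2) * (1/2) ^ j)"
      using measure_P_pos by (intro suminf_ennreal2 summable_mult summable_geometric) auto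
    also have "\<dots> < \<infinity>" by simp
    finally show ?thesis .
  qed
  have Wae: "AE x in lborel. W x < \<infinity>"
    using nn_integral_PInf_AE[of W lborel] Wint by (auto simp: less_top)
  have conv: "convergent (\<lambda>j. f j x)" and dom: "ennreal (f n x) \<le> ennreal (f 0 x) + W x" if "W x < \<infinity>" "x \<in> ?I" for x n
  proof -
    have W: "W x = (\<Sum>j. ennreal \<bar>f j x - f (Suc j) x\<bar>)" using that by (simp add: W_def)
    have tel: "(\<Sum>j<n. f (Suc j) x - f j x) = f n x - f 0 x" for n by (rule sum_lessThan_telescope)
    have sm: "summable (\<lambda>j. \<bar>f j x - f (Suc j) x\<bar>)"
      by (rule summable_suminf_not_top) (use that W in auto)
    have "summable (\<lambda>j. \<bar>f (Suc j) x - f j x\<bar>)" using sm by (subst abs_minus_commute)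
    then have "summable (\<lambda>j. f (Suc j) x - f j x)" by (rule summable_rabs_cancel)
    then have "convergent (\<lambda>n. \<Sum>j<n. f (Suc j) x - f j x)" by (simp add: summable_iff_convergent)
    then have "convergent (\<lambda>n. f n x - f 0 x)" unfolding tel .
    then have "convergent (\<lambda>n. (f n x - f 0 x) + f 0 x)" by (intro convergent_add convergent_const)
    then show "convergent (\<lambda>j. f j x)" by simp
    have "f n x - f 0 x = (\<Sum>j<n. f (Suc j) x - f j x)" by (rule tel[symmetric])
    also have "\<dots> \<le> (\<Sum>j<n. \<bar>f j x - f (Suc j) x\<bar>)" by (intro sum_mono) auto
    also have "\<dots> \<le> (\<Sum>j. \<bar>f j x - f (Suc j) x\<bar>)" by (intro sum_le_suminf sm) auto
    finally have "ennreal (f n x) \<le> ennreal (f 0 x + (\<Sum>j. \<bar>f j x - f (Suc j) x\<bar>))" by (intro ennreal_leI) simp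
    also have "\<dots> = ennreal (f 0 x) + ennreal (\<Sum>j. \<bar>f j x - f (Suc j) x\<bar>)"
      by (intro ennreal_plus f0 suminf_nonneg sm) auto
    also have "ennreal (\<Sum>j. \<bar>f j x - f (Suc j) x\<bar>) = W x"
      unfolding W by (rule suminf_ennreal2[symmetric]) (use sm in auto)
    finally show "ennreal (f n x) \<le> ennreal (f 0 x) + W x" .
  qed
  have "AE x in lborel. x \<in> ?I \<longrightarrow> convergent (\<lambda>j. rf (s j) x)"
    using Wae by eventually_elim (use conv in \<open>auto simp: f_def\<close>)
  then have conv': "convergent (\<lambda>j. f j x)" if "x \<in> ?I" for x
    unfolding f_def by (intro M_convergent_everywhere s that)
  define g where "g x = lim (\<lambda>j. f j x)" for x
  have [measurable]: "g \<in> borel_measurable borel" unfolding g_def[abs_def] by measurable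
  have lim: "(\<lambda>j. f j x) \<longlonglongrightarrow> g x" if "x \<in> ?I" for x
    using conv'[OF that] by (simp add: g_def convergent_LIMSEQ_iff)
  have g0: "g x \<ge> 0" if "x \<in> ?I" for x
    by (rule LIMSEQ_le_const[OF lim[OF that]]) (use f0 in auto)
  have gint: "(\<integral>\<^sup>+x. ennreal (g x) * indicator ?I x \<partial>lborel) = ennreal ?V"
  proof -
    have "(\<lambda>j. \<integral>\<^sup>+x. ennreal (f j x) * indicator ?I x \<partial>lborel) \<longlonglongrightarrow> (\<integral>\<^sup>+x. ennreal (g x) * indicator ?I x \<partial>lborel)"
    proof (rule nn_integral_dominated_convergence[where w="\<lambda>x. ennreal (f 0 x) * indicator ?I x + W x"])
      show "AE x in lborel. ennreal (f j x) * indicator ?I x \<le> ennreal (f 0 x) * indicator ?I x + W x" for j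
        using Wae by eventually_elim (use dom in \<open>auto simp: indicator_def\<close>)
      show "(\<integral>\<^sup>+x. ennreal (f 0 x) * indicator ?I x + W x \<partial>lborel) < \<infinity>"
        by (subst nn_integral_add) (use Wint in \<open>auto simp: fint\<close>)
      show "AE x in lborel. (\<lambda>j. ennreal (f j x) * indicator ?I x) \<longlonglongrightarrow> ennreal (g x) * indicator ?I x"
      proof (rule AE_I2)
        fix x
        show "(\<lambda>j. ennreal (f j x) * indicator ?I x) \<longlonglongrightarrow> ennreal (g x) * indicator ?I x"
          by (cases "x \<in> ?I") (auto intro: tendsto_ennrealI lim)
      qed
    qed measurable
    then show ?thesis unfolding fint by (simp add: LIMSEQ_const_iff)
  qed
  have Imem: "(1 - t) *\<^sub>R x + t *\<^sub>R y \<in> ?I" if "x \<in> ?I" "y \<in> ?I" "0 \<le> t" "t \<le> 1" for x y t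
    using convexD[OF convex_interior[OF convexP] that(1,2), of "1 - t" t] that by simp
  \<comment> \<open>The end points are left out as long as \<open>g\<close> might vanish: there
    \<open>0 powr 0 = 0\<close> would spoil the inequality. They are added once positivity is
    known.\<close>
  have glog: "g ((1 - t) *\<^sub>R x + t *\<^sub>R y) \<le> g x powr (1 - t) * g y powr t"
    if x: "x \<in> ?I" and y: "y \<in> ?I" and t: "0 < t" "t < 1" for x y t
  proof (rule LIMSEQ_le[OF lim])
    show "(1 - t) *\<^sub>R x + t *\<^sub>R y \<in> ?I" using x y t by (intro Imem) auto
    show "(\<lambda>j. f j x powr (1 - t) * f j y powr t) \<longlonglongrightarrow> g x powr (1 - t) * g y powr t"
      by (intro tendsto_intros lim x y) (use t f0 in auto)
    show "\<exists>N. \<forall>j\<ge>N. f j ((1 - t) *\<^sub>R x + t *\<^sub>R y) \<le> f j x powr (1 - t) * f j y powr t"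
      using M_log_cvx[OF s] x y t unfolding f_def log_cvx_def by auto
  qed
  \<comment> \<open>A zero at one interior point spreads: every interior \<open>y\<close> lies
    strictly between it and an interior point beyond \<open>y\<close>, so log-convexity gives
    \<open>g y = 0\<close>. This contradicts the total mass.\<close>
  have gpos: "g x > 0" if x: "x \<in> ?I" for x
  proof (rule ccontr)
    assume "\<not> g x > 0"
    then have gx: "g x = 0" using g0[OF x] by simp
    have "g y = 0" if y: "y \<in> ?I" for y
    proof -
      have "((\<lambda>d. y + d *\<^sub>R (y - x)) \<longlongrightarrow> y + 0 *\<^sub>R (y - x)) (at_right (0::real))" by (intro tendsto_intros)
      then have "eventually (\<lambda>d. y + d *\<^sub>R (y - x) \<in> ?I) (at_right (0::real))"
        by (rule topological_tendstoD) (use y in auto)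
      moreover have "eventually (\<lambda>d. d > 0) (at_right (0::real))" by (simp add: eventually_at_right_less)
      ultimately have "eventually (\<lambda>d. d > 0 \<and> y + d *\<^sub>R (y - x) \<in> ?I) (at_right (0::real))" by eventually_elim auto
      then obtain d where d: "d > 0" "y + d *\<^sub>R (y - x) \<in> ?I"
        using eventually_happens'[OF trivial_limit_at_right_real] by blast
      define t where "t = 1 / (1 + d)"
      have t: "0 < t" "t < 1" "t * (1 + d) = 1" using d by (auto simp: t_def)
      have "(1 - t) *\<^sub>R x + t *\<^sub>R (y + d *\<^sub>R (y - x)) = (1 - t * (1 + d)) *\<^sub>R x + (t * (1 + d)) *\<^sub>R y"
        by (simp add: algebra_simps)
      also have "\<dots> = y" using t by simp
      finally have eq: "(1 - t) *\<^sub>R x + t *\<^sub>R (y + d *\<^sub>R (y - x)) = y" .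
      have "g y \<le> g x powr (1 - t) * g (y + d *\<^sub>R (y - x)) powr t"
        using glog[OF x d(2) t(1,2)] unfolding eq .
      then show ?thesis using gx g0[OF y] by simp
    qed
    then have "(\<integral>\<^sup>+x. ennreal (g x) * indicator ?I x \<partial>lborel) = (\<integral>\<^sup>+x. 0 \<partial>(lborel::'a measure))"
      by (intro nn_integral_cong) (auto simp: indicator_def)
    then show False using gint measure_P_pos by simp
  qed
  have g: "log_cvx g"
    unfolding log_cvx_def
  proof (intro conjI ballI gpos)
    fix x y t assume x: "x \<in> ?I" and y: "y \<in> ?I" and t: "t \<in> {0..1::real}"
    consider "t = 0" | "t = 1" | "0 < t" "t < 1" using t by force
    then show "g ((1 - t) *\<^sub>R x + t *\<^sub>R y) \<le> g x powr (1 - t) * g y powr t"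
      using gpos[OF x] gpos[OF y] glog[OF x y] by cases auto
  qed
  have u: "ext g \<in> M" by (rule ext_in_M[OF g]) (use gint emeasure_P_eq in simp)
  have rfu: "rf (ext g) x = g x" if "x \<in> ?I" for x
    using log_cvx_ext_interior[OF g that] gpos[OF that] by (simp add: rf_def)
  show ?thesis
  proof (rule that[OF u])
    fix x assume x: "x \<in> P"
    show "ext g x \<le> liminf (\<lambda>j. s j x)"
      unfolding ext_def using x
    proof (simp, intro SUP_least)
      fix r assume r: "r \<in> {0<..<1::real}"
      have y: "z + r *\<^sub>R (x - z) \<in> ?I" by (rule radial_point) (use x r in auto)
      \<comment> \<open>Each radial expression involves only two interior values and so converges,
        even for \<open>x\<close> on the boundary; it stays below \<open>s j x\<close> by
        \<open>M_radial_le\<close>.\<close>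
      have "(\<lambda>j. radial (f j) r x) \<longlonglongrightarrow> radial g r x"
        unfolding radial_def by (intro tendsto_intros lim y z_interior)
           (use gpos[OF y] gpos[OF z_interior] r in auto)
      then have "(\<lambda>j. ennreal (radial (f j) r x)) \<longlonglongrightarrow> ennreal (radial g r x)" by (rule tendsto_ennrealI)
      then have "ennreal (radial g r x) = liminf (\<lambda>j. ennreal (radial (f j) r x))"
        by (simp add: lim_imp_Liminf)
      also have "\<dots> \<le> liminf (\<lambda>j. s j x)"
        by (intro Liminf_mono always_eventually allI) (use M_radial_le[OF s x] r in \<open>auto simp: f_def\<close>)
      finally show "ennreal (radial g r x) \<le> liminf (\<lambda>j. s j x)" .
    qed
  next
    have "En (ext g) = (\<integral>\<^sup>+x. liminf (\<lambda>j. ennreal (phi (f j x) + 1) * indicator ?I x) \<partial>lborel)"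
      unfolding En_def
    proof (rule nn_integral_cong)
      fix x
      show "ennreal (phi (rf (ext g) x) + 1) * indicator ?I x = liminf (\<lambda>j. ennreal (phi (f j x) + 1) * indicator ?I x)"
      proof (cases "x \<in> ?I")
        case True
        have "(\<lambda>j. phi (f j x) + 1) \<longlonglongrightarrow> phi (g x) + 1"
          unfolding phi_def by (intro tendsto_intros lim True) (use gpos[OF True] in auto)
        then have "(\<lambda>j. ennreal (phi (f j x) + 1)) \<longlonglongrightarrow> ennreal (phi (g x) + 1)" by (rule tendsto_ennrealI)
        then show ?thesis using True rfu[OF True] by (simp add: lim_imp_Liminf)
      qed (simp add: Liminf_const)
    qed
    also have "\<dots> \<le> liminf (\<lambda>j. \<integral>\<^sup>+x. ennreal (phi (f j x) + 1) * indicator ?I x \<partial>lborel)"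
      by (rule nn_integral_liminf) measurable
    finally show "En (ext g) \<le> liminf (\<lambda>j. En (s j))" by (simp add: En_def f_def)
  qed
qed

end

section \<open>The interior estimate\<close>

text \<open>The geometric sum is controlled by its last active level, which is below
  \<open>a\<close>. This is one half of a discrete layer-cake formula, to be applied to the boundary
  integral.\<close>

lemma dyadic_sum_le:
  fixes a K :: real
  assumes "K > 0" "a \<ge> 0"
  shows "(\<Sum>k<N. K * 2 ^ Suc k * of_bool (K * 2 ^ k < a)) \<le> 4 * a"
proof (induction N)
  case (Suc N)
  show ?case
  proof (cases "K * 2 ^ N < a")
    case True
    have "(\<Sum>k<Suc N. K * 2 ^ Suc k * of_bool (K * 2 ^ k < a)) \<le> (\<Sum>k<Suc N. K * 2 ^ Suc k)"
      using assms by (intro sum_mono) auto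
    also have "\<dots> = 2 * K * (\<Sum>k<Suc N. 2 ^ k)"
      by (subst sum_distrib_left) (simp only: power_Suc mult_ac)
    also have "(\<Sum>k<Suc N. 2 ^ k) = 2 ^ Suc N - (1::real)" by (induction N) auto
    also have "2 * K * (2 ^ Suc N - 1) \<le> 4 * (K * 2 ^ N)" using assms by (simp add: algebra_simps)
    also have "\<dots> \<le> 4 * a" using True by simp
    finally show ?thesis .
  qed (use Suc in simp)
qed (use assms in simp)

lemma dyadic_suminf_le:
  assumes "K > 0"
  shows "(\<Sum>k. ennreal (K * 2 ^ Suc k) * of_bool (ennreal (K * 2 ^ k) < v)) \<le> 4 * v"
proof (cases v)
  case (real a)
  have "(\<Sum>k<N. ennreal (K * 2 ^ Suc k) * of_bool (ennreal (K * 2 ^ k) < v)) \<le> 4 * v" for N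
  proof -
    have "(\<Sum>k<N. ennreal (K * 2 ^ Suc k) * of_bool (ennreal (K * 2 ^ k) < v))
        = (\<Sum>k<N. ennreal (K * 2 ^ Suc k * of_bool (K * 2 ^ k < a)))"
      using real assms by (intro sum.cong) (auto simp: ennreal_less_iff)
    also have "\<dots> = ennreal (\<Sum>k<N. K * 2 ^ Suc k * of_bool (K * 2 ^ k < a))"
      using assms by (intro sum_ennreal) auto
    also have "\<dots> \<le> ennreal (4 * a)" by (intro ennreal_leI dyadic_sum_le) (use assms real in auto)
    also have "\<dots> = 4 * v" using real by (simp add: ennreal_mult')
    finally show ?thesis .
  qed
  then show ?thesis unfolding suminf_eq_SUP by (intro SUP_least)
qed (simp add: ennreal_mult_top)

text \<open>The other half, for the volume integral. A single term suffices: that of the dyadic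
  interval from \<open>K * 2 ^ k\<close> to \<open>K * 2 ^ Suc k\<close> which contains
  \<open>a\<close>.\<close>

lemma powr_le_dyadic:
  fixes a K :: real
  assumes K: "K > 0" and p: "p \<ge> 0" and a: "a \<ge> 0"
  shows "ennreal (a powr p) \<le> ennreal (K powr p) + (\<Sum>k. ennreal ((K * 2 ^ Suc k) powr p) * of_bool (K * 2 ^ k < a))"
proof (cases "a \<le> K")
  case True
  then have "ennreal (a powr p) \<le> ennreal (K powr p)" using p a by (intro ennreal_leI powr_mono2) auto
  then show ?thesis by (rule order_trans) simp
next
  case False
  obtain N where "a / K < 2 ^ N" using real_arch_pow[of 2 "a / K"] by auto
  then have ex: "\<exists>N. a \<le> K * 2 ^ N" using K by (auto simp: field_simps intro!: exI[of _ N])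
  define m where "m = (LEAST N. a \<le> K * 2 ^ N)"
  have m: "a \<le> K * 2 ^ m" unfolding m_def by (rule LeastI_ex[OF ex])
  obtain k where k: "m = Suc k" using False m by (cases m) auto
  have "\<not> a \<le> K * 2 ^ k" using not_less_Least[of k "\<lambda>N. a \<le> K * 2 ^ N"] k by (simp add: m_def)
  then have "ennreal (a powr p) \<le> ennreal ((K * 2 ^ Suc k) powr p) * of_bool (K * 2 ^ k < a)"
    using m k p a by (auto intro!: ennreal_leI powr_mono2)
  also have "\<dots> \<le> (\<Sum>k. ennreal ((K * 2 ^ Suc k) powr p) * of_bool (K * 2 ^ k < a))"
  proof -
    have "h k \<le> (\<Sum>k. h k)" for h :: "nat \<Rightarrow> ennreal"
      using sum_le_suminf[of h "{k}"] by simp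
    then show ?thesis .
  qed
  finally show ?thesis by (rule order_trans) simp
qed

section \<open>Depth of superlevel sets\<close>

locale polytope_system = convex_body P z \<rho> for P :: "'a::euclidean_space set" and z \<rho> +
  fixes c :: real and \<sigma> :: "'a measure"
  assumes sys: "n_system P c \<sigma>" and dim2: "DIM('a) \<ge> 2"
begin

lemma polytopeP: "polytope P" using sys by (simp add: n_system_def simple_polytope_def)
lemma c_pos: "c > 0" using sys by (simp add: n_system_def)
lemma sets_sigma [measurable_cong]: "sets \<sigma> = sets borel" using sys by (simp add: n_system_def)

lemma frontier_subset_P: "frontier P \<subseteq> P"
  using compactP by (simp add: compact_imp_closed frontier_subset_closed)

lemma frontier_borel [measurable]: "frontier P \<in> sets borel"
  by (intro borel_closed frontier_closed)

definition Ub :: "('a \<Rightarrow> ennreal) \<Rightarrow> ennreal" where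
  "Ub u = (\<integral>\<^sup>+x. u x * indicator (frontier P) x \<partial>\<sigma>)"

definition bdry_super :: "('a \<Rightarrow> ennreal) \<Rightarrow> real \<Rightarrow> 'a set" where
  "bdry_super u t = {y \<in> frontier P. ennreal t < u y}"

lemma bdry_super_borel [measurable]: "u \<in> M \<Longrightarrow> bdry_super u t \<in> sets borel"
proof -
  assume "u \<in> M"
  then have [measurable]: "u \<in> borel_measurable borel" by measurable
  show ?thesis unfolding bdry_super_def by measurable
qed

lemma bdry_super_Markov:
  assumes u: "u \<in> M"
  shows "ennreal t * emeasure \<sigma> (bdry_super u t) \<le> Ub u"
proof -
  have [measurable]: "bdry_super u t \<in> sets borel" using u by measurable
  have "ennreal t * emeasure \<sigma> (bdry_super u t) = (\<integral>\<^sup>+x. ennreal t * indicator (bdry_super u t) x \<partial>\<sigma>)"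
    by (subst nn_integral_cmult_indicator) (auto simp: sets_sigma)
  also have "\<dots> \<le> Ub u"
    unfolding Ub_def by (intro nn_integral_mono) (auto simp: indicator_def bdry_super_def less_imp_le)
  finally show ?thesis .
qed

lemma bdry_super_finite: "emeasure \<sigma> (bdry_super u t) < \<infinity>"
proof -
  have "emeasure \<sigma> (bdry_super u t) \<le> emeasure \<sigma> (frontier P)"
    by (intro emeasure_mono) (auto simp: bdry_super_def sets_sigma)
  then show ?thesis using emeasure_frontier_finite[OF sys] by (rule le_less_trans)
qed

text \<open>Since \<open>u z \<le> K \<le> t\<close>, convexity on the segment from \<open>z\<close>
  to the exit point \<open>y\<close> would keep \<open>u\<close> at or below \<open>t\<close> if
  \<open>u y \<le> t\<close>. So the superlevel set lies in the cone over its boundary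
  trace.\<close>

lemma super_radial:
  assumes u: "u \<in> M" and t: "K \<le> t" and v: "v \<in> P" "ennreal t < u v"
  obtains y s where "y \<in> bdry_super u t" "0 < s" "s \<le> 1" "v = z + s *\<^sub>R (y - z)"
proof -
  have uz: "u z \<le> ennreal t" using M_center_le[OF u] t ennreal_leI order_trans by blast
  then have "v \<noteq> z" using v by auto
  then obtain y s where y: "y \<in> frontier P" "0 < s" "s \<le> 1" "v = z + s *\<^sub>R (y - z)"
    using radial_decomposition[OF polytopeP z_interior v(1)] by metis
  have yP: "y \<in> P" using y frontier_subset_P by blast
  have "ennreal t < u y"
  proof (rule ccontr)
    assume "\<not> ennreal t < u y"
    then have uy: "u y \<le> ennreal t" by simp
    show False
    proof (cases "s = 1")
      case True then show False using y uy v by simp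
    next
      case False
      have "u ((1 - s) *\<^sub>R z + s *\<^sub>R y) \<le> ennreal (1 - s) * u z + ennreal s * u y"
        by (rule M_convex) (use u z_in yP y False in auto)
      also have "(1 - s) *\<^sub>R z + s *\<^sub>R y = v" using y by (simp add: algebra_simps)
      also have "ennreal (1 - s) * u z + ennreal s * u y \<le> ennreal (1 - s) * ennreal t + ennreal s * ennreal t"
        by (intro add_mono mult_left_mono uz uy) auto
      also have "\<dots> = ennreal ((1 - s) * t + s * t)"
        using y K_pos t by (simp add: ennreal_mult')
      also have "(1 - s) * t + s * t = t" by (simp add: algebra_simps)
      finally show False using v(2) by simp
    qed
  qed
  then show ?thesis using that y by (simp add: bdry_super_def)
qed

definition shellC :: real where
  "shellC = (SOME C. C \<ge> 0 \<and> (\<forall>A\<in>sets borel. \<forall>e\<ge>0. A \<subseteq> frontier P \<longrightarrow> (\<exists>S\<in>sets borel.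
    {z + r *\<^sub>R (y - z) | y r. y \<in> A \<and> 1 - e \<le> r \<and> 0 < r \<and> r \<le> 1} \<subseteq> S \<and>
    emeasure lborel S \<le> ennreal (C * e) * emeasure \<sigma> A)))"

lemma shellC: "shellC \<ge> 0 \<and> (\<forall>A\<in>sets borel. \<forall>e\<ge>0. A \<subseteq> frontier P \<longrightarrow> (\<exists>S\<in>sets borel.
    {z + r *\<^sub>R (y - z) | y r. y \<in> A \<and> 1 - e \<le> r \<and> 0 < r \<and> r \<le> 1} \<subseteq> S \<and>
    emeasure lborel S \<le> ennreal (shellC * e) * emeasure \<sigma> A))"
  unfolding shellC_def by (rule someI_ex[OF n_system_shell[OF sys z_interior]])

lemma shellC_nonneg: "shellC \<ge> 0" using shellC by blast

lemma shell_volume: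
  assumes A: "A \<in> sets borel" "A \<subseteq> frontier P" and e: "e \<ge> 0" and D: "D \<in> sets borel"
    "\<And>v. v \<in> D \<Longrightarrow> \<exists>y r. v = z + r *\<^sub>R (y - z) \<and> y \<in> A \<and> 1 - e \<le> r \<and> 0 < r \<and> r \<le> 1"
  shows "emeasure lborel D \<le> ennreal (shellC * e) * emeasure \<sigma> A"
proof -
  obtain S where S: "S \<in> sets borel"
    "{z + r *\<^sub>R (y - z) | y r. y \<in> A \<and> 1 - e \<le> r \<and> 0 < r \<and> r \<le> 1} \<subseteq> S"
    "emeasure lborel S \<le> ennreal (shellC * e) * emeasure \<sigma> A"
    using shellC A e by blast
  have "D \<subseteq> S" using D(2) S(2) by blast
  then have "emeasure lborel D \<le> emeasure lborel S" using S by (intro emeasure_mono) auto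
  then show ?thesis using S(3) by (rule order_trans)
qed

text \<open>If \<open>u > t\<close> at a point of relative depth \<open>1 - r\<close>, then by convexity \<open>u > t\<close> on at least half of
  a ball of radius proportional to \<open>1 - r\<close>; radially projected, this half ball fills an
  \<open>(n - 1)\<close>-dimensional proportion of the boundary.\<close>

lemma depth_estimate:
  assumes u: "u \<in> M" and t: "K \<le> t" and y: "y \<in> frontier P" and r: "0 < r" "r < 1"
    and x: "ennreal t < u (z + r *\<^sub>R (y - z))"
  shows "(1 - r) ^ (DIM('a) - 1) \<le> 4 * shellC / (\<rho> ^ DIM('a) * measure lborel (ball (0::'a) 1)) * measure \<sigma> (bdry_super u t)"
proof -
  define x where "x = z + r *\<^sub>R (y - z)"
  define d where "d = 1 - r"
  define b where "b = ball x (d * \<rho>)"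
  define \<omega> where "\<omega> = measure lborel (ball (0::'a) 1)"
  have \<omega>: "\<omega> > 0" unfolding \<omega>_def by (rule measure_ball_pos) simp
  have d: "0 < d" "d < 1" using r by (auto simp: d_def)
  have [measurable]: "u \<in> borel_measurable borel" using u by measurable
  have yP: "y \<in> P" using y frontier_subset_P by blast
  \<comment> \<open>The ball \<open>b\<close> consists of the convex combinations of
    \<open>y\<close> with weight \<open>r\<close> and points of \<open>ball z \<rho>\<close> with
    weight \<open>d\<close>.\<close>
  have bP: "b \<subseteq> P"
  proof
    fix v assume "v \<in> b"
    then have nv: "norm (v - x) < d * \<rho>" by (simp add: b_def dist_norm norm_minus_commute)
    define w where "w = (1 / d) *\<^sub>R (v - x)"
    have "norm w < \<rho>" using nv d by (simp add: w_def pos_divide_less_eq mult.commute)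
    then have "z + w \<in> P" using ballP by (auto simp: dist_norm)
    then have "r *\<^sub>R y + d *\<^sub>R (z + w) \<in> P"
      using convexD[OF convexP yP, of "z + w" r d] r d by (auto simp: d_def)
    moreover have "r *\<^sub>R y + d *\<^sub>R (z + w) = v"
    proof -
      have dw: "d *\<^sub>R w = v - x" using d by (simp add: w_def)
      show ?thesis unfolding scaleR_add_right dw by (simp add: x_def d_def algebra_simps)
    qed
    ultimately show "v \<in> P" by simp
  qed
  define D where "D = {v \<in> b. ennreal t < u v}"
  have [measurable]: "b \<in> sets borel" by (simp add: b_def)
  have [measurable]: "D \<in> sets borel" unfolding D_def by measurable
  have vol_b: "emeasure lborel b = ennreal ((d * \<rho>) ^ DIM('a) * \<omega>)"
  proof -
    have "emeasure lborel b = ennreal (\<bar>d * \<rho>\<bar> ^ DIM('a)) * emeasure lborel {w. x + (d * \<rho>) *\<^sub>R w \<in> b}"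
      by (rule emeasure_lborel_affine) (use d rho in auto)
    also have "{w. x + (d * \<rho>) *\<^sub>R w \<in> b} = ball 0 1"
      using d rho by (auto simp: b_def dist_norm)
    also have "emeasure lborel (ball (0::'a) 1) = ennreal \<omega>"
      unfolding \<omega>_def using emeasure_lborel_ball_finite[of "0::'a" 1] by (intro emeasure_eq_ennreal_measure) auto
    finally show ?thesis using d rho \<omega> by (simp add: ennreal_mult')
  qed
  \<comment> \<open>The reflection of \<open>D\<close> in \<open>x\<close>. Midpoint convexity
    forbids \<open>u \<le> t\<close> at both of two opposite points, so \<open>D\<close> and
    \<open>D'\<close> cover \<open>b\<close>.\<close>
  define D' where "D' = {v. 2 *\<^sub>R x - v \<in> D}"
  have [measurable]: "D' \<in> sets borel" unfolding D'_def by measurable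
  have D': "emeasure lborel D' = emeasure lborel D"
    using emeasure_lborel_affine[of D "-1" "2 *\<^sub>R x"] by (simp add: D'_def)
  have "b \<subseteq> D \<union> D'"
  proof
    fix v assume v: "v \<in> b"
    have v': "2 *\<^sub>R x - v \<in> b" using v
      by (simp add: b_def dist_norm norm_minus_commute scaleR_2 algebra_simps)
    show "v \<in> D \<union> D'"
    proof (rule ccontr)
      assume "v \<notin> D \<union> D'"
      then have le: "u v \<le> ennreal t" "u (2 *\<^sub>R x - v) \<le> ennreal t" using v v' by (auto simp: D_def D'_def)
      have "2 * u x \<le> u (x + (v - x)) + u (x - (v - x))"
        by (rule M_midpoint[OF u]) (use v v' bP in \<open>auto simp: scaleR_2 algebra_simps\<close>)
      also have "x - (v - x) = 2 *\<^sub>R x - v" by (simp add: scaleR_2)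
      also have "u (x + (v - x)) + u (2 *\<^sub>R x - v) \<le> ennreal t + ennreal t" using le by (intro add_mono) auto
      also have "\<dots> = 2 * ennreal t" by (simp add: mult_2)
      finally have "u x \<le> ennreal t"
        by (simp add: ennreal_mult_le_mult_iff)
      then show False using assms(6) by (simp add: x_def)
    qed
  qed
  then have "emeasure lborel b \<le> emeasure lborel (D \<union> D')" by (intro emeasure_mono) auto
  also have "\<dots> \<le> emeasure lborel D + emeasure lborel D'" by (intro emeasure_subadditive) auto
  finally have half: "emeasure lborel b \<le> 2 * emeasure lborel D"
    unfolding D' by (simp add: mult_2)
  obtain F where F: "F facet_of P" "y \<in> F" using y n_system_frontier(1)[OF sys] by blast
  \<comment> \<open>The centre has radial parameter \<open>1 - d\<close>, and the radius
    \<open>d * \<rho>\<close> lets it drop by at most another \<open>d\<close>; hence the thickness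
    \<open>2 * d\<close>.\<close>
  have "emeasure lborel D \<le> ennreal (shellC * (2 * d)) * emeasure \<sigma> (bdry_super u t)"
  proof (rule shell_volume)
    show "bdry_super u t \<in> sets borel" using u by measurable
    show "bdry_super u t \<subseteq> frontier P" by (auto simp: bdry_super_def)
    fix v assume v: "v \<in> D"
    then have vP: "v \<in> P" "ennreal t < u v" using bP by (auto simp: D_def)
    obtain y' s where y': "y' \<in> bdry_super u t" "0 < s" "s \<le> 1" "v = z + s *\<^sub>R (y' - z)"
      using super_radial[OF u t vP] .
    have "r - d \<le> s"
    proof (rule radial_parameter_near[OF polytopeP F rho ballP])
      show "y' \<in> P" using y' frontier_subset_P by (auto simp: bdry_super_def)
      show "z + s *\<^sub>R (y' - z) \<in> ball (z + r *\<^sub>R (y - z)) (d * \<rho>)"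
        using v y' by (simp add: D_def b_def x_def)
    qed (use y' d in auto)
    then show "\<exists>y r. v = z + r *\<^sub>R (y - z) \<and> y \<in> bdry_super u t \<and> 1 - 2 * d \<le> r \<and> 0 < r \<and> r \<le> 1"
      using y' by (intro exI[of _ y'] exI[of _ s]) (simp add: d_def)
  qed (use d in auto)
  also have "emeasure \<sigma> (bdry_super u t) = ennreal (measure \<sigma> (bdry_super u t))"
    using bdry_super_finite[of u t] by (intro emeasure_eq_ennreal_measure) auto
  finally have "emeasure lborel D \<le> ennreal (shellC * (2 * d) * measure \<sigma> (bdry_super u t))"
    using shellC_nonneg d by (simp add: ennreal_mult')
  then have "2 * emeasure lborel D \<le> ennreal 2 * ennreal (shellC * (2 * d) * measure \<sigma> (bdry_super u t))"
    by (simp add: mult_left_mono)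
  also have "\<dots> = ennreal (2 * (shellC * (2 * d) * measure \<sigma> (bdry_super u t)))"
    by (rule ennreal_mult'[symmetric]) simp
  finally have "2 * emeasure lborel D \<le> ennreal (2 * (shellC * (2 * d) * measure \<sigma> (bdry_super u t)))" .
  from order_trans[OF half[unfolded vol_b] this]
  have "(d * \<rho>) ^ DIM('a) * \<omega> \<le> 2 * (shellC * (2 * d) * measure \<sigma> (bdry_super u t))"
    by (subst (asm) ennreal_le_iff) (use shellC_nonneg d in simp_all)
  \<comment> \<open>The 4 combines the half ball with the thickness \<open>2 * d\<close>. Cancelling
    one \<open>d\<close> from the volume of order \<open>d^n\<close> leaves the power
    \<open>n - 1\<close>.\<close>
  also have "\<dots> = d * (4 * shellC * measure \<sigma> (bdry_super u t))" by simp
  also have "(d * \<rho>) ^ DIM('a) * \<omega> = d * (d ^ (DIM('a) - 1) * (\<rho> ^ DIM('a) * \<omega>))"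
  proof -
    have "d ^ DIM('a) = d * d ^ (DIM('a) - 1)"
      using power_Suc[of d "DIM('a) - 1"] by (simp only: Suc_diff_1[OF DIM_positive])
    then show ?thesis by (simp only: power_mult_distrib mult.assoc)
  qed
  finally have "d ^ (DIM('a) - 1) * (\<rho> ^ DIM('a) * \<omega>) \<le> 4 * shellC * measure \<sigma> (bdry_super u t)"
    using d by (simp only: mult_le_cancel_left_pos)
  then show ?thesis using rho \<omega> by (simp add: pos_le_divide_eq flip: d_def \<omega>_def)
qed

section \<open>The integrability exponent and the entropy bound\<close>

definition q :: real where "q = 1 / (real DIM('a) - 1)"

lemma q_pos: "q > 0" using dim2 by (simp add: q_def)

text \<open>The summand 1 makes the constant positive, as \<open>shellC\<close> is only known to be
  nonnegative.\<close>

definition depthC :: real where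
  "depthC = 4 * shellC / (\<rho> ^ DIM('a) * measure lborel (ball (0::'a) 1)) + 1"

lemma depthC_pos: "depthC > 0"
  using shellC_nonneg rho by (auto simp: depthC_def intro!: add_nonneg_pos)

text \<open>Markov's inequality is spent on the depth only. The other factor
  \<open>emeasure \<sigma> (bdry_super u t)\<close> is kept, so that the sum over levels can return
  the energy.\<close>

lemma superlevel_volume:
  assumes u: "u \<in> M" and t: "K \<le> t" and B: "B > 0" and U: "Ub u \<le> ennreal B"
  shows "emeasure lborel {x \<in> P. ennreal t < u x} \<le>
    ennreal (shellC * (depthC * B / t) powr q) * emeasure \<sigma> (bdry_super u t)"
proof -
  have [measurable]: "u \<in> borel_measurable borel" using u by measurable
  have t0: "t > 0" using K_pos t by simp
  have ms: "measure \<sigma> (bdry_super u t) \<le> B / t"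
  proof -
    have "ennreal t * ennreal (measure \<sigma> (bdry_super u t)) \<le> ennreal B"
      using order_trans[OF bdry_super_Markov[OF u] U, of t] bdry_super_finite[of u t]
      by (simp add: emeasure_eq_ennreal_measure)
    then have "t * measure \<sigma> (bdry_super u t) \<le> B"
      using t0 B by (simp add: ennreal_mult'[symmetric])
    then show ?thesis using t0 by (simp add: pos_le_divide_eq mult.commute)
  qed
  show ?thesis
  proof (rule shell_volume)
    show "bdry_super u t \<in> sets borel" using u by measurable
    show "bdry_super u t \<subseteq> frontier P" by (auto simp: bdry_super_def)
    fix v assume "v \<in> {x \<in> P. ennreal t < u x}"
    then have v: "v \<in> P" "ennreal t < u v" by auto
    obtain y r where y: "y \<in> bdry_super u t" "0 < r" "r \<le> 1" "v = z + r *\<^sub>R (y - z)"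
      using super_radial[OF u t v] .
    have "1 - r \<le> (depthC * B / t) powr q"
    proof (cases "r = 1")
      case False
      then have r: "r < 1" using y by simp
      have "(1 - r) ^ (DIM('a) - 1) \<le> 4 * shellC / (\<rho> ^ DIM('a) * measure lborel (ball (0::'a) 1)) * measure \<sigma> (bdry_super u t)"
        by (rule depth_estimate[OF u t _ y(2) r]) (use y v in \<open>auto simp: bdry_super_def\<close>)
      also have "\<dots> \<le> depthC * (B / t)"
        by (intro mult_mono ms) (use depthC_pos in \<open>auto simp: depthC_def\<close>)
      finally have le: "(1 - r) powr (real DIM('a) - 1) \<le> depthC * B / t"
        using r dim2 by (simp add: powr_realpow[symmetric] of_nat_diff)
      have "1 - r = ((1 - r) powr (real DIM('a) - 1)) powr q"
        using r dim2 by (simp add: powr_powr q_def)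
      also have "\<dots> \<le> (depthC * B / t) powr q"
        using le q_pos by (intro powr_mono2) auto
      finally show ?thesis .
    qed simp
    then show "\<exists>y ra. v = z + ra *\<^sub>R (y - z) \<and> y \<in> bdry_super u t \<and> 1 - (depthC * B / t) powr q \<le> ra \<and> 0 < ra \<and> ra \<le> 1"
      using y by (intro exI[of _ y] exI[of _ r]) simp
  qed auto
qed

lemma Lp_bound:
  assumes B: "B > 0"
  shows "\<exists>R::real. \<forall>u\<in>M. Ub u \<le> ennreal B \<longrightarrow> (\<integral>\<^sup>+x. epowr (u x) (1 + q) * indicator P x \<partial>lborel) \<le> ennreal R"
proof -
  define p where "p = 1 + q"
  \<comment> \<open>The 2 is the ratio of consecutive dyadic levels: volume is estimated at
    \<open>L k\<close>, the integrand at \<open>L (Suc k)\<close>.\<close>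
  define E where "E = (2 * depthC * B) powr q"
  define R where "R = K powr p * measure lborel P + shellC * E * (4 * B)"
  have p: "p > 0" using q_pos by (simp add: p_def)
  have "(\<integral>\<^sup>+x. epowr (u x) p * indicator P x \<partial>lborel) \<le> ennreal R" if u: "u \<in> M" and U: "Ub u \<le> ennreal B" for u
  proof -
    have [measurable]: "u \<in> borel_measurable borel" using u by measurable
    define L where "L k = K * 2 ^ k" for k :: nat
    have L0: "L k > 0" for k using K_pos by (simp add: L_def)
    have [measurable]: "bdry_super u t \<in> sets borel" for t using u by measurable
    define W where "W k = {x \<in> P. ennreal (L k) < u x}" for k
    have [measurable]: "W k \<in> sets borel" for k unfolding W_def by measurable
    have "(\<integral>\<^sup>+x. epowr (u x) p * indicator P x \<partial>lborel) \<le>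
      (\<integral>\<^sup>+x. ennreal (K powr p) * indicator P x + (\<Sum>k. ennreal (L (Suc k) powr p) * indicator (W k) x) \<partial>lborel)"
    proof (rule nn_integral_mono_AE, rule AE_mp[OF AE_interior], rule AE_I2, rule impI)
      fix x assume x: "x \<in> P \<longrightarrow> x \<in> interior P"
      show "epowr (u x) p * indicator P x \<le> ennreal (K powr p) * indicator P x + (\<Sum>k. ennreal (L (Suc k) powr p) * indicator (W k) x)"
      proof (cases "x \<in> P")
        case True
        then have xi: "x \<in> interior P" using x by blast
        note a = M_rf[OF u xi]
        have "epowr (u x) p = ennreal (rf u x powr p)" using a by (metis epowr_ennreal less_imp_le)
        also have "\<dots> \<le> ennreal (K powr p) + (\<Sum>k. ennreal ((K * 2 ^ Suc k) powr p) * of_bool (K * 2 ^ k < rf u x))"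
          by (rule powr_le_dyadic) (use K_pos p a in auto)
        also have "(\<Sum>k. ennreal ((K * 2 ^ Suc k) powr p) * of_bool (K * 2 ^ k < rf u x)) = (\<Sum>k. ennreal (L (Suc k) powr p) * indicator (W k) x)"
        proof (intro suminf_cong)
          fix k
          have "(ennreal (L k) < u x) = (L k < rf u x)"
            using a(1) L0[of k] by (metis ennreal_less_iff less_imp_le)
          then show "ennreal ((K * 2 ^ Suc k) powr p) * of_bool (K * 2 ^ k < rf u x) = ennreal (L (Suc k) powr p) * indicator (W k) x"
            using True by (simp add: W_def L_def indicator_def)
        qed
        finally show ?thesis using True by simp
      qed simp
    qed
    also have "\<dots> = ennreal (K powr p) * emeasure lborel P + (\<Sum>k. ennreal (L (Suc k) powr p) * emeasure lborel (W k))"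
      by (subst nn_integral_add, measurable, subst nn_integral_suminf, measurable) (simp add: nn_integral_cmult_indicator)
    also have "(\<Sum>k. ennreal (L (Suc k) powr p) * emeasure lborel (W k)) \<le>
       (\<Sum>k. ennreal (shellC * E) * (ennreal (L (Suc k)) * emeasure \<sigma> (bdry_super u (L k))))"
    proof (intro suminf_le allI)
      fix k
      have KL: "K \<le> L k" using K_pos by (simp add: L_def)
      \<comment> \<open>The power \<open>q\<close> of the level gained in the integrand cancels
        against the thickness of the shell, and a weight linear in the level remains.\<close>
      have eq: "L (Suc k) powr p * (shellC * (depthC * B / L k) powr q) = (shellC * E) * L (Suc k)"
      proof -
        have "L (Suc k) powr p = L (Suc k) * L (Suc k) powr q" using L0[of "Suc k"] by (simp add: p_def powr_add)
        moreover have "L (Suc k) powr q * (depthC * B / L k) powr q = E"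
        proof -
          have "L (Suc k) powr q * (depthC * B / L k) powr q = (L (Suc k) * (depthC * B / L k)) powr q"
            using L0[of k] L0[of "Suc k"] depthC_pos B by (intro powr_mult[symmetric])
          also have "L (Suc k) * (depthC * B / L k) = 2 * depthC * B" using L0[of k] K_pos by (simp add: L_def)
          finally show ?thesis by (simp add: E_def)
        qed
        ultimately show ?thesis by (metis mult.assoc mult.commute mult.left_commute)
      qed
      have "ennreal (L (Suc k) powr p) * emeasure lborel (W k) \<le>
        ennreal (L (Suc k) powr p) * (ennreal (shellC * (depthC * B / L k) powr q) * emeasure \<sigma> (bdry_super u (L k)))"
        unfolding W_def by (intro mult_left_mono superlevel_volume[OF u KL B U]) simp
      also have "\<dots> = ennreal ((shellC * E) * L (Suc k)) * emeasure \<sigma> (bdry_super u (L k))"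
        using shellC_nonneg by (simp add: mult.assoc[symmetric] flip: eq ennreal_mult')
      also have "\<dots> = ennreal (shellC * E) * (ennreal (L (Suc k)) * emeasure \<sigma> (bdry_super u (L k)))"
        using shellC_nonneg L0[of "Suc k"] by (simp add: ennreal_mult' E_def mult.assoc)
      finally show "ennreal (L (Suc k) powr p) * emeasure lborel (W k) \<le> ennreal (shellC * E) * (ennreal (L (Suc k)) * emeasure \<sigma> (bdry_super u (L k)))" .
    qed auto
    also have "(\<Sum>k. ennreal (shellC * E) * (ennreal (L (Suc k)) * emeasure \<sigma> (bdry_super u (L k)))) =
       ennreal (shellC * E) * (\<Sum>k. ennreal (L (Suc k)) * emeasure \<sigma> (bdry_super u (L k)))"
      by (rule ennreal_suminf_cmult)
    also have "(\<Sum>k. ennreal (L (Suc k)) * emeasure \<sigma> (bdry_super u (L k))) =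
       (\<integral>\<^sup>+y. (\<Sum>k. ennreal (L (Suc k)) * indicator (bdry_super u (L k)) y) \<partial>\<sigma>)"
      by (subst nn_integral_suminf) (auto simp: nn_integral_cmult_indicator sets_sigma)
    also have "\<dots> \<le> (\<integral>\<^sup>+y. 4 * (u y * indicator (frontier P) y) \<partial>\<sigma>)"
    proof (rule nn_integral_mono)
      fix y
      show "(\<Sum>k. ennreal (L (Suc k)) * indicator (bdry_super u (L k)) y) \<le> 4 * (u y * indicator (frontier P) y)"
      proof (cases "y \<in> frontier P")
        case True
        have "(\<Sum>k. ennreal (L (Suc k)) * indicator (bdry_super u (L k)) y) = (\<Sum>k. ennreal (K * 2 ^ Suc k) * of_bool (ennreal (K * 2 ^ k) < u y))"
          using True by (intro suminf_cong) (simp add: L_def bdry_super_def indicator_def)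
        also have "\<dots> \<le> 4 * u y" by (rule dyadic_suminf_le[OF K_pos])
        finally show ?thesis using True by simp
      qed (simp add: bdry_super_def)
    qed
    also have "\<dots> = 4 * Ub u"
      unfolding Ub_def by (rule nn_integral_cmult) measurable
    also have "\<dots> \<le> 4 * ennreal B" using U by (rule mult_left_mono) simp
    finally have "(\<integral>\<^sup>+x. epowr (u x) p * indicator P x \<partial>lborel) \<le> ennreal (K powr p) * emeasure lborel P + ennreal (shellC * E) * (4 * ennreal B)"
      by (simp add: add_left_mono mult_left_mono)
    also have "\<dots> = ennreal R"
    proof -
      have "4 * ennreal B = ennreal (4 * B)" using B by (simp add: ennreal_mult')
      moreover have "shellC * E \<ge> 0" using shellC_nonneg by (simp add: E_def)
      ultimately show ?thesis unfolding R_def emeasure_P_eq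
        using B by (subst ennreal_plus) (auto simp: ennreal_mult')
    qed
    finally show ?thesis .
  qed
  then show ?thesis by (intro exI[of _ R]) (simp add: p_def)
qed

text \<open>The bound \<open>q ln a \<le> a powr q\<close> makes \<open>phi a\<close> at most a
  multiple of \<open>a powr (1 + q)\<close>. The constant depends on the energy level alone.\<close>

lemma En_bound:
  assumes B: "B > 0"
  shows "\<exists>R::real. \<forall>u\<in>M. Ub u \<le> ennreal B \<longrightarrow> En u \<le> ennreal R"
proof -
  obtain R where R: "\<And>u. u \<in> M \<Longrightarrow> Ub u \<le> ennreal B \<Longrightarrow> (\<integral>\<^sup>+x. epowr (u x) (1 + q) * indicator P x \<partial>lborel) \<le> ennreal R"
    using Lp_bound[OF B] by blast
  define m where "m = 1 / q"
  have m: "m > 0" using q_pos by (simp add: m_def)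
  have "En u \<le> ennreal (m * \<bar>R\<bar> + measure lborel P)" if u: "u \<in> M" and U: "Ub u \<le> ennreal B" for u
  proof -
    have [measurable]: "u \<in> borel_measurable borel" using u by measurable
    have [measurable]: "(\<lambda>x. epowr (u x) (1 + q)) \<in> borel_measurable borel"
      unfolding epowr_def by measurable
    have "En u \<le> (\<integral>\<^sup>+x. ennreal m * (epowr (u x) (1 + q) * indicator P x) + indicator P x \<partial>lborel)"
      unfolding En_def
    proof (rule nn_integral_mono)
      fix x
      show "ennreal (phi (rf u x) + 1) * indicator (interior P) x \<le> ennreal m * (epowr (u x) (1 + q) * indicator P x) + indicator P x"
      proof (cases "x \<in> interior P")
        case True
        note a = M_rf[OF u True]
        let ?a = "rf u x"
        have "q * ln ?a = ln (?a powr q)" using a by (simp add: ln_powr)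
        also have "\<dots> \<le> ?a powr q - 1" using a by (intro ln_le_minus_one) simp
        finally have "q * ln ?a \<le> ?a powr q" by simp
        then have "ln ?a \<le> m * ?a powr q" using q_pos by (simp add: m_def pos_le_divide_eq mult.commute)
        then have "phi ?a \<le> ?a * (m * ?a powr q)" unfolding phi_def using a by (intro mult_left_mono) auto
        also have "\<dots> = m * ?a powr (1 + q)" using a by (simp add: powr_add)
        finally have "ennreal (phi ?a + 1) \<le> ennreal (m * ?a powr (1 + q) + 1)" by (intro ennreal_leI) simp
        also have "\<dots> = ennreal m * ennreal (?a powr (1 + q)) + 1" using m by (simp add: ennreal_mult')
        also have "ennreal (?a powr (1 + q)) = epowr (u x) (1 + q)" using a by (metis epowr_ennreal less_imp_le)
        finally show ?thesis using True interior_subset[of P] by auto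
      qed simp
    qed
    also have "\<dots> = ennreal m * (\<integral>\<^sup>+x. epowr (u x) (1 + q) * indicator P x \<partial>lborel) + emeasure lborel P"
      by (subst nn_integral_add, measurable, subst nn_integral_cmult) auto
    also have "\<dots> \<le> ennreal m * ennreal \<bar>R\<bar> + ennreal (measure lborel P)"
      unfolding emeasure_P_eq using order_trans[OF R[OF u U], of "ennreal \<bar>R\<bar>"]
      by (intro add_mono mult_left_mono) (auto intro: ennreal_leI)
    also have "\<dots> = ennreal (m * \<bar>R\<bar> + measure lborel P)" using m by (simp add: ennreal_mult')
    finally show ?thesis .
  qed
  then show ?thesis by blast
qed

end

section \<open>Minimisation\<close>

context polytope_system
begin

text \<open>Outside \<open>X\<close> the internal and the free energy are infinite, while on
  \<open>X\<close> the entropy term is finite by \<open>En_bound\<close>. The minimisation can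
  therefore be carried out with real numbers.\<close>

definition X :: "('a \<Rightarrow> ennreal) set" where "X = {u\<in>M. Ub u < \<infinity>}"
definition U :: "('a \<Rightarrow> ennreal) \<Rightarrow> real" where "U u = enn2real (Ub u)"
definition E :: "('a \<Rightarrow> ennreal) \<Rightarrow> real" where "E u = enn2real (En u)"
definition H :: "('a \<Rightarrow> ennreal) \<Rightarrow> ('a \<Rightarrow> ennreal) \<Rightarrow> real" where "H u v = enn2real (Hd u v)"

lemma U_nonneg: "0 \<le> U u" by (simp add: U_def)
lemma E_nonneg: "0 \<le> E u" by (simp add: E_def)

lemma X_M: "u \<in> X \<Longrightarrow> u \<in> M" by (simp add: X_def)

lemma Ub_eq: "u \<in> X \<Longrightarrow> Ub u = ennreal (U u)" by (simp add: X_def U_def)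

lemma X_I: "u \<in> M \<Longrightarrow> Ub u \<le> ennreal B \<Longrightarrow> u \<in> X"
  by (auto simp: X_def intro: le_less_trans)

lemma En_finite: "u \<in> X \<Longrightarrow> En u < \<infinity>"
proof -
  assume u: "u \<in> X"
  have B: "U u + 1 > 0" using U_nonneg[of u] by simp
  have "Ub u \<le> ennreal (U u + 1)" unfolding Ub_eq[OF u] by (intro ennreal_leI) simp
  moreover obtain R where "\<forall>u\<in>M. Ub u \<le> ennreal (U u0 + 1) \<longrightarrow> En u \<le> ennreal R" if "u0 = u" for u0
    using En_bound[OF B] by blast
  ultimately have "En u \<le> ennreal R" using X_M[OF u] by blast
  then show ?thesis by (rule le_less_trans) simp
qed

lemma En_eq: "u \<in> X \<Longrightarrow> En u = ennreal (E u)"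
  using En_finite by (simp add: E_def)

lemma E_bounded: "\<exists>R. \<forall>u\<in>X. U u \<le> B \<longrightarrow> E u \<le> R"
proof -
  define B' where "B' = \<bar>B\<bar> + 1"
  have "B' > 0" by (simp add: B'_def)
  then obtain R where R: "\<forall>u\<in>M. Ub u \<le> ennreal B' \<longrightarrow> En u \<le> ennreal R" using En_bound by blast
  have "E u \<le> \<bar>R\<bar>" if u: "u \<in> X" "U u \<le> B" for u
  proof -
    have "Ub u \<le> ennreal B'" unfolding Ub_eq[OF u(1)] by (intro ennreal_leI) (use u in \<open>simp add: B'_def\<close>)
    then have "En u \<le> ennreal \<bar>R\<bar>" using R X_M[OF u(1)] by (meson abs_ge_self ennreal_leI order_trans)
    then show ?thesis unfolding En_eq[OF u(1)] by (subst (asm) ennreal_le_iff) auto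
  qed
  then show ?thesis by blast
qed

lemma Ub_mid: "u \<in> M \<Longrightarrow> v \<in> M \<Longrightarrow> Ub (mid u v) = ennreal (1/2) * Ub u + ennreal (1/2) * Ub v"
proof -
  assume "u \<in> M" "v \<in> M"
  then have [measurable]: "u \<in> borel_measurable borel" "v \<in> borel_measurable borel" by measurable
  have "Ub (mid u v) = (\<integral>\<^sup>+x. ennreal (1/2) * (u x * indicator (frontier P) x) + ennreal (1/2) * (v x * indicator (frontier P) x) \<partial>\<sigma>)"
    unfolding Ub_def mid_def by (intro nn_integral_cong) (simp only: distrib_right mult.assoc)
  also have "\<dots> = ennreal (1/2) * Ub u + ennreal (1/2) * Ub v"
    unfolding Ub_def by (subst nn_integral_add, measurable, (subst nn_integral_cmult, measurable)+)
  finally show ?thesis .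
qed

lemma Hd_H: "u \<in> X \<Longrightarrow> v \<in> X \<Longrightarrow> Hd u v = ennreal (H u v)"
proof -
  assume u: "u \<in> X" and v: "v \<in> X"
  have le: "2 * (En (mid u v) + Hd u v) \<le> En u + En v" by (rule En_mid[OF X_M[OF u] X_M[OF v]])
  have "En u + En v < \<infinity>" using En_finite[OF u] En_finite[OF v] by simp
  then have "2 * (En (mid u v) + Hd u v) < \<infinity>" using le by (rule le_less_trans[rotated])
  then have "Hd u v < \<infinity>" by (auto simp: ennreal_mult_less_top)
  then show ?thesis by (simp add: H_def)
qed

lemma mid_X:
  assumes u: "u \<in> X" and v: "v \<in> X"
  shows "mid u v \<in> X" "U (mid u v) = (U u + U v) / 2" "E (mid u v) + H u v \<le> (E u + E v) / 2"
proof -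
  have k: "ennreal k * ennreal a + ennreal k * ennreal b = ennreal (k * a + k * b)" if "k > 0" "a \<ge> 0" "b \<ge> 0" for k a b
    using that by (simp add: ennreal_mult'' ennreal_plus)
  have "Ub (mid u v) = ennreal ((1/2) * U u + (1/2) * U v)"
    unfolding Ub_mid[OF X_M[OF u] X_M[OF v]] Ub_eq[OF u] Ub_eq[OF v] by (rule k) (auto simp: U_nonneg)
  also have "(1/2) * U u + (1/2) * U v = (U u + U v) / 2" by simp
  finally have eq: "Ub (mid u v) = ennreal ((U u + U v) / 2)" .
  show X: "mid u v \<in> X" by (rule X_I[OF mid_in_M[OF X_M[OF u] X_M[OF v]] eq_refl[OF eq]])
  show "U (mid u v) = (U u + U v) / 2" using eq U_nonneg[of u] U_nonneg[of v] by (simp only: U_def[of "mid u v"]) simp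
  have le: "2 * (En (mid u v) + Hd u v) \<le> En u + En v" by (rule En_mid[OF X_M[OF u] X_M[OF v]])
  have "2 * (ennreal (E (mid u v)) + ennreal (H u v)) = ennreal 2 * ennreal (E (mid u v) + H u v)"
    using E_nonneg by (simp add: H_def)
  also have "\<dots> = ennreal (2 * (E (mid u v) + H u v))" by (rule ennreal_mult'[symmetric]) simp
  finally have "ennreal (2 * (E (mid u v) + H u v)) \<le> ennreal (E u + E v)"
    using le unfolding Hd_H[OF u v] En_eq[OF u] En_eq[OF v] En_eq[OF X] using E_nonneg by (metis ennreal_plus)
  then have "2 * (E (mid u v) + H u v) \<le> E u + E v"
    by (subst (asm) ennreal_le_iff) (auto simp: E_nonneg)
  then show "E (mid u v) + H u v \<le> (E u + E v) / 2" by simp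
qed

lemma H_le_0: "u \<in> X \<Longrightarrow> v \<in> X \<Longrightarrow> H u v \<le> 0 \<Longrightarrow> u = v"
  using Hd_eq_0[OF X_M X_M] Hd_H by (simp add: ennreal_eq_0_iff)

text \<open>The uniform state makes the sets whose infima are taken below nonempty.\<close>

lemma indicator_X: "indicator P \<in> X"
proof -
  have "Ub (indicator P) \<le> (\<integral>\<^sup>+x. indicator (frontier P) x \<partial>\<sigma>)"
    unfolding Ub_def by (intro nn_integral_mono) (auto simp: indicator_def)
  also have "\<dots> = emeasure \<sigma> (frontier P)" by (rule nn_integral_indicator) (simp add: sets_sigma)
  also have "\<dots> < \<infinity>" by (rule emeasure_frontier_finite[OF sys])
  finally show ?thesis using indicator_in_M by (simp add: X_def)
qed

text \<open>Transfers a liminf bound to real numbers. A negative \<open>enn2real a - d\<close> is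
  treated apart, since \<open>ennreal\<close> would send it to 0.\<close>

lemma eventually_gt_enn2real_of_le_liminf:
  fixes a :: ennreal
  assumes "a \<le> liminf f" "a < \<infinity>" "\<And>j. f j = ennreal (g j)" "\<And>j. g j \<ge> 0" "d > 0"
  shows "eventually (\<lambda>j. enn2real a - d < g j) sequentially"
proof (cases "enn2real a - d < 0")
  case True
  then show ?thesis using assms(4) by (intro always_eventually allI) (rule less_le_trans)
next
  case False
  obtain r where r: "a = ennreal r" "r \<ge> 0" using assms(2) by (cases a) auto
  moreover from this have "0 \<le> r - d" using False by simp
  ultimately have "ennreal (r - d) < a" using assms(5) by (simp add: ennreal_less_iff)
  then have "eventually (\<lambda>j. ennreal (r - d) < f j) sequentially" using assms(1) le_Liminf_iff by blast
  then show ?thesis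
    by eventually_elim (use r False assms(3,4) in \<open>auto simp: ennreal_less_iff\<close>)
qed

lemma X_limit:
  assumes s: "\<And>j. s j \<in> X" and D: "\<And>j. H (s j) (s (Suc j)) \<le> (1/4) ^ j" and B: "\<And>j. U (s j) \<le> B"
  obtains u where "u \<in> X" "\<And>d. d > 0 \<Longrightarrow> eventually (\<lambda>j. U u - d < U (s j) \<and> E u - d < E (s j)) sequentially"
proof -
  have "Hd (s j) (s (Suc j)) \<le> ennreal ((1/4) ^ j)" for j
    unfolding Hd_H[OF s s] by (rule ennreal_leI[OF D])
  then obtain u where u: "u \<in> M" "\<And>x. x \<in> P \<Longrightarrow> u x \<le> liminf (\<lambda>j. s j x)" "En u \<le> liminf (\<lambda>j. En (s j))"
    using M_limit[of s] X_M[OF s] by blast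
  have [measurable]: "s j \<in> borel_measurable borel" for j using X_M[OF s[of j]] by measurable
  \<comment> \<open>Fatou's lemma for \<open>\<sigma>\<close> applies because the liminf bound holds
    at every boundary point, not merely almost everywhere for \<open>lborel\<close>.\<close>
  have Uu: "Ub u \<le> liminf (\<lambda>j. Ub (s j))"
  proof -
    have "Ub u \<le> (\<integral>\<^sup>+x. liminf (\<lambda>j. s j x * indicator (frontier P) x) \<partial>\<sigma>)"
      unfolding Ub_def
    proof (rule nn_integral_mono)
      fix x
      show "u x * indicator (frontier P) x \<le> liminf (\<lambda>j. s j x * indicator (frontier P) x)"
        using u(2)[of x] frontier_subset_P by (cases "x \<in> frontier P") auto
    qed
    also have "\<dots> \<le> liminf (\<lambda>j. Ub (s j))"
      unfolding Ub_def by (rule nn_integral_liminf) measurable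
    finally show ?thesis .
  qed
  have "liminf (\<lambda>j. Ub (s j)) \<le> liminf (\<lambda>j. ennreal B)"
    by (intro Liminf_mono always_eventually allI) (use B in \<open>auto simp: Ub_eq[OF s] intro!: ennreal_leI\<close>)
  also have "\<dots> = ennreal B" by (simp add: Liminf_const)
  finally have "Ub u \<le> ennreal B" using Uu by (rule order_trans[rotated])
  then have uX: "u \<in> X" by (rule X_I[OF u(1)])
  show ?thesis
  proof (rule that[OF uX])
    fix d :: real assume d: "d > 0"
    have "eventually (\<lambda>j. enn2real (Ub u) - d < U (s j)) sequentially"
      by (rule eventually_gt_enn2real_of_le_liminf[OF Uu _ Ub_eq[OF s] U_nonneg d]) (use uX in \<open>simp add: X_def\<close>)
    moreover have "eventually (\<lambda>j. enn2real (En u) - d < E (s j)) sequentially"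
      by (rule eventually_gt_enn2real_of_le_liminf[OF u(3) _ En_eq[OF s] E_nonneg d]) (use En_finite[OF uX] in simp)
    ultimately show "eventually (\<lambda>j. U u - d < U (s j) \<and> E u - d < E (s j)) sequentially"
      by eventually_elim (simp add: U_def[of u] E_def[of u])
  qed
qed

section \<open>Existence and uniqueness of minimisers\<close>

lemma tendsto_quarter_power: "(\<lambda>j. (1/4) ^ j :: real) \<longlonglongrightarrow> 0"
  by (rule LIMSEQ_power_zero) simp

text \<open>Comparing the infimum with the value at a midpoint bounds \<open>b * H u v\<close> by
  the average excess of \<open>u\<close> and \<open>v\<close>. The weight \<open>b > 0\<close>
  yields the Cauchy property and uniqueness, and \<open>a > 0\<close> bounds the energy along the
  sequence.\<close>

lemma weighted_minimizer:
  assumes a: "a > 0" and b: "b > 0"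
  shows "\<exists>!u. u \<in> X \<and> (\<forall>v\<in>X. a * U u + b * E u \<le> a * U v + b * E v)"
proof -
  define G where "G u = a * U u + b * E u" for u
  have G0: "G u \<ge> 0" for u using a b U_nonneg E_nonneg by (simp add: G_def)
  define \<gamma> where "\<gamma> = Inf (G ` X)"
  have bdd: "bdd_below (G ` X)" using G0 by (intro bdd_belowI[of _ 0]) auto
  have ge: "\<gamma> \<le> G u" if "u \<in> X" for u unfolding \<gamma>_def by (rule cInf_lower[OF _ bdd]) (use that in simp)
  have near: "\<exists>u\<in>X. G u < \<gamma> + d" if "d > 0" for d
  proof -
    have "Inf (G ` X) < \<gamma> + d" using that by (simp add: \<gamma>_def)
    then show ?thesis using cInf_lessD[of "G ` X" "\<gamma> + d"] indicator_X by auto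
  qed
  have gap: "b * H u v \<le> (G u - \<gamma> + (G v - \<gamma>)) / 2" if u: "u \<in> X" and v: "v \<in> X" for u v
  proof -
    have "\<gamma> \<le> G (mid u v)" by (rule ge[OF mid_X(1)[OF u v]])
    moreover have "G (mid u v) + b * H u v = a * ((U u + U v) / 2) + b * (E (mid u v) + H u v)"
      by (simp add: G_def mid_X(2)[OF u v] algebra_simps)
    moreover have "b * (E (mid u v) + H u v) \<le> b * ((E u + E v) / 2)"
      using b mid_X(3)[OF u v] by (intro mult_left_mono) auto
    moreover have "a * ((U u + U v) / 2) + b * ((E u + E v) / 2) = (G u + G v) / 2"
      by (simp add: G_def field_simps)
    ultimately show ?thesis by (simp add: field_simps)
  qed
  \<comment> \<open>An excess below \<open>b * (1/4) ^ j\<close> gives consecutive members a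
    distance of at most \<open>(1/4) ^ j\<close>, the rate that \<open>X_limit\<close> asks
    for.\<close>
  have "\<exists>u. u \<in> X \<and> G u < \<gamma> + b * (1/4) ^ j" for j :: nat
    using near[of "b * (1/4) ^ j"] b by auto
  then obtain s where s: "\<And>j. s j \<in> X" "\<And>j. G (s j) < \<gamma> + b * (1/4) ^ j" by metis
  have "H (s j) (s (Suc j)) \<le> (1/4) ^ j" for j
  proof -
    have "b * H (s j) (s (Suc j)) \<le> (b * (1/4) ^ j + b * (1/4) ^ Suc j) / 2"
      using gap[OF s(1)[of j] s(1)[of "Suc j"]] s(2)[of j] s(2)[of "Suc j"] by simp
    also have "\<dots> \<le> b * (1/4) ^ j" using b by simp
    finally show ?thesis using b by simp
  qed
  moreover have "U (s j) \<le> (\<gamma> + b) / a" for j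
  proof -
    have "b * (1/4) ^ j \<le> b * 1" using b by (intro mult_left_mono power_le_one) auto
    moreover have "b * E (s j) \<ge> 0" using b E_nonneg by simp
    ultimately have "a * U (s j) \<le> \<gamma> + b" using s(2)[of j] by (simp add: G_def)
    then show ?thesis using a by (simp add: pos_le_divide_eq mult.commute)
  qed
  ultimately obtain u where u: "u \<in> X"
    and ev: "\<And>d. d > 0 \<Longrightarrow> eventually (\<lambda>j. U u - d < U (s j) \<and> E u - d < E (s j)) sequentially"
    by (rule X_limit[OF s(1)]) blast+
  have "G u \<le> \<gamma>"
  proof (rule field_le_epsilon)
    fix e :: real assume e: "e > 0"
    define d where "d = e / (a + b)"
    have d: "d > 0" using e a b by (simp add: d_def)
    have "eventually (\<lambda>j. G u - e \<le> \<gamma> + b * (1/4) ^ j) sequentially"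
      using ev[OF d]
    proof eventually_elim
      case (elim j)
      have "a * (U u - d) \<le> a * U (s j)" "b * (E u - d) \<le> b * E (s j)"
        using elim a b by (auto intro!: mult_left_mono)
      moreover have "a * d + b * d = e" unfolding distrib_right[symmetric] d_def using a b by simp
      ultimately show ?case using s(2)[of j] by (simp add: G_def algebra_simps)
    qed
    moreover have "(\<lambda>j. \<gamma> + b * (1/4) ^ j) \<longlonglongrightarrow> \<gamma> + b * 0" by (intro tendsto_intros tendsto_quarter_power)
    ultimately have "G u - e \<le> \<gamma>" using tendsto_lowerbound[of "\<lambda>j. \<gamma> + b * (1/4) ^ j" \<gamma> sequentially] by simp
    then show "G u \<le> \<gamma> + e" by simp
  qed
  have min: "G u \<le> G v" if "v \<in> X" for v using \<open>G u \<le> \<gamma>\<close> ge[OF that] by simp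
  show ?thesis
  proof (rule ex1I[of _ u])
    show "u \<in> X \<and> (\<forall>v\<in>X. a * U u + b * E u \<le> a * U v + b * E v)" using u min by (simp add: G_def)
    fix v assume v: "v \<in> X \<and> (\<forall>w\<in>X. a * U v + b * E v \<le> a * U w + b * E w)"
    then have "G v \<le> G u" using u by (simp add: G_def)
    then have "b * H v u \<le> 0" using gap[of v u] v u \<open>G u \<le> \<gamma>\<close> by simp
    then have "H v u \<le> 0" using b by (simp add: mult_le_0_iff)
    then show "v = u" using H_le_0 v u by blast
  qed
qed

text \<open>The energy sublevels above the infimum \<open>m\<close> are nonempty and closed under
  midpoints, as \<open>U\<close> is affine there. The entropy gap is used inside these sublevels,
  with \<open>e0\<close> as the relaxed minimum; that \<open>U\<close> attains \<open>m\<close>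
  comes out only in the limit.\<close>

lemma lexicographic_minimizer:
  obtains u where "u \<in> X" "\<And>v. v \<in> X \<Longrightarrow> U u \<le> U v" "\<And>v. v \<in> X \<Longrightarrow> U v = U u \<Longrightarrow> E u \<le> E v"
    "\<And>v. v \<in> X \<Longrightarrow> U v = U u \<Longrightarrow> E v = E u \<Longrightarrow> v = u"
proof -
  define m where "m = Inf (U ` X)"
  have bdd: "bdd_below (U ` X)" using U_nonneg by (intro bdd_belowI[of _ 0]) auto
  have ge: "m \<le> U u" if "u \<in> X" for u unfolding m_def by (rule cInf_lower[OF _ bdd]) (use that in simp)
  have near: "\<exists>u\<in>X. U u < m + d" if "d > 0" for d
  proof -
    have "Inf (U ` X) < m + d" using that by (simp add: m_def)
    then show ?thesis using cInf_lessD[of "U ` X" "m + d"] indicator_X by auto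
  qed
  obtain R where R: "\<And>u. u \<in> X \<Longrightarrow> U u \<le> m + 1 \<Longrightarrow> E u \<le> R" using E_bounded by blast
  \<comment> \<open>The asymptotic lower bounds of \<open>E\<close> near minimal energy; their
    supremum is the limit of the infima of \<open>E\<close> over shrinking sublevels of
    \<open>U\<close>.\<close>
  define L where "L = {r. \<exists>e>0. \<forall>u\<in>X. U u \<le> m + e \<longrightarrow> r \<le> E u}"
  define e0 where "e0 = Sup L"
  have L0: "0 \<in> L" unfolding L_def using E_nonneg by (auto intro: exI[of _ 1])
  \<comment> \<open>States of nearly minimal energy have \<open>E\<close> at most \<open>R\<close>:
    here the integrability estimate enters the case \<open>T = 0\<close>.\<close>
  have Lbdd: "bdd_above L"
  proof (rule bdd_aboveI)
    fix r assume "r \<in> L"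
    then obtain e where e: "e > 0" "\<And>u. u \<in> X \<Longrightarrow> U u \<le> m + e \<Longrightarrow> r \<le> E u" unfolding L_def by blast
    obtain u where "u \<in> X" "U u < m + min e 1" using near[of "min e 1"] e by auto
    then show "r \<le> R" using e(2)[of u] R[of u] by (force intro: order_trans)
  qed
  have lower: "\<exists>e>0. \<forall>u\<in>X. U u \<le> m + e \<longrightarrow> e0 - d \<le> E u" if d: "d > 0" for d
  proof -
    have "e0 - d < Sup L" using d by (simp add: e0_def)
    then obtain r where r: "r \<in> L" "e0 - d < r" using less_cSup_iff[of L] L0 Lbdd by blast
    then obtain e where "e > 0" "\<forall>u\<in>X. U u \<le> m + e \<longrightarrow> r \<le> E u" unfolding L_def by blast
    then show ?thesis using r(2) by (intro exI[of _ e]) fastforce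
  qed
  have upper: "\<exists>u\<in>X. U u \<le> m + e \<and> E u \<le> e0 + d" if e: "e > 0" and d: "d > 0" for e d
  proof (rule ccontr)
    assume "\<not> ?thesis"
    then have "e0 + d \<in> L" unfolding L_def using e by fastforce
    then have "e0 + d \<le> e0" unfolding e0_def by (rule cSup_upper[OF _ Lbdd])
    then show False using d by simp
  qed
  \<comment> \<open>Half of the target rate: a midpoint value of at least
    \<open>e0 - \<delta> j\<close> and end values of at most \<open>e0 + \<delta> j\<close> leave
    \<open>H\<close> at most \<open>2 * \<delta> j\<close>.\<close>
  define \<delta> :: "nat \<Rightarrow> real" where "\<delta> j = (1/4) ^ j / 2" for j
  have \<delta>: "\<delta> j > 0" "\<delta> (Suc j) \<le> \<delta> j" for j by (auto simp: \<delta>_def)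
  obtain e where e: "\<And>j. e j > 0" "\<And>j u. u \<in> X \<Longrightarrow> U u \<le> m + e j \<Longrightarrow> e0 - \<delta> j \<le> E u"
    using lower[OF \<delta>(1)] by metis
  \<comment> \<open>The additional cap forces \<open>U (s j)\<close> to tend to
    \<open>m\<close>.\<close>
  define e' where "e' j = min (e j) ((1/4) ^ j)" for j
  have e': "e' j > 0" "e' j \<le> (1/4) ^ j" for j using e(1)[of j] by (auto simp: e'_def)
  have e'lower: "e0 - \<delta> j \<le> E u" if "u \<in> X" "U u \<le> m + e' j" for j u
    by (rule e(2)[OF that(1)]) (use that(2) in \<open>auto simp: e'_def\<close>)
  have "\<exists>u. u \<in> X \<and> U u \<le> m + e' j \<and> E u \<le> e0 + \<delta> j" for j
    using upper[OF e'(1) \<delta>(1)] by blast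
  then obtain s where s: "\<And>j. s j \<in> X" "\<And>j. U (s j) \<le> m + e' j" "\<And>j. E (s j) \<le> e0 + \<delta> j" by metis
  have "H (s j) (s (Suc j)) \<le> (1/4) ^ j" for j
  proof -
    let ?w = "mid (s j) (s (Suc j))"
    note w = mid_X[OF s(1)[of j] s(1)[of "Suc j"]]
    \<comment> \<open>The tolerances \<open>e'\<close> need not decrease, so the midpoint is placed
      in the larger of the two sublevels. Either one gives the lower bound
      \<open>e0 - \<delta> j\<close>, because \<open>\<delta>\<close> decreases.\<close>
    have "U ?w \<le> m + e' j \<or> U ?w \<le> m + e' (Suc j)"
    proof (cases "e' j \<le> e' (Suc j)")
      case True
      then show ?thesis using s(2)[of j] s(2)[of "Suc j"] unfolding w(2) by (intro disjI2) simp
    next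
      case False
      then show ?thesis using s(2)[of j] s(2)[of "Suc j"] unfolding w(2) by (intro disjI1) simp
    qed
    then have "e0 - \<delta> j \<le> E ?w"
      using e'lower[OF w(1), of j] e'lower[OF w(1), of "Suc j"] \<delta>(2)[of j] by linarith
    then have "H (s j) (s (Suc j)) \<le> 2 * \<delta> j"
      using w(3) s(3)[of j] s(3)[of "Suc j"] \<delta>(2)[of j] by simp
    then show ?thesis by (simp add: \<delta>_def)
  qed
  moreover have "U (s j) \<le> m + 1" for j
  proof -
    have "(1/4::real) ^ j \<le> 1" by (rule power_le_one) auto
    then show ?thesis using s(2)[of j] e'(2)[of j] by linarith
  qed
  ultimately obtain u where u: "u \<in> X"
    and ev: "\<And>d. d > 0 \<Longrightarrow> eventually (\<lambda>j. U u - d < U (s j) \<and> E u - d < E (s j)) sequentially"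
    by (rule X_limit[OF s(1)]) blast+
  have "U u \<le> m"
  proof (rule field_le_epsilon)
    fix d :: real assume d: "d > 0"
    have "eventually (\<lambda>j. U u - d \<le> m + (1/4) ^ j) sequentially"
      using ev[OF d]
    proof eventually_elim
      case (elim j) then show ?case using s(2)[of j] e'(2)[of j] by linarith
    qed
    moreover have "(\<lambda>j. m + (1/4) ^ j) \<longlonglongrightarrow> m + 0" by (intro tendsto_intros tendsto_quarter_power)
    ultimately have "U u - d \<le> m" using tendsto_lowerbound[of "\<lambda>j. m + (1/4) ^ j" m sequentially] by simp
    then show "U u \<le> m + d" by simp
  qed
  then have Um: "U u = m" using ge[OF u] by simp
  have Ele: "E u \<le> e0"
  proof (rule field_le_epsilon)
    fix d :: real assume d: "d > 0"
    have "eventually (\<lambda>j. E u - d \<le> e0 + (1/4) ^ j) sequentially"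
      using ev[OF d]
    proof eventually_elim
      case (elim j)
      have "\<delta> j \<le> (1/4) ^ j" by (simp add: \<delta>_def)
      then show ?case using s(3)[of j] elim by linarith
    qed
    moreover have "(\<lambda>j. e0 + (1/4) ^ j) \<longlonglongrightarrow> e0 + 0" by (intro tendsto_intros tendsto_quarter_power)
    ultimately have "E u - d \<le> e0" using tendsto_lowerbound[of "\<lambda>j. e0 + (1/4) ^ j" e0 sequentially] by simp
    then show "E u \<le> e0 + d" by simp
  qed
  have Ege: "e0 \<le> E v" if v: "v \<in> X" "U v = m" for v
  proof (rule field_le_epsilon)
    fix d :: real assume d: "d > 0"
    obtain e where "e > 0" "\<forall>u\<in>X. U u \<le> m + e \<longrightarrow> e0 - d \<le> E u" using lower[OF d] by blast
    then show "e0 \<le> E v + d" using v by fastforce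
  qed
  show ?thesis
  proof (rule that[OF u])
    show "U u \<le> U v" if "v \<in> X" for v using ge[OF that] Um by simp
    show "E u \<le> E v" if "v \<in> X" "U v = U u" for v using Ele Ege[of v] that Um by simp
    fix v assume v: "v \<in> X" "U v = U u" "E v = E u"
    have "e0 \<le> E (mid v u)" by (rule Ege) (use mid_X[OF v(1) u] v Um in auto)
    then have "H v u \<le> 0" using mid_X(3)[OF v(1) u] v Ele by simp
    then show "v = u" by (rule H_le_0[OF v(1) u])
  qed
qed

end

section \<open>Translation back to entropy and free energy\<close>

context polytope_system
begin

abbreviation V :: real where "V \<equiv> measure lborel P"

lemma mu_total: "enn2ereal (mu_int P c (\<lambda>_. 1)) = ereal (c * V)"
proof -
  have "mu_int P c (\<lambda>_. 1) = ennreal c * ennreal V"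
    by (simp add: mu_int_def emeasure_P_eq)
  also have "\<dots> = ennreal (c * V)" using c_pos by (simp add: ennreal_mult')
  finally show ?thesis using c_pos measure_P_pos by simp
qed

lemma cV_pos: "c * V > 0" using c_pos measure_P_pos by simp

lemma internal_energy_X:
  assumes "u \<in> X"
  shows "internal_energy P c \<sigma> u = ereal (U u / (c * V))"
  using c_pos measure_P_pos U_nonneg[of u] Ub_eq[OF assms]
  by (simp add: internal_energy_def mu_total Ub_def)

lemma internal_energy_not_X:
  assumes "u \<in> M" "u \<notin> X"
  shows "internal_energy P c \<sigma> u = \<infinity>"
proof -
  have "Ub u = \<infinity>" using assms by (auto simp: X_def less_top[symmetric])
  then show ?thesis using cV_pos by (simp add: internal_energy_def mu_total Ub_def)
qed

text \<open>\<open>ulogu_int\<close> subtracts the negative part \<open>N\<close> from the positive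
  part \<open>A\<close>, while \<open>En\<close> shifts the integrand by 1. The identity
  \<open>En u + N = A + ennreal V\<close> relates them without subtraction in
  \<open>ennreal\<close>; \<open>N \<le> V\<close> makes everything finite.\<close>

lemma entropy_X:
  assumes uX: "u \<in> X"
  shows "entropy P c u = ereal ((V - E u) / V)"
proof -
  have u: "u \<in> M" by (rule X_M[OF uX])
  have [measurable]: "rf u \<in> borel_measurable borel" using u by measurable
  let ?I = "interior P"
  define A where "A = (\<integral>\<^sup>+x. ennreal (phi (rf u x)) * indicator ?I x \<partial>lborel)"
  define N where "N = (\<integral>\<^sup>+x. ennreal (- phi (rf u x)) * indicator ?I x \<partial>lborel)"
  have N: "N \<le> ennreal V"
  proof -
    have "N \<le> (\<integral>\<^sup>+x. indicator P x \<partial>lborel)"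
      unfolding N_def
    proof (rule nn_integral_mono)
      fix x
      show "ennreal (- phi (rf u x)) * indicator ?I x \<le> indicator P x"
      proof (cases "x \<in> ?I")
        case True
        have "- phi (rf u x) \<le> 1" using phi_ge[OF M_rf(2)[OF u True]] M_rf(2)[OF u True] by linarith
        then have "ennreal (- phi (rf u x)) \<le> ennreal 1" by (rule ennreal_leI)
        then show ?thesis using True interior_subset[of P] by auto
      qed simp
    qed
    then show ?thesis by (simp add: emeasure_P_eq)
  qed
  have sum: "En u + N = A + ennreal V"
  proof -
    have "En u + N = (\<integral>\<^sup>+x. ennreal (phi (rf u x) + 1) * indicator ?I x + ennreal (- phi (rf u x)) * indicator ?I x \<partial>lborel)"
      unfolding En_def N_def by (rule nn_integral_add[symmetric]) measurable
    also have "\<dots> = (\<integral>\<^sup>+x. ennreal (phi (rf u x)) * indicator ?I x + indicator ?I x \<partial>lborel)"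
    proof (rule nn_integral_cong)
      fix x
      show "ennreal (phi (rf u x) + 1) * indicator ?I x + ennreal (- phi (rf u x)) * indicator ?I x = ennreal (phi (rf u x)) * indicator ?I x + indicator ?I x"
      proof (cases "x \<in> ?I")
        case True
        let ?a = "phi (rf u x)"
        have a: "- 1 \<le> ?a" using phi_ge[OF M_rf(2)[OF u True]] M_rf(2)[OF u True] by linarith
        have "ennreal (?a + 1) + ennreal (- ?a) = ennreal ?a + 1"
        proof (cases "?a \<ge> 0")
          case True
          then show ?thesis by (simp add: ennreal_neg)
        next
          case False
          then have "ennreal (?a + 1) + ennreal (- ?a) = ennreal ((?a + 1) + - ?a)"
            using a by (intro ennreal_plus[symmetric]) auto
          then show ?thesis using False by (simp add: ennreal_neg)
        qed
        then show ?thesis using True by simp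
      qed simp
    qed
    also have "\<dots> = A + emeasure lborel ?I"
      unfolding A_def by (subst nn_integral_add) auto
    also have "emeasure lborel ?I = emeasure lborel P"
    proof (rule antisym)
      show "emeasure lborel ?I \<le> emeasure lborel P" by (intro emeasure_mono interior_subset) auto
      have "AE x in lborel. x \<in> P \<longrightarrow> x \<in> ?I" by (rule AE_interior)
      then show "emeasure lborel P \<le> emeasure lborel ?I" by (rule emeasure_mono_AE) auto
    qed
    finally show ?thesis by (simp add: emeasure_P_eq)
  qed
  obtain k where k: "N = ennreal k" "k \<ge> 0" using N by (cases N) (auto simp: top_unique)
  have "A + ennreal V = ennreal (E u + k)" using sum k En_eq[OF uX] E_nonneg[of u] by simp
  then obtain a where a: "A = ennreal a" "a \<ge> 0" by (cases A) auto
  have ak: "a + V = E u + k"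
    using sum k a E_nonneg[of u] measure_P_pos unfolding En_eq[OF uX]
    by (simp add: ennreal_plus[symmetric] del: ennreal_plus)
  have pos: "(\<integral>\<^sup>+x. e2ennreal (xlogx (u x)) * indicator P x \<partial>lborel) = A"
    and neg: "(\<integral>\<^sup>+x. e2ennreal (- xlogx (u x)) * indicator P x \<partial>lborel) = N"
  proof -
    have *: "xlogx (u x) = ereal (phi (rf u x))" if "x \<in> ?I" for x
      using M_finite_interior[OF u that] by (auto simp: xlogx_def phi_def rf_def)
    have ae: "AE x in lborel. e2ennreal (xlogx (u x)) * indicator P x = ennreal (phi (rf u x)) * indicator ?I x"
      "AE x in lborel. e2ennreal (- xlogx (u x)) * indicator P x = ennreal (- phi (rf u x)) * indicator ?I x"
      by (rule AE_mp[OF AE_interior], rule AE_I2, use interior_subset[of P] in \<open>auto simp: indicator_def *\<close>)+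
    show "(\<integral>\<^sup>+x. e2ennreal (xlogx (u x)) * indicator P x \<partial>lborel) = A"
      unfolding A_def by (rule nn_integral_cong_AE[OF ae(1)])
    show "(\<integral>\<^sup>+x. e2ennreal (- xlogx (u x)) * indicator P x \<partial>lborel) = N"
      unfolding N_def by (rule nn_integral_cong_AE[OF ae(2)])
  qed
  have "ulogu_int P c u = enn2ereal (ennreal c * ennreal a) - enn2ereal (ennreal c * ennreal k)"
    unfolding ulogu_int_def mu_int_def pos neg a(1) k(1) ..
  also have "\<dots> = ereal (c * a) - ereal (c * k)"
    using c_pos a k by (simp flip: ennreal_mult')
  also have "\<dots> = ereal (c * (E u - V))" using ak by (simp flip: right_diff_distrib)
  finally show ?thesis
    unfolding entropy_def mu_total using c_pos measure_P_pos
    by (simp add: field_simps)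
qed

text \<open>In \<open>ereal\<close>, \<open>\<infinity> - x = \<infinity>\<close> for every
  \<open>x\<close>, so both branches of \<open>free_energy\<close> give the same value.\<close>

lemma free_energy_not_X:
  assumes "u \<in> M" "u \<notin> X"
  shows "free_energy P c \<sigma> T u = \<infinity>"
  by (simp add: free_energy_def internal_energy_not_X[OF assms])

lemma free_energy_X:
  assumes "u \<in> X"
  shows "free_energy P c \<sigma> T u = ereal (1 / (c * V) * U u + T / V * E u - T)"
proof -
  have "U u / (c * V) - T * ((V - E u) / V) = 1 / (c * V) * U u + T / V * E u - T"
    using measure_P_pos by (simp add: diff_divide_distrib right_diff_distrib)
  then show ?thesis
    using assms by (simp add: free_energy_def entropy_X internal_energy_X)
qed

text \<open>Finite energy alone yields the exponent, so the claim on the minimisers reduces to their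
  membership in \<open>X\<close>.\<close>

lemma Mp_q:
  assumes u: "u \<in> X"
  shows "u \<in> Mp (real DIM('a) / (real DIM('a) - 1)) P c"
proof -
  have uM: "u \<in> Mp 1 P c" using X_M[OF u] Mp_1_eq[OF c_pos] by simp
  have pq: "real DIM('a) / (real DIM('a) - 1) = 1 + q" using dim2 by (simp add: q_def field_simps)
  have B: "U u + 1 > 0" using U_nonneg[of u] by simp
  obtain R where R: "\<forall>u'\<in>M. Ub u' \<le> ennreal (U u + 1) \<longrightarrow> (\<integral>\<^sup>+x. epowr (u' x) (1 + q) * indicator P x \<partial>lborel) \<le> ennreal R"
    using Lp_bound[OF B] by blast
  have "Ub u \<le> ennreal (U u + 1)" unfolding Ub_eq[OF u] by (intro ennreal_leI) simp
  then have "(\<integral>\<^sup>+x. epowr (u x) (1 + q) * indicator P x \<partial>lborel) \<le> ennreal R" using R X_M[OF u] by blast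
  then have "(\<integral>\<^sup>+x. epowr (u x) (1 + q) * indicator P x \<partial>lborel) < \<infinity>" by (rule le_less_trans) simp
  then have "mu_int P c (\<lambda>x. epowr (u x) (1 + q)) < \<infinity>" by (simp add: mu_int_def ennreal_mult_less_top)
  then show ?thesis using uM unfolding Mp_def pq by simp
qed


text \<open>On \<open>X\<close> the free energy is a weighted sum of \<open>U\<close> and
  \<open>E\<close> up to the constant \<open>-T\<close>. In the form of an equivalence with
  \<open>w = u\<close>, existence, uniqueness and the integrability of every minimiser all follow by
  rewriting.\<close>

lemma free_energy_minimizer:
  assumes T: "T > 0"
  obtains u where "u \<in> X"
    "\<And>w. w \<in> M \<and> (\<forall>v\<in>M. free_energy P c \<sigma> T w \<le> free_energy P c \<sigma> T v) \<longleftrightarrow> w = u"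
proof -
  define G where "G u = 1 / (c * V) * U u + T / V * E u" for u
  have F: "free_energy P c \<sigma> T u = ereal (G u - T)" if "u \<in> X" for u
    using free_energy_X[OF that] by (simp add: G_def)
  have "\<exists>!u. u \<in> X \<and> (\<forall>v\<in>X. G u \<le> G v)"
    unfolding G_def by (rule weighted_minimizer) (use T c_pos measure_P_pos in auto)
  then obtain u where u: "u \<in> X" "\<And>v. v \<in> X \<Longrightarrow> G u \<le> G v"
    and uniq: "\<And>w. w \<in> X \<Longrightarrow> (\<And>v. v \<in> X \<Longrightarrow> G w \<le> G v) \<Longrightarrow> w = u"
    by (metis (no_types, lifting))
  have min: "free_energy P c \<sigma> T u \<le> free_energy P c \<sigma> T v" if "v \<in> M" for v
    using u(2)[of v] F[OF u(1)] F[of v] free_energy_not_X[OF that, of T] by (cases "v \<in> X") auto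
  show ?thesis
  proof (rule that[OF u(1)], intro iffI)
    fix w assume w: "w \<in> M \<and> (\<forall>v\<in>M. free_energy P c \<sigma> T w \<le> free_energy P c \<sigma> T v)"
    then have le: "free_energy P c \<sigma> T w \<le> free_energy P c \<sigma> T u" using X_M[OF u(1)] by blast
    then have wX: "w \<in> X" using free_energy_not_X[of w T] w F[OF u(1)] by force
    show "w = u"
    proof (rule uniq[OF wX])
      fix v assume "v \<in> X"
      then show "G w \<le> G v" using le F[OF wX] F[OF u(1)] u(2) by force
    qed
  next
    fix w assume "w = u"
    then show "w \<in> M \<and> (\<forall>v\<in>M. free_energy P c \<sigma> T w \<le> free_energy P c \<sigma> T v)" using min X_M[OF u(1)] by blast
  qed
qed

lemma ground_state:
  obtains u where "u \<in> X"
    "\<And>w. w \<in> M \<and> (\<forall>v\<in>M. internal_energy P c \<sigma> w \<le> internal_energy P c \<sigma> v) \<and>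
        entropy P c w = Sup {entropy P c v | v. v \<in> M \<and> internal_energy P c \<sigma> v = (INF w\<in>M. internal_energy P c \<sigma> w)}
      \<longleftrightarrow> w = u"
proof -
  obtain u where u: "u \<in> X" "\<And>v. v \<in> X \<Longrightarrow> U u \<le> U v" "\<And>v. v \<in> X \<Longrightarrow> U v = U u \<Longrightarrow> E u \<le> E v"
    and uniq: "\<And>v. v \<in> X \<Longrightarrow> U v = U u \<Longrightarrow> E v = E u \<Longrightarrow> v = u"
    by (rule lexicographic_minimizer) blast
  have uM: "u \<in> M" by (rule X_M[OF u(1)])
  have min: "internal_energy P c \<sigma> u \<le> internal_energy P c \<sigma> v" if "v \<in> M" for v
    using u(2)[of v] internal_energy_X[OF u(1)] internal_energy_X[of v] internal_energy_not_X[OF that] cV_pos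
    by (cases "v \<in> X") (auto simp: divide_right_mono)
  have INF: "(INF w\<in>M. internal_energy P c \<sigma> w) = internal_energy P c \<sigma> u"
    by (rule antisym) (auto intro!: INF_lower INF_greatest uM min)
  have same: "v \<in> X \<and> U v = U u" if "v \<in> M" "internal_energy P c \<sigma> v = internal_energy P c \<sigma> u" for v
  proof -
    have "v \<in> X" using that internal_energy_not_X[of v] internal_energy_X[OF u(1)] by force
    then show ?thesis using that internal_energy_X[of v] internal_energy_X[OF u(1)] c_pos measure_P_pos by simp
  qed
  have Sup: "Sup {entropy P c v | v. v \<in> M \<and> internal_energy P c \<sigma> v = (INF w\<in>M. internal_energy P c \<sigma> w)} = entropy P c u"
    unfolding INF
  proof (rule antisym)
    show "entropy P c u \<le> Sup {entropy P c v | v. v \<in> M \<and> internal_energy P c \<sigma> v = internal_energy P c \<sigma> u}"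
      using uM by (intro Sup_upper) blast
    have "entropy P c v \<le> entropy P c u" if v: "v \<in> M" "internal_energy P c \<sigma> v = internal_energy P c \<sigma> u" for v
      using u(3)[of v] same[OF v] measure_P_pos
      by (simp add: entropy_X[OF u(1)] entropy_X[of v] divide_right_mono)
    then show "Sup {entropy P c v | v. v \<in> M \<and> internal_energy P c \<sigma> v = internal_energy P c \<sigma> u} \<le> entropy P c u"
      by (intro Sup_least) blast
  qed
  show ?thesis
  proof (rule that[OF u(1)], unfold Sup, intro iffI)
    fix w assume w: "w \<in> M \<and> (\<forall>v\<in>M. internal_energy P c \<sigma> w \<le> internal_energy P c \<sigma> v) \<and> entropy P c w = entropy P c u"
    then have "internal_energy P c \<sigma> w = internal_energy P c \<sigma> u" using uM min by (intro antisym) auto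
    then have wX: "w \<in> X" "U w = U u" using same w by auto
    moreover have "E w = E u"
      using w entropy_X[OF u(1)] entropy_X[OF wX(1)] measure_P_pos by simp
    ultimately show "w = u" using uniq by blast
  next
    fix w assume "w = u"
    then show "w \<in> M \<and> (\<forall>v\<in>M. internal_energy P c \<sigma> w \<le> internal_energy P c \<sigma> v) \<and> entropy P c w = entropy P c u"
      using uM min by blast
  qed
qed

end

theorem mainTheorem12:
  fixes P :: "'a::euclidean_space set" and c :: real and \<sigma> :: "'a measure"
  assumes sys: "n_system P c \<sigma>"
    and dim: "DIM('a) \<ge> 2"
  shows "(\<forall>T>0. \<exists>!u. u \<in> Mp 1 P c \<and>
              (\<forall>v \<in> Mp 1 P c. free_energy P c \<sigma> T u \<le> free_energy P c \<sigma> T v)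
         \<and> (\<forall>u. u \<in> Mp 1 P c \<and>
              (\<forall>v \<in> Mp 1 P c. free_energy P c \<sigma> T u \<le> free_energy P c \<sigma> T v)
              \<longrightarrow> u \<in> Mp (real DIM('a) / (real DIM('a) - 1)) P c))
       \<and> (\<exists>!u. u \<in> Mp 1 P c \<and>
              (\<forall>v \<in> Mp 1 P c. internal_energy P c \<sigma> u \<le> internal_energy P c \<sigma> v) \<and>
              entropy P c u = Sup {entropy P c v | v. v \<in> Mp 1 P c \<and>
                 internal_energy P c \<sigma> v = (INF w \<in> Mp 1 P c. internal_energy P c \<sigma> w)})
       \<and> (\<forall>u. u \<in> Mp 1 P c \<and>
              (\<forall>v \<in> Mp 1 P c. internal_energy P c \<sigma> u \<le> internal_energy P c \<sigma> v) \<and>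
              entropy P c u = Sup {entropy P c v | v. v \<in> Mp 1 P c \<and>
                 internal_energy P c \<sigma> v = (INF w \<in> Mp 1 P c. internal_energy P c \<sigma> w)}
              \<longrightarrow> u \<in> Mp (real DIM('a) / (real DIM('a) - 1)) P c)"
proof -
  have poly: "polytope P" and int: "interior P \<noteq> {}" and c: "c > 0"
    using sys by (auto simp: n_system_def simple_polytope_def)
  obtain z where "z \<in> interior P" using int by blast
  then obtain \<rho> where \<rho>: "\<rho> > 0" "ball z \<rho> \<subseteq> P" using mem_interior by blast
  interpret polytope_system P z \<rho> c \<sigma>
    by unfold_locales (use \<rho> poly polytope_imp_convex polytope_imp_compact sys dim in auto)
  show ?thesis
    unfolding Mp_1_eq[OF c]
  proof (intro conjI allI impI)
    fix T :: real assume "T > 0"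
    then obtain u where u: "u \<in> X"
      "\<And>w. w \<in> M \<and> (\<forall>v\<in>M. free_energy P c \<sigma> T w \<le> free_energy P c \<sigma> T v) \<longleftrightarrow> w = u"
      by (rule free_energy_minimizer) blast
    \<comment> \<open>The integrability clause lies in the scope of \<open>\<exists>!\<close> but
      binds its own \<open>u\<close>; it is a closed condition, and \<open>conj_assoc\<close>
      regroups the rest so that the equivalence applies.\<close>
    show "\<exists>!u. u \<in> M \<and> (\<forall>v\<in>M. free_energy P c \<sigma> T u \<le> free_energy P c \<sigma> T v) \<and>
        (\<forall>u. u \<in> M \<and> (\<forall>v\<in>M. free_energy P c \<sigma> T u \<le> free_energy P c \<sigma> T v) \<longrightarrow>
           u \<in> Mp (real DIM('a) / (real DIM('a) - 1)) P c)"
      unfolding u(2) conj_assoc[symmetric] using Mp_q[OF u(1)] by simp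
  next
    obtain u where u: "u \<in> X"
      "\<And>w. w \<in> M \<and> (\<forall>v\<in>M. internal_energy P c \<sigma> w \<le> internal_energy P c \<sigma> v) \<and>
        entropy P c w = Sup {entropy P c v | v. v \<in> M \<and> internal_energy P c \<sigma> v = (INF w\<in>M. internal_energy P c \<sigma> w)}
      \<longleftrightarrow> w = u"
      by (rule ground_state) blast
    show "\<exists>!w. w \<in> M \<and> (\<forall>v\<in>M. internal_energy P c \<sigma> w \<le> internal_energy P c \<sigma> v) \<and>
        entropy P c w = Sup {entropy P c v | v. v \<in> M \<and> internal_energy P c \<sigma> v = (INF w\<in>M. internal_energy P c \<sigma> w)}"
      unfolding u(2) by simp
    fix w assume "w \<in> M \<and> (\<forall>v\<in>M. internal_energy P c \<sigma> w \<le> internal_energy P c \<sigma> v) \<and>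
        entropy P c w = Sup {entropy P c v | v. v \<in> M \<and> internal_energy P c \<sigma> v = (INF w\<in>M. internal_energy P c \<sigma> w)}"
    then show "w \<in> Mp (real DIM('a) / (real DIM('a) - 1)) P c"
      unfolding u(2) using Mp_q[OF u(1)] by simp
  qed
qed

end
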